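(* Let $r_1,\ldots,r_m\in(0,\infty)$, $s_1,\ldots,s_m\in(0,\infty]$ with $r_j<s_j$, and $p_j\in[r_j,s_j]$ for $j\in\{1,\ldots,m\}$ with $\frac1p:=\sum_{j=1}^m\frac1{p_j}$. Let $(\Omega,|\cdot|)$ be a $\sigma$-finite measure space with a basis of sets $\mathcal{E}$. Let $V_j$ be sets and $S_j:V_j\to L^0(\Omega)$ maps. Suppose \[ T:\bigcup_{w_1\in A_{p_1,(r_1,s_1)}(\mathcal{E})}S_1^{-1}(L^{p_1}_{w_1}(\Omega))\times\cdots\times\bigcup_{w_m\in A_{p_m,(r_m,s_m)}(\mathcal{E})}S_m^{-1}(L^{p_m}_{w_m}(\Omega))\to L^0(\Omega) \] is a map for which there is an increasing function $\phi:[0,\infty)^m\to[0,\infty)$ such that for all $w_j\in A_{p_j,(r_j,s_j)}(\mathcal{E})$ and $f_j\in V_j$ with $S_jf_j\in L^{p_j}_{w_j}(\Omega)$, $j\in\{1,\ldots,m\}$, with $w=\prod_{j=1}^mw_j$, \[ \|T(f_1,\ldots,f_m)\|_{L^p_w(\Omega)}\leq\phi([w_1]^{\mathcal{E}}_{p_1,(r_1,s_1)},\ldots,[w_m]^{\mathcal{E}}_{p_m,(r_m,s_m)})\prod_{j=1}^m\|S_jf_j\|_{L^{p_j}_{w_j}(\Omega)}. \] Let $X_1,\ldots,X_m$ be quasi-Banach function spaces over $\Omega$ such that $X_j$ is $r_j$-convex and $s_j$-concave and, for all $j$: if $p_j\neq r_j$, then $M^{\mathcal{E}}:(X_j)_{r_j,s_j}\to(X_j)_{r_j,s_j}$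 is bounded; and if $p_j\neq s_j$, then $M^{\mathcal{E}}:[(X_j)_{r_j,s_j}]'\to[(X_j)_{r_j,s_j}]'$ is bounded. Let $X=\prod_{j=1}^mX_j$. Then $T(f_1,\ldots,f_m)$ is well-defined for all $f_j\in V_j$ with $S_jf_j\in X_j$, and \[ \|T(f_1,\ldots,f_m)\|_X\leq2^{\frac1r-\frac1s}\phi(C_1,\ldots,C_m)\prod_{j=1}^m\|S_jf_j\|_{X_j}, \] where $\frac1r=\sum_j\frac1{r_j}$, $\frac1s=\sum_j\frac1{s_j}$, and \[ C_j=2^{\frac1{r_j}-\frac1{s_j}}\|M^{\mathcal{E}}\|_{(X_j)_{r_j,s_j}\to(X_j)_{r_j,s_j}}^{\frac1{r_j}-\frac1{p_j}}\|M^{\mathcal{E}}\|_{[(X_j)_{r_j,s_j}]'\to[(X_j)_{r_j,s_j}]'}^{\frac1{p_j}-\frac1{s_j}}. \]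
   Context: Conventions: $\frac1\infty=0$, $\frac10=\infty$; factors raised to the power $0$ are read as $1$. A weight is a measurable function with $0<w<\infty$ a.e.; $L^0(\Omega)$: a.e. finite measurable functions; $\|f\|_{L^p_w}=\|fw\|_{L^p}$. Increasing for $\phi$ on $[0,\infty)^m$ means increasing in each variable. A basis of sets in $\Omega$ is a collection $\mathcal{E}$ of measurable sets $E$ with $0<|E|<\infty$ such that (1) $\bigcup_{E\in\mathcal{E}}E=\Omega$; (2) any $x_1,x_2\in\Omega$ lie in a common $E\in\mathcal{E}$; (3) there is a countable $\mathcal{E}'\subseteq\mathcal{E}$ such that for all $\varepsilon>0$, $E\in\mathcal{E}$ there is $E'\in\mathcal{E}'$ with $E\subseteq E'$, $|E'|\le(1+\varepsilon)|E|$. $\langle f\rangle_{p,E}=|E|^{-1/p}\|f\mathbf{1}_E\|_{L^p(\Omega)}$, $M^{\mathcal{E}}f=\sup_{E\in\mathcal{E}}\langle f\rangle_{1,E}\mathbf{1}_E$. $w\in A_{p,(r,s)}(\mathcal{E})$ iff $[w]^{\mathcal{E}}_{p,(r,s)}=\sup_{E\in\mathcal{E}}\langle w^{-1}\rangle_{\frac1{\frac1r-\frac1p},E}\langle w\rangle_{\frac1{\frac1p-\frac1s},E}<\infty$. A quasi-Banach function space over $\Omega$ is a vector space $X\subseteq L^0(\Omega)$ with a quasi-norm such that: (ideal) $f\in X$, $g\in L^0$, $|g|\le|f|$ imply $g\in X$, $\|g\|_X\le\|f\|_X$; (Fatou) $0\le f_n\uparrow f$, $f_n\in X$, $\sup_n\|f_n\|_X<\infty$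 imply $f\in X$, $\|f\|_X=\sup_n\|f_n\|_X$; (saturation) every measurable set of positive measure contains a measurable $F$ of positive measure with $\mathbf{1}_F\in X$. $X'=\{g\in L^0: fg\in L^1\ \forall f\in X\}$, $\|g\|_{X'}=\sup_{\|f\|_X=1}\|fg\|_{L^1}$. For $t\in(0,\infty)$, $X^t=\{f:|f|^{1/t}\in X\}$, $\|f\|_{X^t}=\||f|^{1/t}\|_X^t$. $X$ is $p$-convex if $\|(|f|^p+|g|^p)^{1/p}\|_X\le(\|f\|_X^p+\|g\|_X^p)^{1/p}$ and $q$-concave if $(\|f\|_X^q+\|g\|_X^q)^{1/q}\le\|(|f|^q+|g|^q)^{1/q}\|_X$ for all $f,g\in X$ (usual modification for $\infty$). For $r<s$, $X_{r,s}=\big[[(X^r)']^{(s/r)'}\big]'$ with $(s/r)'=\frac1{1-r/s}$. $\prod_jX_j$ is the set of $f\in L^0$ with $|f|\le\prod_jf_j$ for some $0\le f_j\in X_j$, with $\|f\|=\inf\prod_j\|f_j\|_{X_j}$. *)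

theory Defs
  imports "HOL-Probability.Essential_Supremum"
begin

text \<open>
  Scalars are a type \<open>'k\<close> of class \<open>real_normed_field\<close>, so that both real- and complex-valued
  functions are covered. Members of \<open>L\<^sup>0\<close> are represented by functions; the a.e. identification
  is built into the definitions, all pointwise relations being required a.e. only.
  Exponents in \<open>(0,\<infinity>]\<close> have type \<^typ>\<open>ennreal\<close>, where \<open>inverse 0 = \<infinity>\<close> and \<open>inverse \<infinity> = 0\<close>.
\<close>

text \<open>Powers on \<open>[0,\<infinity>]\<close> with exponent \<open>t \<ge> 0\<close>; exponent \<open>0\<close> gives \<open>1\<close>, also for the bases \<open>0\<close> and
  \<open>\<infinity>\<close> (note that \<open>0 powr 0 = 0\<close> in the library).\<close>

definition epow :: "ennreal \<Rightarrow> real \<Rightarrow> ennreal" where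
  "epow a t = (if t = 0 then 1 else if a = \<infinity> then \<infinity> else ennreal (enn2real a powr t))"

abbreviation emb :: "('a \<Rightarrow> real) \<Rightarrow> 'a \<Rightarrow> 'k::real_normed_field" where
  "emb u \<equiv> (\<lambda>x. of_real (u x))"


subsection \<open>Lebesgue spaces, weights and bases of sets\<close>

definition L0 :: "'a measure \<Rightarrow> ('a \<Rightarrow> 'k::{real_normed_field,second_countable_topology}) set" where
  "L0 M = borel_measurable M"

definition Lnorm :: "'a measure \<Rightarrow> ennreal \<Rightarrow> ('a \<Rightarrow> 'b::real_normed_vector) \<Rightarrow> ennreal" where
  "Lnorm M p f =
     (if p = \<infinity> then esssup M (\<lambda>x. ennreal (norm (f x)))
      else epow (\<integral>\<^sup>+x. epow (ennreal (norm (f x))) (enn2real p) \<partial>M) (1 / enn2real p))"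

definition weight :: "'a measure \<Rightarrow> ('a \<Rightarrow> real) \<Rightarrow> bool" where
  "weight M w \<longleftrightarrow> w \<in> borel_measurable M \<and> (AE x in M. 0 < w x)"

definition wLnorm :: "'a measure \<Rightarrow> ennreal \<Rightarrow> ('a \<Rightarrow> real) \<Rightarrow> ('a \<Rightarrow> 'k::real_normed_field) \<Rightarrow> ennreal"
  where "wLnorm M p w f = Lnorm M p (\<lambda>x. w x *\<^sub>R f x)"

definition wLp :: "'a measure \<Rightarrow> ennreal \<Rightarrow> ('a \<Rightarrow> real)
    \<Rightarrow> ('a \<Rightarrow> 'k::{real_normed_field,second_countable_topology}) set" where
  "wLp M p w = {f \<in> L0 M. wLnorm M p w f < \<infinity>}"

definition set_basis :: "'a measure \<Rightarrow> 'a set set \<Rightarrow> bool" where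
  "set_basis M \<E> \<longleftrightarrow>
     (\<forall>E\<in>\<E>. E \<in> sets M \<and> 0 < emeasure M E \<and> emeasure M E < \<infinity>) \<and>
     \<Union>\<E> = space M \<and>
     (\<forall>x\<in>space M. \<forall>y\<in>space M. \<exists>E\<in>\<E>. x \<in> E \<and> y \<in> E) \<and>
     (\<exists>\<E>'\<subseteq>\<E>. countable \<E>' \<and>
        (\<forall>\<epsilon>>0. \<forall>E\<in>\<E>. \<exists>E'\<in>\<E>'. E \<subseteq> E' \<and> emeasure M E' \<le> ennreal (1 + \<epsilon>) * emeasure M E))"

definition avg :: "'a measure \<Rightarrow> ennreal \<Rightarrow> 'a set \<Rightarrow> ('a \<Rightarrow> 'b::real_normed_vector) \<Rightarrow> ennreal" where
  "avg M p E f =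
     Lnorm M p (\<lambda>x. indicator E x *\<^sub>R f x) / epow (emeasure M E) (enn2real (inverse p))"

definition maximal :: "'a measure \<Rightarrow> 'a set set \<Rightarrow> ('a \<Rightarrow> 'b::real_normed_vector) \<Rightarrow> 'a \<Rightarrow> ennreal" where
  "maximal M \<E> f x = (SUP E\<in>\<E>. avg M 1 E f * indicator E x)"

definition Ap_const :: "'a measure \<Rightarrow> 'a set set \<Rightarrow> ennreal \<Rightarrow> real \<Rightarrow> ennreal \<Rightarrow> ('a \<Rightarrow> real) \<Rightarrow> ennreal"
  where
  "Ap_const M \<E> p r s w =
     (SUP E\<in>\<E>. avg M (inverse (inverse (ennreal r) - inverse p)) E (\<lambda>x. inverse (w x))
              * avg M (inverse (inverse p - inverse s)) E w)"

definition Ap :: "'a measure \<Rightarrow> 'a set set \<Rightarrow> ennreal \<Rightarrow> real \<Rightarrow> ennreal \<Rightarrow> ('a \<Rightarrow> real) set" where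
  "Ap M \<E> p r s = {w. weight M w \<and> Ap_const M \<E> p r s w < \<infinity>}"


subsection \<open>Quasi-Banach function spaces\<close>

text \<open>The norm is \<open>[0,\<infinity>]\<close>-valued and only meaningful on the carrier.\<close>

record ('a, 'k) fspace =
  carr :: "('a \<Rightarrow> 'k) set"
  nrm :: "('a \<Rightarrow> 'k) \<Rightarrow> ennreal"

definition quasi_normed_on :: "'a measure \<Rightarrow> ('a, 'k::real_normed_field) fspace \<Rightarrow> bool" where
  "quasi_normed_on M X \<longleftrightarrow>
     (\<lambda>x. 0) \<in> carr X \<and>
     (\<forall>f\<in>carr X. \<forall>g\<in>carr X. (\<lambda>x. f x + g x) \<in> carr X) \<and>
     (\<forall>c. \<forall>f\<in>carr X. (\<lambda>x. c * f x) \<in> carr X) \<and>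
     (\<forall>f\<in>carr X. nrm X f < \<infinity>) \<and>
     (\<forall>f\<in>carr X. nrm X f = 0 \<longleftrightarrow> (AE x in M. f x = 0)) \<and>
     (\<forall>c. \<forall>f\<in>carr X. nrm X (\<lambda>x. c * f x) = ennreal (norm c) * nrm X f) \<and>
     (\<exists>K::real. \<forall>f\<in>carr X. \<forall>g\<in>carr X.
        nrm X (\<lambda>x. f x + g x) \<le> ennreal K * (nrm X f + nrm X g))"

text \<open>In the Fatou property below the limit \<open>v\<close> is assumed a.e. finite. Given saturation, this
  implies the variant in which finiteness of the limit is part of the conclusion.\<close>

definition qBfs :: "'a measure \<Rightarrow> ('a, 'k::{real_normed_field,second_countable_topology}) fspace \<Rightarrow> bool"
  where
  "qBfs M X \<longleftrightarrow>
     carr X \<subseteq> L0 M \<and> quasi_normed_on M X \<and>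
     (\<forall>f\<in>carr X. \<forall>g\<in>L0 M. (AE x in M. norm (g x) \<le> norm (f x)) \<longrightarrow>
        g \<in> carr X \<and> nrm X g \<le> nrm X f) \<and>
     (\<forall>(u :: nat \<Rightarrow> 'a \<Rightarrow> real) v.
        (\<forall>n. emb (u n) \<in> carr X) \<and> v \<in> borel_measurable M \<and>
        (AE x in M. \<forall>n. 0 \<le> u n x) \<and>
        (AE x in M. incseq (\<lambda>n. u n x) \<and> (\<lambda>n. u n x) \<longlonglongrightarrow> v x) \<and>
        (SUP n. nrm X (emb (u n))) < \<infinity> \<longrightarrow>
        emb v \<in> carr X \<and> nrm X (emb v) = (SUP n. nrm X (emb (u n)))) \<and>
     (\<forall>A\<in>sets M. 0 < emeasure M A \<longrightarrow>
        (\<exists>F\<in>sets M. F \<subseteq> A \<and> 0 < emeasure M F \<and> indicator F \<in> carr X))"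

definition lp_pair :: "ennreal \<Rightarrow> ennreal \<Rightarrow> ennreal \<Rightarrow> ennreal" where
  "lp_pair p a b = (if p = \<infinity> then max a b
     else epow (epow a (enn2real p) + epow b (enn2real p)) (1 / enn2real p))"

definition lp_pair_fun :: "ennreal \<Rightarrow> ('a \<Rightarrow> 'k::real_normed_field) \<Rightarrow> ('a \<Rightarrow> 'k) \<Rightarrow> 'a \<Rightarrow> 'k" where
  "lp_pair_fun p f g = emb (\<lambda>x. enn2real (lp_pair p (ennreal (norm (f x))) (ennreal (norm (g x)))))"

definition p_convex :: "ennreal \<Rightarrow> ('a, 'k::real_normed_field) fspace \<Rightarrow> bool" where
  "p_convex p X \<longleftrightarrow>
     (\<forall>f\<in>carr X. \<forall>g\<in>carr X. nrm X (lp_pair_fun p f g) \<le> lp_pair p (nrm X f) (nrm X g))"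

definition q_concave :: "ennreal \<Rightarrow> ('a, 'k::real_normed_field) fspace \<Rightarrow> bool" where
  "q_concave q X \<longleftrightarrow>
     (\<forall>f\<in>carr X. \<forall>g\<in>carr X. lp_pair q (nrm X f) (nrm X g) \<le> nrm X (lp_pair_fun q f g))"

definition kdual :: "'a measure \<Rightarrow> ('a, 'k::{real_normed_field,second_countable_topology}) fspace
    \<Rightarrow> ('a, 'k) fspace" where
  "kdual M X = \<lparr> carr = {g \<in> L0 M. \<forall>f\<in>carr X. Lnorm M 1 (\<lambda>x. f x * g x) < \<infinity>},
                 nrm = (\<lambda>g. SUP f\<in>{f \<in> carr X. nrm X f = 1}. Lnorm M 1 (\<lambda>x. f x * g x)) \<rparr>"

definition space_pow :: "'a measure \<Rightarrow> real \<Rightarrow> ('a, 'k::{real_normed_field,second_countable_topology}) fspace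
    \<Rightarrow> ('a, 'k) fspace" where
  "space_pow M t X = \<lparr> carr = {f \<in> L0 M. emb (\<lambda>x. norm (f x) powr (1 / t)) \<in> carr X},
                       nrm = (\<lambda>f. epow (nrm X (emb (\<lambda>x. norm (f x) powr (1 / t)))) t) \<rparr>"

text \<open>The exponent is \<open>(s/r)' = 1 / (1 - r/s)\<close>, which equals \<open>1\<close> for \<open>s = \<infinity>\<close>.\<close>

definition space_rs :: "'a measure \<Rightarrow> real \<Rightarrow> ennreal
    \<Rightarrow> ('a, 'k::{real_normed_field,second_countable_topology}) fspace \<Rightarrow> ('a, 'k) fspace" where
  "space_rs M r s X =
     kdual M (space_pow M (1 / (1 - r * enn2real (inverse s))) (kdual M (space_pow M r X)))"

definition space_prod :: "'a measure \<Rightarrow> ('m::finite \<Rightarrow> ('a, 'k::{real_normed_field,second_countable_topology}) fspace)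
    \<Rightarrow> ('a, 'k) fspace" where
  "space_prod M X =
     (let dom = (\<lambda>f. {g :: 'm \<Rightarrow> 'a \<Rightarrow> real.
                   (\<forall>j. emb (g j) \<in> carr (X j) \<and> (AE x in M. 0 \<le> g j x)) \<and>
                   (AE x in M. norm (f x) \<le> (\<Prod>j\<in>UNIV. g j x))})
      in \<lparr> carr = {f \<in> L0 M. dom f \<noteq> {}},
           nrm = (\<lambda>f. INF g\<in>dom f. \<Prod>j\<in>UNIV. nrm (X j) (emb (g j))) \<rparr>)"


subsection \<open>Boundedness of the maximal operator\<close>

definition maximal_fun :: "'a measure \<Rightarrow> 'a set set \<Rightarrow> ('a \<Rightarrow> 'k::real_normed_field) \<Rightarrow> 'a \<Rightarrow> 'k" where
  "maximal_fun M \<E> f = emb (\<lambda>x. enn2real (maximal M \<E> f x))"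

definition maximal_norm :: "'a measure \<Rightarrow> 'a set set \<Rightarrow> ('a, 'k::real_normed_field) fspace \<Rightarrow> ennreal"
  where
  "maximal_norm M \<E> Y = Inf {C. \<forall>f\<in>carr Y. nrm Y (maximal_fun M \<E> f) \<le> C * nrm Y f}"

text \<open>\<^const>\<open>maximal_fun\<close> sends the value \<open>\<infinity>\<close> of the maximal function to \<open>0\<close>, so a.e. finiteness is
  demanded separately.\<close>

definition maximal_bounded :: "'a measure \<Rightarrow> 'a set set \<Rightarrow> ('a, 'k::real_normed_field) fspace \<Rightarrow> bool"
  where
  "maximal_bounded M \<E> Y \<longleftrightarrow>
     (\<forall>f\<in>carr Y. (AE x in M. maximal M \<E> f x < \<infinity>) \<and> maximal_fun M \<E> f \<in> carr Y) \<and>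
     maximal_norm M \<E> Y < \<infinity>"


subsection \<open>Multivariable data\<close>

definition increasing_nonneg :: "(('m \<Rightarrow> real) \<Rightarrow> real) \<Rightarrow> bool" where
  "increasing_nonneg \<phi> \<longleftrightarrow>
     (\<forall>x. (\<forall>j. 0 \<le> x j) \<longrightarrow> 0 \<le> \<phi> x \<and> (\<forall>j. mono_on {0..} (\<lambda>t. \<phi> (x(j := t)))))"

definition T_domain :: "'a measure \<Rightarrow> 'a set set \<Rightarrow> ('m \<Rightarrow> ennreal) \<Rightarrow> ('m \<Rightarrow> real) \<Rightarrow> ('m \<Rightarrow> ennreal)
    \<Rightarrow> ('m \<Rightarrow> 'v set) \<Rightarrow> ('m \<Rightarrow> 'v \<Rightarrow> 'a \<Rightarrow> 'k::{real_normed_field,second_countable_topology})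
    \<Rightarrow> ('m \<Rightarrow> 'v) set" where
  "T_domain M \<E> p r s V S =
     (\<Pi> j\<in>UNIV. \<Union>w\<in>Ap M \<E> (p j) (r j) (s j). {v \<in> V j. S j v \<in> wLp M (p j) w})"

definition extrap_const :: "'a measure \<Rightarrow> 'a set set \<Rightarrow> ennreal \<Rightarrow> real \<Rightarrow> ennreal
    \<Rightarrow> ('a, 'k::{real_normed_field,second_countable_topology}) fspace \<Rightarrow> real" where
  "extrap_const M \<E> p r s X =
     2 powr (1 / r - enn2real (inverse s))
     * enn2real (epow (maximal_norm M \<E> (space_rs M r s X)) (1 / r - enn2real (inverse p)))
     * enn2real (epow (maximal_norm M \<E> (kdual M (space_rs M r s X)))
                   (enn2real (inverse p) - enn2real (inverse s)))"

end

theory Submission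
  imports Defs
begin

text \<open>
  Write \<open>\<alpha> = 1/r - 1/p\<close> and \<open>\<beta> = 1/p - 1/s\<close>, and let \<open>Y = X\<^bsub>r,s\<^esub>\<close>. Lozanovskii's duality for Calderon
  products gives \<open>X = Y\<^bsup>\<alpha>+\<beta>\<^esup> \<cdot> L\<^sup>s\<close>, so up to \<open>\<epsilon>\<close> each \<open>f \<in> X\<close> is \<open>h\<^bsup>\<alpha>+\<beta>\<^esup> g\<close>. Given moreover a test
  function \<open>u = k\<^bsup>\<alpha>+\<beta>\<^esup>\<close> with \<open>k \<in> Y'\<close>, the Rubio de Francia algorithm replaces \<open>h\<close> and \<open>k\<close> by
  majorants of class \<open>A\<^sub>1\<close>, and \<open>w = h\<^bsup>-\<alpha>\<^esup> k\<^bsup>\<beta>\<^esup>\<close> is a weight with the required constant for which \<open>f\<close> lies in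
  \<open>L\<^sup>p\<^sub>w\<close> and \<open>u \<le> w (h k)\<^bsup>\<alpha>\<^esup>\<close>. Applying the hypothesis with these weights and Hoelder's inequality bounds
  the \<open>L\<^sup>r\<close> norm of \<open>T(f\<^sub>1,\<dots>,f\<^sub>m) \<Prod>\<^sub>j u\<^sub>j\<close>, and a second use of Lozanovskii's duality turns
  this into membership in \<open>\<Prod>\<^sub>j X\<^sub>j\<close>.
\<close>

section \<open>Weighted means and almost everywhere convergence\<close>

text \<open>The spaces \<open>X j\<close> are only quasi-Banach and \<open>T\<close> is an arbitrary
  map, so neither duality in \<open>X\<close> nor linearity of \<open>T\<close> can be invoked.
  Duality comes from convexity: \<open>r\<close>-convexity makes the unit ball of \<open>X^r\<close>
  convex and the Fatou property closes it under almost everywhere limits, so that it equals its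
  bipolar; the test functions are roots of members of its polar. Concavity makes the unit ball of
  \<open>U = [(X^r)']^((s/r)')\<close> convex, and this is what lets Lozanovskii's argument split
  \<open>X\<close> into a power of \<open>U'\<close> and \<open>L^s\<close>.

  The algorithm loses a factor 2 in two places. Its majorant has \<open>A_1\<close> constant
  \<open>2 ||M||\<close>, which gives the power of 2 in \<open>C_j\<close>. Its pairing with the
  dual unit ball is bounded by 2, which gives \<open>2^\<beta>\<close> in the weighted norm of
  \<open>f\<close> and \<open>2^\<alpha>\<close> in Hoelder's inequality, together
  \<open>2^(1/r - 1/s)\<close>. The loss is no larger because each integral pairs one majorant with
  one original function.

  The exponent \<alpha> or \<beta> is then 0, and the constant 1 takes the place of the
  majorant.\<close>

lemma prod_powr_le_weighted_sum:
  fixes \<theta> a :: "'i \<Rightarrow> real"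
  assumes I: "finite I" and th: "\<And>i. i \<in> I \<Longrightarrow> 0 \<le> \<theta> i" and sum1: "(\<Sum>i\<in>I. \<theta> i) = 1"
    and a: "\<And>i. i \<in> I \<Longrightarrow> 0 \<le> a i"
  shows "(\<Prod>i\<in>I. a i powr \<theta> i) \<le> (\<Sum>i\<in>I. \<theta> i * a i)"
\<comment> \<open>A zero base makes the product vanish even where \<open>\<theta> i = 0\<close>,
  since \<open>0 powr 0 = 0\<close>; otherwise logarithms exist and convexity of \<open>exp\<close>
  applies.\<close>
proof (cases "\<exists>i\<in>I. a i = 0")
  case True
  then have "(\<Prod>i\<in>I. a i powr \<theta> i) = 0"
    using I by (auto simp: prod_zero_iff)
  moreover have "0 \<le> (\<Sum>i\<in>I. \<theta> i * a i)"
    using th a by (intro sum_nonneg) auto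
  ultimately show ?thesis by simp
next
  case False
  then have pos: "\<And>i. i \<in> I \<Longrightarrow> 0 < a i" using a by (metis less_eq_real_def)
  have "(\<Prod>i\<in>I. a i powr \<theta> i) = (\<Prod>i\<in>I. exp (\<theta> i * ln (a i)))"
    by (intro prod.cong refl) (use pos in \<open>force simp: powr_def\<close>)
  also have "\<dots> = exp (\<Sum>i\<in>I. \<theta> i *\<^sub>R ln (a i))"
    using I by (simp add: exp_sum)
  also have "\<dots> \<le> (\<Sum>i\<in>I. \<theta> i * exp (ln (a i)))"
    using I th sum1 by (intro convex_on_sum[OF _ _ exp_convex]) auto
  also have "\<dots> = (\<Sum>i\<in>I. \<theta> i * a i)"
    using pos by (intro sum.cong refl) (simp add: exp_ln)
  finally show ?thesis .
qed

text \<open>Hoelder's inequality for several factors: the weighted arithmetic-geometric inequality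
  for \<open>A i x / c i\<close>, integrated. The integral bound is asked only where
  \<open>0 < \<theta> i\<close>, because at endpoint exponents nothing is known about the integral
  of the corresponding factor.\<close>

lemma nn_integral_prod_powr_le:
  fixes A :: "'i \<Rightarrow> 'a \<Rightarrow> real"
  assumes I: "finite I" and th: "\<And>i. i \<in> I \<Longrightarrow> 0 \<le> \<theta> i" and sum1: "(\<Sum>i\<in>I. \<theta> i) = 1"
    and [measurable]: "\<And>i. i \<in> I \<Longrightarrow> A i \<in> borel_measurable M"
    and A: "\<And>i x. i \<in> I \<Longrightarrow> 0 \<le> A i x"
    and c: "\<And>i. i \<in> I \<Longrightarrow> 0 < c i"
    and int: "\<And>i. i \<in> I \<Longrightarrow> 0 < \<theta> i \<Longrightarrow> (\<integral>\<^sup>+x. ennreal (A i x) \<partial>M) \<le> ennreal (c i)"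
  shows "(\<integral>\<^sup>+x. ennreal (\<Prod>i\<in>I. A i x powr \<theta> i) \<partial>M) \<le> ennreal (\<Prod>i\<in>I. c i powr \<theta> i)"
proof -
  define P where "P = (\<Prod>i\<in>I. c i powr \<theta> i)"
  have P: "0 \<le> P" unfolding P_def by (intro prod_nonneg) auto
  have pw: "(\<Prod>i\<in>I. A i x powr \<theta> i) \<le> P * (\<Sum>i\<in>I. \<theta> i / c i * A i x)" for x
  proof -
    have "(\<Prod>i\<in>I. A i x powr \<theta> i) = (\<Prod>i\<in>I. c i powr \<theta> i * (A i x / c i) powr \<theta> i)"
    proof (intro prod.cong refl)
      fix i assume i: "i \<in> I"
      have "c i powr \<theta> i * (A i x / c i) powr \<theta> i = (c i * (A i x / c i)) powr \<theta> i"
        by (rule powr_mult[symmetric])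
      then show "A i x powr \<theta> i = c i powr \<theta> i * (A i x / c i) powr \<theta> i"
        using c[OF i] by simp
    qed
    also have "\<dots> = P * (\<Prod>i\<in>I. (A i x / c i) powr \<theta> i)"
      by (simp add: prod.distrib P_def)
    also have "\<dots> \<le> P * (\<Sum>i\<in>I. \<theta> i * (A i x / c i))"
      using I th sum1 A c P by (intro mult_left_mono prod_powr_le_weighted_sum) (auto simp: less_imp_le)
    finally show ?thesis by simp
  qed
  have "(\<integral>\<^sup>+x. ennreal (\<Prod>i\<in>I. A i x powr \<theta> i) \<partial>M)
      \<le> (\<integral>\<^sup>+x. ennreal P * (\<Sum>i\<in>I. ennreal (\<theta> i / c i) * ennreal (A i x)) \<partial>M)"
  proof (intro nn_integral_mono)
    fix x
    have "ennreal (\<Prod>i\<in>I. A i x powr \<theta> i) \<le> ennreal (P * (\<Sum>i\<in>I. \<theta> i / c i * A i x))"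
      by (rule ennreal_leI[OF pw])
    also have "\<dots> = ennreal P * (\<Sum>i\<in>I. ennreal (\<theta> i / c i) * ennreal (A i x))"
    proof -
      have "ennreal (\<Sum>i\<in>I. \<theta> i / c i * A i x) = (\<Sum>i\<in>I. ennreal (\<theta> i / c i * A i x))"
        using A c th by (intro sum_ennreal[symmetric] mult_nonneg_nonneg divide_nonneg_pos) auto
      also have "\<dots> = (\<Sum>i\<in>I. ennreal (\<theta> i / c i) * ennreal (A i x))"
        using A c th by (intro sum.cong refl ennreal_mult' divide_nonneg_pos) auto
      finally show ?thesis using P by (simp add: ennreal_mult')
    qed
    finally show "ennreal (\<Prod>i\<in>I. A i x powr \<theta> i) \<le> \<dots>" .
  qed
  also have "\<dots> = ennreal P * (\<Sum>i\<in>I. ennreal (\<theta> i / c i) * (\<integral>\<^sup>+x. ennreal (A i x) \<partial>M))"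
    by (subst nn_integral_cmult, measurable, subst nn_integral_sum) (auto simp: nn_integral_cmult intro!: sum.cong)
  also have "\<dots> \<le> ennreal P * (\<Sum>i\<in>I. ennreal (\<theta> i))"
  proof (intro mult_left_mono sum_mono)
    fix i assume i: "i \<in> I"
    show "ennreal (\<theta> i / c i) * (\<integral>\<^sup>+x. ennreal (A i x) \<partial>M) \<le> ennreal (\<theta> i)"
    proof (cases "\<theta> i = 0")
      case False
      then have "0 < \<theta> i" using th[OF i] by simp
      then have "ennreal (\<theta> i / c i) * (\<integral>\<^sup>+x. ennreal (A i x) \<partial>M) \<le> ennreal (\<theta> i / c i) * ennreal (c i)"
        by (intro mult_left_mono int i) auto
      also have "\<dots> = ennreal (\<theta> i)"
        using c[OF i] \<open>0 < \<theta> i\<close> by (simp flip: ennreal_mult')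
      finally show ?thesis .
    qed simp
  qed simp
  also have "\<dots> = ennreal P"
    using th sum1 by (simp add: sum_ennreal)
  finally show ?thesis unfolding P_def .
qed

section \<open>Arithmetic of extended reals, and pointwise limits from integral bounds\<close>

lemma ennreal_add_halves: "(x::ennreal) / 2 + x / 2 = x"
proof (cases x)
  case (real r)
  then show ?thesis by (simp add: divide_ennreal flip: ennreal_numeral ennreal_plus)
qed (simp add: ennreal_top_divide)

lemma ennreal_le_4_times:
  assumes "(x::ennreal) / 4 \<le> y" shows "x \<le> 4 * y"
proof -
  have "x = 4 * (x / 4)"
  proof (cases x)
    case (real r)
    then show ?thesis by (simp add: divide_ennreal flip: ennreal_numeral ennreal_mult)
  qed (simp add: ennreal_top_divide ennreal_mult_top)
  also have "\<dots> \<le> 4 * y" using assms by (rule mult_left_mono) simp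
  finally show ?thesis .
qed

lemma ennreal_less_add_pos:
  assumes "x < \<infinity>" "0 < e" shows "x < x + ennreal e"
  using assms by (cases x) (auto simp: ennreal_less_iff simp flip: ennreal_plus)

text \<open>The series \<open>\<Sum>n. 2^n * f n\<close> has integral at most \<open>2 * C\<close>,
  hence is finite almost everywhere, and its value serves as \<open>c\<close>.\<close>

lemma AE_le_geometric:
  fixes f :: "nat \<Rightarrow> 'a \<Rightarrow> real"
  assumes [measurable]: "\<And>n. f n \<in> borel_measurable M"
    and C: "0 \<le> C" and int: "\<And>n. (\<integral>\<^sup>+x. ennreal (f n x) \<partial>M) \<le> ennreal (C / 4 ^ n)"
  shows "AE x in M. \<exists>c\<ge>0. \<forall>n. f n x \<le> c / 2 ^ n"
proof -
  have "(\<integral>\<^sup>+x. (\<Sum>n. ennreal (2 ^ n) * ennreal (f n x)) \<partial>M)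
      = (\<Sum>n. ennreal (2 ^ n) * (\<integral>\<^sup>+x. ennreal (f n x) \<partial>M))"
    by (subst nn_integral_suminf) (auto simp: nn_integral_cmult)
  also have "\<dots> \<le> (\<Sum>n. ennreal (C * (1/2) ^ n))"
  proof (intro suminf_le)
    fix n
    have "ennreal (2 ^ n) * (\<integral>\<^sup>+x. ennreal (f n x) \<partial>M) \<le> ennreal (2 ^ n) * ennreal (C / 4 ^ n)"
      by (intro mult_left_mono int) simp
    also have "\<dots> = ennreal (C * (1/2) ^ n)"
    proof -
      have "(4::real) ^ n = 2 ^ n * 2 ^ n" by (simp flip: power_mult_distrib)
      then show ?thesis using C by (simp flip: ennreal_mult' add: field_simps)
    qed
    finally show "ennreal (2 ^ n) * (\<integral>\<^sup>+x. ennreal (f n x) \<partial>M) \<le> ennreal (C * (1/2) ^ n)" .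
  qed auto
  also have "\<dots> = ennreal (\<Sum>n. C * (1/2) ^ n)"
    using C by (intro suminf_ennreal2) (auto intro!: summable_mult)
  also have "\<dots> < \<infinity>" by simp
  finally have "AE x in M. (\<Sum>n. ennreal (2 ^ n) * ennreal (f n x)) \<noteq> \<infinity>"
    by (intro nn_integral_PInf_AE) auto
  then show ?thesis
  proof eventually_elim
    case (elim x)
    define S where "S = (\<Sum>n. ennreal (2 ^ n) * ennreal (f n x))"
    have "f n x \<le> enn2real S / 2 ^ n" for n
    proof (cases "f n x \<le> 0")
      case True
      then show ?thesis by (meson divide_nonneg_nonneg enn2real_nonneg order_trans zero_le_numeral zero_le_power)
    next
      case False
      have "ennreal (2 ^ n) * ennreal (f n x) \<le> S"
        unfolding S_def using sum_le_suminf[of "\<lambda>n. ennreal (2 ^ n) * ennreal (f n x)" "{n}"] by simp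
      then have "ennreal (2 ^ n * f n x) \<le> ennreal (enn2real S)"
        using elim False unfolding S_def[symmetric] by (simp add: ennreal_mult' less_top)
      then have "2 ^ n * f n x \<le> enn2real S"
        by (simp add: ennreal_le_iff)
      then show ?thesis by (simp add: field_simps)
    qed
    then show ?case by (intro exI[of _ "enn2real S"]) auto
  qed
qed

lemma abs_le_of_weighted_square:
  fixes r d c :: real
  assumes "0 < r" "0 \<le> c" "r * d\<^sup>2 \<le> c / 2 ^ n"
  shows "\<bar>d\<bar> \<le> sqrt (c / r) * (sqrt (1/2)) ^ n"
proof -
  have "d\<^sup>2 \<le> c / r * (1/2) ^ n"
    using assms by (simp add: field_simps)
  then have "sqrt (d\<^sup>2) \<le> sqrt (c / r * (1/2) ^ n)" by (rule real_sqrt_le_mono)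
  moreover have "sqrt (c / r * (1/2) ^ n) = sqrt (c / r) * (sqrt (1/2)) ^ n"
    by (simp only: real_sqrt_mult real_sqrt_power)
  ultimately show ?thesis by (simp only: real_sqrt_abs)
qed

text \<open>Integrated squares of order \<open>4^-n\<close> yield pointwise squares of order
  \<open>2^-n\<close>, whose roots are dominated by a geometric series of ratio
  \<open>sqrt (1/2)\<close>. This takes the place of completeness of a weighted L2 space and gives
  pointwise limits directly.\<close>

lemma AE_summable_of_weighted_squares:
  fixes d :: "nat \<Rightarrow> 'a \<Rightarrow> real"
  assumes [measurable]: "\<And>n. d n \<in> borel_measurable M" "r \<in> borel_measurable M"
    and r: "\<And>x. 0 < r x" and C: "0 \<le> C"
    and int: "\<And>n. (\<integral>\<^sup>+x. ennreal (r x * (d n x)\<^sup>2) \<partial>M) \<le> ennreal (C / 4 ^ n)"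
  shows "AE x in M. summable (\<lambda>n. \<bar>d n x\<bar>)"
proof -
  have "AE x in M. \<exists>c\<ge>0. \<forall>n. r x * (d n x)\<^sup>2 \<le> c / 2 ^ n"
    by (rule AE_le_geometric[OF _ C int]) auto
  then show ?thesis
  proof eventually_elim
    case (elim x)
    then obtain c where c: "0 \<le> c" "\<And>n. r x * (d n x)\<^sup>2 \<le> c / 2 ^ n" by auto
    have "summable (\<lambda>n. sqrt (c / r x) * (sqrt (1/2)) ^ n)"
      by (intro summable_mult summable_geometric) (simp add: real_sqrt_divide)
    then show ?case
      by (rule summable_comparison_test'[where N=0]) (use abs_le_of_weighted_square[OF r c] in auto)
  qed
qed

lemma AE_convergent_of_weighted_squares:
  fixes z :: "nat \<Rightarrow> 'a \<Rightarrow> real"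
  assumes [measurable]: "\<And>n. z n \<in> borel_measurable M" "r \<in> borel_measurable M"
    and r: "\<And>x. 0 < r x" and C: "0 \<le> C"
    and int: "\<And>n. (\<integral>\<^sup>+x. ennreal (r x * (z (Suc n) x - z n x)\<^sup>2) \<partial>M) \<le> ennreal (C / 4 ^ n)"
  shows "AE x in M. convergent (\<lambda>n. z n x)"
proof -
  have "AE x in M. summable (\<lambda>n. \<bar>z (Suc n) x - z n x\<bar>)"
    by (rule AE_summable_of_weighted_squares[OF _ _ r C int]) auto
  then show ?thesis
  proof eventually_elim
    case (elim x)
    then have "summable (\<lambda>n. z (Suc n) x - z n x)" by (rule summable_rabs_cancel)
    then have "convergent (\<lambda>n. z n x - z 0 x)"
      unfolding summable_iff_convergent sum_lessThan_telescope[where f="\<lambda>n. z n x"] .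
    then have "convergent (\<lambda>n. (z n x - z 0 x) + z 0 x)"
      by (intro convergent_add convergent_const)
    then show ?case by simp
  qed
qed

text \<open>Fatou's lemma, in the form in which bounds for near-optimal sequences pass to their
  limits.\<close>

lemma nn_integral_le_of_AE_tendsto:
  fixes f :: "nat \<Rightarrow> 'a \<Rightarrow> ennreal"
  assumes [measurable]: "\<And>n. f n \<in> borel_measurable M"
    and lim: "AE x in M. (\<lambda>n. f n x) \<longlonglongrightarrow> g x"
    and le: "\<And>n. (\<integral>\<^sup>+x. f n x \<partial>M) \<le> c n" and c: "c \<longlonglongrightarrow> C"
  shows "(\<integral>\<^sup>+x. g x \<partial>M) \<le> C"
proof -
  have "(\<integral>\<^sup>+x. g x \<partial>M) = (\<integral>\<^sup>+x. liminf (\<lambda>n. f n x) \<partial>M)"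
    using lim by (intro nn_integral_cong_AE) (auto elim!: eventually_mono dest: lim_imp_Liminf[OF sequentially_bot])
  also have "\<dots> \<le> liminf (\<lambda>n. \<integral>\<^sup>+x. f n x \<partial>M)"
    by (rule nn_integral_liminf) auto
  also have "\<dots> \<le> liminf c"
    using le by (intro Liminf_mono) auto
  also have "\<dots> = C"
    using c by (intro lim_imp_Liminf) auto
  finally show ?thesis .
qed

section \<open>Polars and the bipolar theorem\<close>

text \<open>The positive part of the unit ball of an associate space (see
  \<open>pball_kdual\<close>). Members are nonnegative at every point, which keeps almost everywhere
  conditions out of the pairings.\<close>

definition polar :: "'a measure \<Rightarrow> ('a \<Rightarrow> real) set \<Rightarrow> ('a \<Rightarrow> real) set" where
  "polar M B = {g \<in> borel_measurable M. (\<forall>x. 0 \<le> g x) \<and>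
     (\<forall>b\<in>B. (\<integral>\<^sup>+x. ennreal (g x * b x) \<partial>M) \<le> 1)}"

text \<open>Models the positive part of the unit ball of a Banach function space with the Fatou
  property. It is stated for a set of functions, since the argument concerns the ball of
  \<open>X^r\<close>, whose convexity and closedness are what has to be established.\<close>

locale solid_ball =
  fixes M :: "'a measure" and B :: "('a \<Rightarrow> real) set"
  assumes meas [measurable_dest]: "b \<in> B \<Longrightarrow> b \<in> borel_measurable M"
    and nonneg: "b \<in> B \<Longrightarrow> 0 \<le> b x"
    and zero: "(\<lambda>x. 0) \<in> B"
    and convex: "b \<in> B \<Longrightarrow> c \<in> B \<Longrightarrow> 0 \<le> t \<Longrightarrow> t \<le> 1 \<Longrightarrow> (\<lambda>x. (1 - t) * b x + t * c x) \<in> B"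
    and solid: "b \<in> B \<Longrightarrow> c \<in> borel_measurable M \<Longrightarrow> (\<And>x. 0 \<le> c x) \<Longrightarrow> AE x in M. c x \<le> b x \<Longrightarrow> c \<in> B"
    and closed: "(\<And>n. bs n \<in> B) \<Longrightarrow> c \<in> borel_measurable M \<Longrightarrow> (\<And>x. 0 \<le> c x) \<Longrightarrow>
       AE x in M. (\<lambda>n. bs n x) \<longlonglongrightarrow> c x \<Longrightarrow> c \<in> B"
begin

lemma min_mem:
  assumes "b \<in> B" "f \<in> borel_measurable M" "\<And>x. 0 \<le> f x"
  shows "(\<lambda>x. min (b x) (f x)) \<in> B"
  using assms meas[OF assms(1)] nonneg[OF assms(1)] by (intro solid[OF assms(1)]) auto

text \<open>Here \<open>b\<close> is the nearest point to \<open>f\<close> of the ball in \<open>L\<^sup>2(\<sigma>)\<close>, where the density \<open>\<sigma>\<close> is chosen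
  such that \<open>f\<close> is square integrable; the last property is the first order condition.\<close>

lemma projection:
  assumes sf: "sigma_finite_measure M"
    and f [measurable]: "f \<in> borel_measurable M" and f0: "\<And>x. 0 \<le> f x"
  obtains b \<sigma> where "b \<in> B" "\<And>x. b x \<le> f x" "\<sigma> \<in> borel_measurable M" "\<And>x. (0::real) < \<sigma> x"
    "\<And>x. \<sigma> x * f x \<le> 1"
    "(\<integral>\<^sup>+x. ennreal (\<sigma> x * (f x - b x) * b x) \<partial>M) < \<infinity>"
    "\<And>c. c \<in> B \<Longrightarrow> (\<integral>\<^sup>+x. ennreal (\<sigma> x * (f x - b x) * c x) \<partial>M)
                  \<le> (\<integral>\<^sup>+x. ennreal (\<sigma> x * (f x - b x) * b x) \<partial>M)"
proof -
  obtain \<rho> :: "'a \<Rightarrow> real" where \<rho> [measurable]: "\<rho> \<in> borel_measurable M" and \<rho>0: "\<And>x. 0 < \<rho> x"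
    and \<rho>1: "\<And>x. \<rho> x \<le> 1" and \<rho>i: "integrable M \<rho>"
    using sigma_finite_measure.obtain_positive_integrable_function[OF sf] by metis
  \<comment> \<open>The quotient makes \<open>\<sigma> * f^2 \<le> \<rho>\<close> integrable and at
    the same time keeps \<open>\<sigma> * f \<le> 1\<close>.\<close>
  define \<sigma> where "\<sigma> x = \<rho> x / (1 + (f x)\<^sup>2)" for x
  have \<sigma>m [measurable]: "\<sigma> \<in> borel_measurable M" unfolding \<sigma>_def by measurable
  have den: "0 < 1 + (f x)\<^sup>2" for x by (simp add: add_pos_nonneg)
  have \<sigma>0: "0 < \<sigma> x" for x unfolding \<sigma>_def using \<rho>0 den by simp
  have \<sigma>ff: "\<sigma> x * (f x)\<^sup>2 \<le> \<rho> x" for x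
  proof -
    have "\<rho> x * (f x)\<^sup>2 \<le> \<rho> x * (1 + (f x)\<^sup>2)" using \<rho>0[of x] by (intro mult_left_mono) auto
    then show ?thesis using den[of x] by (simp add: \<sigma>_def field_simps)
  qed
  have \<sigma>f: "\<sigma> x * f x \<le> 1" for x
  proof -
    have "0 \<le> (f x - 1)\<^sup>2" by simp
    then have "2 * f x \<le> 1 + (f x)\<^sup>2" by (simp add: power2_eq_square algebra_simps)
    then have "f x \<le> 1 + (f x)\<^sup>2" using f0[of x] by linarith
    then have "\<rho> x * f x \<le> 1 * (1 + (f x)\<^sup>2)" using \<rho>0[of x] \<rho>1[of x] f0[of x]
      by (intro mult_mono) auto
    then show ?thesis using den[of x] by (simp add: \<sigma>_def field_simps)
  qed
  define I where "I b = (\<integral>\<^sup>+x. ennreal (\<sigma> x * (f x - b x)\<^sup>2) \<partial>M)" for b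
  define i where "i = (INF b\<in>B. I b)"
  have "(\<integral>\<^sup>+x. ennreal (\<rho> x) \<partial>M) < \<infinity>"
    using \<rho>i \<rho>0 by (simp add: nn_integral_eq_integral less_imp_le)
  moreover have "I (\<lambda>x. 0) \<le> (\<integral>\<^sup>+x. ennreal (\<rho> x) \<partial>M)"
    unfolding I_def using \<sigma>ff by (intro nn_integral_mono ennreal_leI) simp
  moreover have "i \<le> I (\<lambda>x. 0)" unfolding i_def using zero by (rule INF_lower)
  ultimately have ifin: "i < \<infinity>" by (meson le_less_trans)
  have iB: "i \<le> I b" if "b \<in> B" for b unfolding i_def using that by (rule INF_lower)
  \<comment> \<open>Cutting \<open>b\<close> off at \<open>f\<close> stays in the ball by solidity
    and does not increase the distance to \<open>f\<close>, so near-minimizers may be taken below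
    \<open>f\<close>.\<close>
  have "\<exists>b\<in>B. (\<forall>x. b x \<le> f x) \<and> I b \<le> i + ennreal (1 / 4 ^ n)" for n :: nat
  proof -
    have "i < i + ennreal (1 / 4 ^ n)"
      using ifin by (rule ennreal_less_add_pos) simp
    then obtain b where b: "b \<in> B" "I b < i + ennreal (1 / 4 ^ n)"
      unfolding i_def INF_less_iff by auto
    have "I (\<lambda>x. min (b x) (f x)) \<le> I b"
      unfolding I_def using \<sigma>0
      by (intro nn_integral_mono ennreal_leI mult_left_mono) (auto simp: min_def less_imp_le)
    then show ?thesis using b min_mem[OF b(1) f f0] by (intro bexI[of _ "\<lambda>x. min (b x) (f x)"]) auto
  qed
  then obtain bs where bs: "\<And>n. bs n \<in> B" "\<And>n x. bs n x \<le> f x" "\<And>n. I (bs n) \<le> i + ennreal (1 / 4 ^ n)"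
    by metis
  have bsm [measurable]: "bs n \<in> borel_measurable M" for n using meas[OF bs(1)] .
  \<comment> \<open>The parallelogram identity: the midpoint of two near-minimizers is no closer to
    \<open>f\<close> than the infimum, so their mutual distance is controlled by the excess
    \<eta>.\<close>
  have quad: "(\<integral>\<^sup>+x. ennreal (\<sigma> x * (b x - c x)\<^sup>2) \<partial>M) \<le> ennreal (4 * \<eta>)"
    if "b \<in> B" "c \<in> B" "I b \<le> i + ennreal \<eta>" "I c \<le> i + ennreal \<eta>" "0 \<le> \<eta>" for b c \<eta>
  proof -
    note [measurable] = meas[OF that(1)] meas[OF that(2)]
    let ?m = "\<lambda>x. (1 - 1/2) * b x + (1/2) * c x"
    have m: "?m \<in> B" by (rule convex) (use that in auto)
    have "i + (\<integral>\<^sup>+x. ennreal (\<sigma> x * (b x - c x)\<^sup>2) \<partial>M) / 4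
        \<le> I ?m + (\<integral>\<^sup>+x. ennreal (\<sigma> x * (b x - c x)\<^sup>2) \<partial>M) / 4"
      by (intro add_right_mono iB m)
    also have "\<dots> = (\<integral>\<^sup>+x. ennreal (\<sigma> x * (f x - ?m x)\<^sup>2) + ennreal (\<sigma> x * (b x - c x)\<^sup>2) / 4 \<partial>M)"
      unfolding I_def by (simp add: nn_integral_add nn_integral_divide)
    also have "\<dots> = (\<integral>\<^sup>+x. ennreal (\<sigma> x * (f x - b x)\<^sup>2) / 2 + ennreal (\<sigma> x * (f x - c x)\<^sup>2) / 2 \<partial>M)"
    proof (intro nn_integral_cong)
      fix x
      have "\<sigma> x * (f x - ?m x)\<^sup>2 + \<sigma> x * (b x - c x)\<^sup>2 / 4 = \<sigma> x * (f x - b x)\<^sup>2 / 2 + \<sigma> x * (f x - c x)\<^sup>2 / 2"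
        by (simp add: power2_eq_square field_simps)
      then have "ennreal (\<sigma> x * (f x - ?m x)\<^sup>2 + \<sigma> x * (b x - c x)\<^sup>2 / 4)
        = ennreal (\<sigma> x * (f x - b x)\<^sup>2 / 2 + \<sigma> x * (f x - c x)\<^sup>2 / 2)" by (rule arg_cong)
      then show "ennreal (\<sigma> x * (f x - ?m x)\<^sup>2) + ennreal (\<sigma> x * (b x - c x)\<^sup>2) / 4
        = ennreal (\<sigma> x * (f x - b x)\<^sup>2) / 2 + ennreal (\<sigma> x * (f x - c x)\<^sup>2) / 2"
        using \<sigma>0[of x] by (simp add: ennreal_plus divide_ennreal[symmetric] less_imp_le)
    qed
    also have "\<dots> = I b / 2 + I c / 2"
      unfolding I_def by (simp add: nn_integral_add nn_integral_divide)
    also have "\<dots> \<le> (i + ennreal \<eta>) / 2 + (i + ennreal \<eta>) / 2"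
      by (intro add_mono divide_right_mono_ennreal that)
    also have "\<dots> = i + ennreal \<eta>"
      by (rule ennreal_add_halves)
    finally have "(\<integral>\<^sup>+x. ennreal (\<sigma> x * (b x - c x)\<^sup>2) \<partial>M) / 4 \<le> ennreal \<eta>"
      using ifin by (auto simp: ennreal_add_left_cancel_le)
    then show ?thesis using that(5) ennreal_le_4_times by (simp add: ennreal_mult')
  qed
  have "AE x in M. convergent (\<lambda>n. bs n x)"
  proof (rule AE_convergent_of_weighted_squares[OF bsm \<sigma>m \<sigma>0, of 4])
    fix n
    have "i + ennreal (1 / 4 ^ Suc n) \<le> i + ennreal (1 / 4 ^ n)"
      by (intro add_left_mono ennreal_leI) (simp add: field_simps)
    then have "(\<integral>\<^sup>+x. ennreal (\<sigma> x * (bs (Suc n) x - bs n x)\<^sup>2) \<partial>M) \<le> ennreal (4 * (1 / 4 ^ n))"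
      using bs(3)[of "Suc n"] by (intro quad bs order_trans[OF bs(3)]) auto
    then show "(\<integral>\<^sup>+x. ennreal (\<sigma> x * (bs (Suc n) x - bs n x)\<^sup>2) \<partial>M) \<le> ennreal (4 / 4 ^ n)"
      by simp
  qed simp
  \<comment> \<open>\<open>lim\<close> is arbitrary where the sequence diverges; clamping to the
    interval from 0 to \<open>f x\<close> gives the pointwise bounds everywhere and changes nothing
    at points of convergence.\<close>
  define b where "b x = max 0 (min (lim (\<lambda>n. bs n x)) (f x))" for x
  have bm [measurable]: "b \<in> borel_measurable M" unfolding b_def by measurable
  have bf: "b x \<le> f x" and b0: "0 \<le> b x" for x using f0[of x] by (auto simp: b_def)
  have lim: "AE x in M. (\<lambda>n. bs n x) \<longlonglongrightarrow> b x"
    using \<open>AE x in M. convergent (\<lambda>n. bs n x)\<close>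
  proof eventually_elim
    case (elim x)
    then have l: "(\<lambda>n. bs n x) \<longlonglongrightarrow> lim (\<lambda>n. bs n x)" by (simp add: convergent_LIMSEQ_iff)
    moreover have "0 \<le> lim (\<lambda>n. bs n x)"
      using l nonneg[OF bs(1)] by (intro LIMSEQ_le_const) auto
    moreover have "lim (\<lambda>n. bs n x) \<le> f x"
      using l bs(2) by (intro LIMSEQ_le_const2) auto
    ultimately show ?case by (simp add: b_def)
  qed
  have bB: "b \<in> B" by (rule closed[OF bs(1) bm b0 lim])
  have "I b \<le> i"
    unfolding I_def
  proof (rule nn_integral_le_of_AE_tendsto)
    show "(\<integral>\<^sup>+x. ennreal (\<sigma> x * (f x - bs n x)\<^sup>2) \<partial>M) \<le> i + ennreal (1 / 4 ^ n)" for n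
      using bs(3)[of n] by (simp add: I_def)
    show "AE x in M. (\<lambda>n. ennreal (\<sigma> x * (f x - bs n x)\<^sup>2)) \<longlonglongrightarrow> ennreal (\<sigma> x * (f x - b x)\<^sup>2)"
      using lim by eventually_elim (intro tendsto_intros)
    have "(\<lambda>n. (1 / 4 :: real) ^ n) \<longlonglongrightarrow> 0" by (intro LIMSEQ_power_zero) simp
    then have "(\<lambda>n. i + ennreal (1 / 4 ^ n)) \<longlonglongrightarrow> i + ennreal 0"
      by (intro tendsto_intros) (simp add: power_divide)
    then show "(\<lambda>n. i + ennreal (1 / 4 ^ n)) \<longlonglongrightarrow> i" by simp
  qed measurable
  have int: "integrable M g" if [measurable]: "g \<in> borel_measurable M" and "\<And>x. \<bar>g x\<bar> \<le> K * \<rho> x" for g K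
    by (rule Bochner_Integration.integrable_bound[of M "\<lambda>x. K * \<rho> x"])
      (use \<rho>i that \<rho>0 in \<open>auto intro!: AE_I2 intro: order_trans[OF _ abs_ge_self]\<close>)
  have bnd: "\<bar>\<sigma> x * (u * v)\<bar> \<le> (J * K) * \<rho> x" if "\<bar>u\<bar> \<le> J * f x" "\<bar>v\<bar> \<le> K * f x" "0 \<le> J" "0 \<le> K" for x u v J K
  proof -
    have "\<bar>u * v\<bar> \<le> (J * f x) * (K * f x)" unfolding abs_mult using that f0[of x] by (intro mult_mono) auto
    then have "\<sigma> x * \<bar>u * v\<bar> \<le> \<sigma> x * ((J * f x) * (K * f x))"
      using \<sigma>0[of x] by (intro mult_left_mono) auto
    also have "\<dots> = (J * K) * (\<sigma> x * (f x)\<^sup>2)" by (simp add: power2_eq_square)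
    also have "\<dots> \<le> (J * K) * \<rho> x" using that by (intro mult_left_mono \<sigma>ff) auto
    finally show ?thesis using \<sigma>0[of x] by (simp add: abs_mult)
  qed
  have fb: "\<bar>f x - b x\<bar> \<le> 1 * f x" "\<bar>b x\<bar> \<le> 1 * f x" for x using bf[of x] b0[of x] by auto
  \<comment> \<open>For \<open>c \<le> N * f\<close> every integral is finite and the quadratic
    expansion can be done in the reals. General \<open>c\<close> follows by truncating at
    \<open>n * f\<close>.\<close>
  have var_bdd: "(\<integral>\<^sup>+x. ennreal (\<sigma> x * (f x - b x) * c x) \<partial>M) \<le> (\<integral>\<^sup>+x. ennreal (\<sigma> x * (f x - b x) * b x) \<partial>M)"
    if c: "c \<in> B" and N: "\<And>x. c x \<le> real N * f x" for c N
  proof -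
    note [measurable] = meas[OF c]
    have cN: "\<bar>c x\<bar> \<le> N * f x" for x using nonneg[OF c, of x] N[of x] by simp
    have cbN: "\<bar>c x - b x\<bar> \<le> (N + 1) * f x" for x
      using nonneg[OF c, of x] N[of x] b0[of x] bf[of x] f0[of x] by (auto simp: algebra_simps abs_le_iff)
    have i1: "integrable M (\<lambda>x. \<sigma> x * ((f x - b x) * c x))"
      by (rule int[OF _ bnd[OF fb(1) cN]]) auto
    have i2: "integrable M (\<lambda>x. \<sigma> x * ((f x - b x) * b x))"
      by (rule int[OF _ bnd[OF fb(1) fb(2)]]) auto
    have i3: "integrable M (\<lambda>x. \<sigma> x * ((c x - b x) * (c x - b x)))"
      by (rule int[OF _ bnd[OF cbN cbN]]) auto
    have i4: "integrable M (\<lambda>x. \<sigma> x * ((f x - b x) * (f x - b x)))"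
      by (rule int[OF _ bnd[OF fb(1) fb(1)]]) auto
    define D where "D = (\<integral>x. \<sigma> x * ((f x - b x) * c x) \<partial>M) - (\<integral>x. \<sigma> x * ((f x - b x) * b x) \<partial>M)"
    define R where "R = (\<integral>x. \<sigma> x * ((c x - b x) * (c x - b x)) \<partial>M)"
    \<comment> \<open>Minimality against the point \<open>(1 - t) * b + t * c\<close>: the quadratic
      terms in \<open>f - b\<close> cancel, and dividing by \<open>t\<close> leaves an error that
      tends to 0 with \<open>t\<close>.\<close>
    have scal: "2 * D \<le> t * R" if t: "0 < t" "t \<le> 1" for t
    proof -
      have eq: "\<sigma> x * ((f x - ((1 - t) * b x + t * c x)) * (f x - ((1 - t) * b x + t * c x)))
        = \<sigma> x * ((f x - b x) * (f x - b x)) - 2 * t * (\<sigma> x * ((f x - b x) * c x) - \<sigma> x * ((f x - b x) * b x))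
          + t\<^sup>2 * (\<sigma> x * ((c x - b x) * (c x - b x)))" for x
        by (simp add: power2_eq_square algebra_simps)
      have m: "(\<lambda>x. (1 - t) * b x + t * c x) \<in> B" using t by (intro convex bB c) auto
      have i5: "integrable M (\<lambda>x. \<sigma> x * ((f x - ((1 - t) * b x + t * c x)) * (f x - ((1 - t) * b x + t * c x))))"
        unfolding eq by (intro Bochner_Integration.integrable_add Bochner_Integration.integrable_diff
          integrable_mult_right i1 i2 i3 i4)
      have "ennreal (\<integral>x. \<sigma> x * ((f x - b x) * (f x - b x)) \<partial>M)
        \<le> ennreal (\<integral>x. \<sigma> x * ((f x - ((1 - t) * b x + t * c x)) * (f x - ((1 - t) * b x + t * c x))) \<partial>M)"
        using \<open>I b \<le> i\<close> iB[OF m] i4 i5 \<sigma>0 unfolding I_def power2_eq_square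
        by (subst (1 2) nn_integral_eq_integral[symmetric]) (auto simp: less_imp_le)
      then have "(\<integral>x. \<sigma> x * ((f x - b x) * (f x - b x)) \<partial>M)
        \<le> (\<integral>x. \<sigma> x * ((f x - ((1 - t) * b x + t * c x)) * (f x - ((1 - t) * b x + t * c x))) \<partial>M)"
        by (subst (asm) ennreal_le_iff) (auto intro!: integral_nonneg_AE simp: less_imp_le[OF \<sigma>0])
      also have "\<dots> = (\<integral>x. \<sigma> x * ((f x - b x) * (f x - b x)) \<partial>M) - 2 * t * D + t\<^sup>2 * R"
        unfolding eq D_def R_def using i1 i2 i3 i4 by simp
      finally have "t * (2 * D) \<le> t * (t * R)" by (simp add: power2_eq_square mult_ac)
      then show ?thesis using t by simp
    qed
    have le: "2 * D \<le> 1 / real (Suc n) * R" for n by (rule scal) auto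
    have "(\<lambda>n. 1 / real (Suc n) * R) \<longlonglongrightarrow> 0 * R"
      by (intro tendsto_intros LIMSEQ_Suc[OF lim_1_over_n])
    then have "2 * D \<le> 0" using le by (intro LIMSEQ_le_const[of _ "0::real"]) auto
    then have "(\<integral>x. \<sigma> x * ((f x - b x) * c x) \<partial>M) \<le> (\<integral>x. \<sigma> x * ((f x - b x) * b x) \<partial>M)"
      by (simp add: D_def)
    moreover have "0 \<le> \<sigma> x * ((f x - b x) * c x)" "0 \<le> \<sigma> x * ((f x - b x) * b x)" for x
      using \<sigma>0[of x] bf[of x] b0[of x] nonneg[OF c, of x] by auto
    ultimately show ?thesis using i1 i2
      by (subst (1 2) mult.assoc, subst (1 2) nn_integral_eq_integral) (auto intro!: ennreal_leI)
  qed
  have var: "(\<integral>\<^sup>+x. ennreal (\<sigma> x * (f x - b x) * c x) \<partial>M) \<le> (\<integral>\<^sup>+x. ennreal (\<sigma> x * (f x - b x) * b x) \<partial>M)"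
    if c: "c \<in> B" for c
  proof (rule nn_integral_le_of_AE_tendsto)
    note [measurable] = meas[OF c]
    show "(\<integral>\<^sup>+x. ennreal (\<sigma> x * (f x - b x) * min (c x) (real n * f x)) \<partial>M)
        \<le> (\<integral>\<^sup>+x. ennreal (\<sigma> x * (f x - b x) * b x) \<partial>M)" for n
      by (rule var_bdd[of _ n]) (auto intro!: min_mem c mult_nonneg_nonneg f0)
    show "(\<lambda>x. ennreal (\<sigma> x * (f x - b x) * min (c x) (real n * f x))) \<in> borel_measurable M" for n
      by measurable
    show "AE x in M. (\<lambda>n. ennreal (\<sigma> x * (f x - b x) * min (c x) (real n * f x)))
        \<longlonglongrightarrow> ennreal (\<sigma> x * (f x - b x) * c x)"
    proof (intro AE_I2)
      fix x
      show "(\<lambda>n. ennreal (\<sigma> x * (f x - b x) * min (c x) (real n * f x)))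
        \<longlonglongrightarrow> ennreal (\<sigma> x * (f x - b x) * c x)"
      \<comment> \<open>Where \<open>f x = 0\<close> also \<open>b x = 0\<close>, so both sides
        vanish; elsewhere the truncation level \<open>n * f x\<close> eventually exceeds
        \<open>c x\<close>.\<close>
      proof (cases "f x = 0")
        case True
        then have "b x = 0" using b0[of x] bf[of x] by simp
        then show ?thesis using True by simp
      next
        case False
        then have "0 < f x" using f0[of x] by simp
        then obtain n0 :: nat where "c x < real n0 * f x" using reals_Archimedean3 by blast
        have "min (c x) (real n * f x) = c x" if "n0 \<le> n" for n
        proof -
          have "real n0 * f x \<le> real n * f x" using that f0[of x] by (intro mult_right_mono) auto
          then show ?thesis using \<open>c x < real n0 * f x\<close> by (intro min_absorb1) linarith
        qed
        then have "\<forall>\<^sub>F n in sequentially. ennreal (\<sigma> x * (f x - b x) * min (c x) (real n * f x))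
            = ennreal (\<sigma> x * (f x - b x) * c x)"
          unfolding eventually_sequentially by (intro exI[of _ n0]) simp
        then show ?thesis by (rule tendsto_eventually)
      qed
    qed
  qed simp
  have "(\<integral>\<^sup>+x. ennreal (\<sigma> x * (f x - b x) * b x) \<partial>M) = ennreal (\<integral>x. \<sigma> x * (f x - b x) * b x \<partial>M)"
  proof (intro nn_integral_eq_integral AE_I2)
    show "integrable M (\<lambda>x. \<sigma> x * (f x - b x) * b x)"
      unfolding mult.assoc by (rule int[OF _ bnd[OF fb(1) fb(2)]]) auto
    show "0 \<le> \<sigma> x * (f x - b x) * b x" for x
      using \<sigma>0[of x] bf[of x] b0[of x] by simp
  qed
  then have fin: "(\<integral>\<^sup>+x. ennreal (\<sigma> x * (f x - b x) * b x) \<partial>M) < \<infinity>" by simp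
  show ?thesis by (rule that[of b \<sigma>]) (fact bB bf \<sigma>m \<sigma>0 \<sigma>f fin var)+
qed
end

lemma polarD:
  assumes "g \<in> polar M B"
  shows "g \<in> borel_measurable M" "\<And>x. 0 \<le> g x" "\<And>b. b \<in> B \<Longrightarrow> (\<integral>\<^sup>+x. ennreal (g x * b x) \<partial>M) \<le> 1"
  using assms by (auto simp: polar_def)

lemma nn_integral_scale_le:
  assumes "(\<integral>\<^sup>+x. ennreal (g x * b x) \<partial>M) \<le> ennreal c" "0 < c" 
    and [measurable]: "g \<in> borel_measurable M" "b \<in> borel_measurable M"
  shows "(\<integral>\<^sup>+x. ennreal (g x / c * b x) \<partial>M) \<le> 1"
proof -
  have "(\<integral>\<^sup>+x. ennreal (g x / c * b x) \<partial>M) = (\<integral>\<^sup>+x. ennreal (1 / c) * ennreal (g x * b x) \<partial>M)"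
    using assms by (intro nn_integral_cong) (simp flip: ennreal_mult')
  also have "\<dots> = ennreal (1 / c) * (\<integral>\<^sup>+x. ennreal (g x * b x) \<partial>M)"
    by (simp add: nn_integral_cmult)
  also have "\<dots> \<le> ennreal (1 / c) * ennreal c"
    by (rule mult_left_mono[OF assms(1)]) simp
  also have "\<dots> = 1" using assms by (simp flip: ennreal_mult')
  finally show ?thesis .
qed

section \<open>Consequences of the projection: bipolar theorem, positive functionals and uniform
  boundedness\<close>

context solid_ball
begin

text \<open>Let \<open>b\<close> be the projection of \<open>f\<close> and
  \<open>g = \<sigma> * (f - b)\<close>. On the ball the functional \<open>g\<close> is largest at
  \<open>b\<close>, with finite value \<open>K\<close>, so up to scaling \<open>g\<close> lies in
  the polar, and the hypothesis bounds its pairing with \<open>f\<close> by \<open>K\<close> as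
  well. The difference of the two pairings is the squared distance of \<open>f\<close> to
  \<open>b\<close>, which must therefore be 0.\<close>

lemma bipolar:
  assumes sf: "sigma_finite_measure M"
    and f [measurable]: "f \<in> borel_measurable M" and f0: "\<And>x. 0 \<le> f x"
    and pol: "\<And>g. g \<in> polar M B \<Longrightarrow> (\<integral>\<^sup>+x. ennreal (f x * g x) \<partial>M) \<le> 1"
  shows "f \<in> B"
proof -
  obtain b \<sigma> where b: "b \<in> B" "\<And>x. b x \<le> f x" and \<sigma>[measurable]: "\<sigma> \<in> borel_measurable M" and \<sigma>0: "\<And>x. (0::real) < \<sigma> x"
    and "\<And>x. \<sigma> x * f x \<le> 1"
    and fin: "(\<integral>\<^sup>+x. ennreal (\<sigma> x * (f x - b x) * b x) \<partial>M) < \<infinity>"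
    and var: "\<And>c. c \<in> B \<Longrightarrow> (\<integral>\<^sup>+x. ennreal (\<sigma> x * (f x - b x) * c x) \<partial>M)
                  \<le> (\<integral>\<^sup>+x. ennreal (\<sigma> x * (f x - b x) * b x) \<partial>M)"
    by (rule projection[OF sf f f0]) blast
  note [measurable] = meas[OF b(1)]
  define g where "g x = \<sigma> x * (f x - b x)" for x
  have g0: "0 \<le> g x" for x using \<sigma>0[of x] b(2)[of x] by (simp add: g_def)
  have [measurable]: "g \<in> borel_measurable M" unfolding g_def by measurable
  define K where "K = (\<integral>\<^sup>+x. ennreal (g x * b x) \<partial>M)"
  have K: "K < \<infinity>" using fin by (simp add: K_def g_def)
  have gf: "(\<integral>\<^sup>+x. ennreal (g x * f x) \<partial>M) \<le> K"
  proof (rule ennreal_le_epsilon)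
    fix e :: real assume e: "0 < e"
    \<comment> \<open>Adding \<open>e\<close> keeps the divisor positive when
      \<open>K = 0\<close>.\<close>
    define k where "k = enn2real K + e"
    have k: "0 < k" "K + ennreal e = ennreal k" 
      using e K by (auto simp: k_def add_nonneg_pos ennreal_plus less_top)
    have "(\<lambda>x. g x / k) \<in> polar M B"
      unfolding polar_def
    proof (clarsimp simp: g0 k less_imp_le)
      fix c assume c: "c \<in> B"
      note [measurable] = meas[OF c]
      have "(\<integral>\<^sup>+x. ennreal (g x * c x) \<partial>M) \<le> K" using var[OF c] by (simp add: K_def g_def)
      also have "\<dots> \<le> ennreal k" unfolding k(2)[symmetric] by simp
      finally show "(\<integral>\<^sup>+x. ennreal (g x * c x / k) \<partial>M) \<le> 1"
        using nn_integral_scale_le[of M g c k] k(1) by simp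
    qed
    then have "(\<integral>\<^sup>+x. ennreal (f x * (g x / k)) \<partial>M) \<le> 1" by (rule pol)
    moreover have "(\<integral>\<^sup>+x. ennreal (f x * (g x / k)) \<partial>M) = (\<integral>\<^sup>+x. ennreal (1 / k) * ennreal (g x * f x) \<partial>M)"
      using k(1) by (intro nn_integral_cong) (simp flip: ennreal_mult' add: mult.commute)
    ultimately have "ennreal (1 / k) * (\<integral>\<^sup>+x. ennreal (g x * f x) \<partial>M) \<le> 1"
      by (simp add: nn_integral_cmult)
    then have "ennreal k * (ennreal (1 / k) * (\<integral>\<^sup>+x. ennreal (g x * f x) \<partial>M)) \<le> ennreal k * 1"
      by (rule mult_left_mono) simp
    then show "(\<integral>\<^sup>+x. ennreal (g x * f x) \<partial>M) \<le> K + ennreal e"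
      using k(1) by (simp add: k(2) mult.assoc[symmetric] flip: ennreal_mult')
  qed
  have eq: "ennreal (g x * f x) = ennreal (g x * b x) + ennreal (\<sigma> x * (f x - b x)\<^sup>2)" for x
  proof -
    have "g x * f x = g x * b x + \<sigma> x * (f x - b x)\<^sup>2"
      by (simp add: g_def power2_eq_square algebra_simps)
    then show ?thesis using g0[of x] nonneg[OF b(1), of x] \<sigma>0[of x] by (simp add: less_imp_le)
  qed
  have "K + (\<integral>\<^sup>+x. ennreal (\<sigma> x * (f x - b x)\<^sup>2) \<partial>M) \<le> K + 0"
    using gf unfolding eq K_def by (simp add: nn_integral_add)
  then have "(\<integral>\<^sup>+x. ennreal (\<sigma> x * (f x - b x)\<^sup>2) \<partial>M) \<le> 0"
    using K ennreal_add_left_cancel_le[of K _ 0] by auto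
  then have "AE x in M. ennreal (\<sigma> x * (f x - b x)\<^sup>2) = 0"
    by (subst (asm) le_zero_eq, subst (asm) nn_integral_0_iff_AE) auto
  then have "AE x in M. f x \<le> b x"
  proof eventually_elim
    case (elim x)
    then show ?case using \<sigma>0[of x] by (auto simp: ennreal_eq_0_iff mult_le_0_iff)
  qed
  then show ?thesis by (rule solid[OF b(1) f f0])
qed

text \<open>Projecting the constant \<open>n\<close> gives a functional \<open>h n\<close>, bounded
  on the ball and positive wherever the projection \<open>b n\<close> stays below \<open>n\<close>.
  A weighted sum of all \<open>h n\<close> lies in the polar. On its zero set \<open>A\<close> every
  \<open>b n\<close> is at least \<open>n\<close>, so all multiples \<open>n * indicator A\<close>
  belong to the ball by solidity and \<open>A\<close> is null.\<close>

lemma polar_has_positive: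
  assumes sf: "sigma_finite_measure M"
    and null: "\<And>A. A \<in> sets M \<Longrightarrow> (\<And>n::nat. (\<lambda>x. real n * indicator A x) \<in> B) \<Longrightarrow> emeasure M A = 0"
  obtains g where "g \<in> polar M B" "AE x in M. 0 < g x"
proof -
  define Q where "Q n b h c \<longleftrightarrow> b \<in> B \<and> h \<in> borel_measurable M \<and> (\<forall>x. 0 \<le> h x) \<and> (\<forall>x. h x \<le> 1) \<and> 0 < c
      \<and> (\<forall>x. b x < real n \<longrightarrow> 0 < h x)
      \<and> (\<forall>d\<in>B. (\<integral>\<^sup>+x. ennreal (h x * d x) \<partial>M) \<le> ennreal c)"
    for n :: nat and b h :: "'a \<Rightarrow> real" and c :: real
  have "\<exists>b h c. Q n b h c" for n
  proof -
    obtain b \<sigma> where b: "b \<in> B" "\<And>x. b x \<le> real n" and \<sigma>[measurable]: "\<sigma> \<in> borel_measurable M" 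
      and \<sigma>0: "\<And>x. (0::real) < \<sigma> x" and \<sigma>1: "\<And>x. \<sigma> x * real n \<le> 1"
      and fin: "(\<integral>\<^sup>+x. ennreal (\<sigma> x * (real n - b x) * b x) \<partial>M) < \<infinity>"
      and var: "\<And>c. c \<in> B \<Longrightarrow> (\<integral>\<^sup>+x. ennreal (\<sigma> x * (real n - b x) * c x) \<partial>M)
                  \<le> (\<integral>\<^sup>+x. ennreal (\<sigma> x * (real n - b x) * b x) \<partial>M)"
      by (rule projection[OF sf borel_measurable_const[of "real n"] of_nat_0_le_iff]) blast
    note [measurable] = meas[OF b(1)]
    define c where "c = enn2real (\<integral>\<^sup>+x. ennreal (\<sigma> x * (real n - b x) * b x) \<partial>M) + 1"
    have c: "0 < c" "(\<integral>\<^sup>+x. ennreal (\<sigma> x * (real n - b x) * b x) \<partial>M) \<le> ennreal c"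
      using fin by (auto simp: c_def add_nonneg_pos ennreal_plus less_top)
    show ?thesis
    proof (rule exI[of _ b], rule exI[of _ "\<lambda>x. \<sigma> x * (real n - b x)"], rule exI[of _ c], unfold Q_def, intro conjI allI ballI impI)
      fix x
      show "\<sigma> x * (real n - b x) \<le> 1"
        using \<sigma>0[of x] nonneg[OF b(1), of x] by (intro order_trans[OF mult_left_mono \<sigma>1[of x]]) auto
      show "0 \<le> \<sigma> x * (real n - b x)" using \<sigma>0[of x] b(2)[of x] by simp
      show "0 < \<sigma> x * (real n - b x)" if "b x < real n" using that \<sigma>0[of x] by simp
    next
      fix d assume "d \<in> B"
      from order_trans[OF var[OF this] c(2)]
      show "(\<integral>\<^sup>+x. ennreal (\<sigma> x * (real n - b x) * d x) \<partial>M) \<le> ennreal c" .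
    qed (use b c in auto)
  qed
  then obtain b h c where Q: "\<And>n. Q n (b n) (h n) (c n)" by metis
  then have b: "\<And>n::nat. b n \<in> B" and h [measurable]: "\<And>n. h n \<in> borel_measurable M"
    and h0: "\<And>n x. 0 \<le> h n x" and h1: "\<And>n x. h n x \<le> 1" and c: "\<And>n. 0 < c n"
    and hp: "\<And>n x. b n x < real n \<Longrightarrow> 0 < h n x"
    and hc: "\<And>n d. d \<in> B \<Longrightarrow> (\<integral>\<^sup>+x. ennreal (h n x * d x) \<partial>M) \<le> ennreal (c n)"
    by (auto simp: Q_def)
  \<comment> \<open>Both \<open>a n\<close> and \<open>a n * c n\<close> are at most
    \<open>(1/2)^(n+1)\<close>: the former makes the series converge pointwise, the latter keeps its
    pairing with the ball below 1.\<close>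
  define a where "a n = (1/2) ^ Suc n / (1 + c n)" for n
  have a0: "0 < a n" for n using c[of n] by (simp add: a_def)
  have a1: "a n \<le> (1/2) ^ Suc n" for n
    using c[of n] divide_left_mono[of 1 "1 + c n" "(1/2) ^ Suc n"] by (simp add: a_def)
  have ac: "a n * c n \<le> (1/2) ^ Suc n" for n
    using c[of n] mult_left_mono[of "c n / (1 + c n)" 1 "(1/2) ^ Suc n"] by (simp add: a_def)
  define g where "g x = (\<Sum>n. a n * h n x)" for x
  have sum: "summable (\<lambda>n. a n * h n x)" for x
  proof (rule summable_comparison_test'[where N=0 and g="\<lambda>n. (1/2)^Suc n"])
    show "summable (\<lambda>n. (1/2::real) ^ Suc n)" by (simp add: summable_geometric)
    show "norm (a n * h n x) \<le> (1/2) ^ Suc n" for n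
      using mult_mono[OF a1[of n] h1[of n x]] h0[of n x] a0[of n] by simp
  qed
  have g0: "0 \<le> g x" for x unfolding g_def
    by (intro suminf_nonneg sum mult_nonneg_nonneg h0 less_imp_le[OF a0])
  have [measurable]: "g \<in> borel_measurable M" unfolding g_def by measurable
  have "(\<integral>\<^sup>+x. ennreal (g x * d x) \<partial>M) \<le> 1" if d: "d \<in> B" for d
  proof -
    note [measurable] = meas[OF d]
    have "(\<integral>\<^sup>+x. ennreal (g x * d x) \<partial>M) = (\<integral>\<^sup>+x. (\<Sum>n. ennreal (a n) * ennreal (h n x * d x)) \<partial>M)"
    proof (intro nn_integral_cong)
      fix x
      have "ennreal (g x * d x) = ennreal (\<Sum>n. a n * h n x * d x)"
        unfolding g_def by (subst suminf_mult2[OF sum[of x]]) simp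
      also have "\<dots> = (\<Sum>n. ennreal (a n * h n x * d x))"
        using summable_mult2[OF sum[of x], of "d x"] h0 a0 nonneg[OF d]
        by (intro suminf_ennreal2[symmetric]) (auto intro!: mult_nonneg_nonneg less_imp_le[OF a0])
      finally show "ennreal (g x * d x) = (\<Sum>n. ennreal (a n) * ennreal (h n x * d x))"
        using a0 by (simp flip: ennreal_mult' add: less_imp_le mult.assoc)
    qed
    also have "\<dots> = (\<Sum>n. ennreal (a n) * (\<integral>\<^sup>+x. ennreal (h n x * d x) \<partial>M))"
      by (subst nn_integral_suminf) (auto simp: nn_integral_cmult)
    also have "\<dots> \<le> (\<Sum>n. ennreal ((1/2) ^ Suc n))"
    proof (intro suminf_le)
      fix n
      have "ennreal (a n) * (\<integral>\<^sup>+x. ennreal (h n x * d x) \<partial>M) \<le> ennreal (a n) * ennreal (c n)"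
        by (intro mult_left_mono hc d) simp
      also have "\<dots> \<le> ennreal ((1/2) ^ Suc n)"
        using ac[of n] a0[of n] by (simp flip: ennreal_mult' add: ennreal_leI less_imp_le)
      finally show "ennreal (a n) * (\<integral>\<^sup>+x. ennreal (h n x * d x) \<partial>M) \<le> ennreal ((1/2) ^ Suc n)" .
    qed auto
    also have "\<dots> = ennreal (\<Sum>n. (1/2) ^ Suc n)"
      by (intro suminf_ennreal2) (auto simp: summable_geometric)
    also have "(\<Sum>n. (1/2::real) ^ Suc n) = 1"
      using power_half_series sums_unique by force
    finally show ?thesis by simp
  qed
  then have "g \<in> polar M B" by (auto simp: polar_def g0)
  moreover have "AE x in M. 0 < g x"
  proof -
    define A where "A = {x \<in> space M. g x \<le> 0}"
    have A [measurable]: "A \<in> sets M" unfolding A_def by measurable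
    have "(\<lambda>x. real n * indicator A x) \<in> B" for n :: nat
    proof (rule solid[OF b[of n]])
      show "AE x in M. real n * indicator A x \<le> b n x"
      proof (intro AE_I2)
        fix x
        show "real n * indicator A x \<le> b n x"
        proof (cases "x \<in> A \<and> b n x < real n")
          case True
          then have "0 < a n * h n x" using hp a0 by simp
          also have "\<dots> \<le> g x" unfolding g_def
            using sum_le_suminf[OF sum, of "{n}"] h0 a0 by (simp add: less_imp_le)
          finally show ?thesis using True by (simp add: A_def)
        qed (use nonneg[OF b, of n x] in \<open>auto simp: indicator_def\<close>)
      qed
    qed auto
    then have "emeasure M A = 0" using null[OF A] by blast
    then show ?thesis
      by (intro AE_I[of _ _ A]) (auto simp: A_def not_less)
  qed
  ultimately show ?thesis by (rule that)
qed

text \<open>The sum is the midpoint of \<open>bs 0\<close> and the same sum for the shifted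
  sequence; the missing mass \<open>2^-n\<close> sits on the zero function.\<close>

lemma dyadic_sum_mem:
  assumes "\<And>k. bs k \<in> B"
  shows "(\<lambda>x. \<Sum>k<n. (1/2) ^ Suc k * bs k x) \<in> B"
  using assms
proof (induction n arbitrary: bs)
  case 0
  then show ?case using zero by simp
next
  case (Suc n)
  have "(\<lambda>x. (1 - 1/2) * bs 0 x + 1/2 * (\<Sum>k<n. (1/2) ^ Suc k * bs (Suc k) x)) \<in> B"
    by (rule convex[OF Suc.prems Suc.IH[OF Suc.prems]]) auto
  also have "(\<lambda>x. (1 - 1/2) * bs 0 x + 1/2 * (\<Sum>k<n. (1/2) ^ Suc k * bs (Suc k) x))
      = (\<lambda>x. \<Sum>k<Suc n. (1/2) ^ Suc k * bs k x)"
    unfolding sum.lessThan_Suc_shift by (simp add: sum_distrib_left mult.assoc)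
  finally show ?case .
qed

text \<open>A gliding hump. If the pairings were unbounded, some \<open>bs n\<close> would pair with
  \<open>g\<close> to more than \<open>4^n\<close>. The dyadic sum of the \<open>bs n\<close>
  converges almost everywhere, because the positive functional \<open>h\<close> gives its partial
  sums integral at most 1, and it belongs to the ball by closedness. Its pairing with
  \<open>g\<close> exceeds every \<open>2^n / 2\<close>, contrary to finiteness.\<close>

lemma uniformly_bounded:
  assumes h: "h \<in> polar M B" "AE x in M. 0 < h x"
    and [measurable]: "g \<in> borel_measurable M" and g0: "\<And>x. 0 \<le> g x"
    and fin: "\<And>b. b \<in> B \<Longrightarrow> (\<integral>\<^sup>+x. ennreal (g x * b x) \<partial>M) < \<infinity>"
  shows "\<exists>C::real. 0 \<le> C \<and> (\<forall>b\<in>B. (\<integral>\<^sup>+x. ennreal (g x * b x) \<partial>M) \<le> ennreal C)"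
proof (rule ccontr)
  assume no: "\<not> ?thesis"
  have "\<exists>b. b \<in> B \<and> ennreal (4 ^ n) < (\<integral>\<^sup>+x. ennreal (g x * b x) \<partial>M)" for n :: nat
  proof (rule ccontr)
    assume "\<not> ?thesis"
    then have "\<forall>b\<in>B. (\<integral>\<^sup>+x. ennreal (g x * b x) \<partial>M) \<le> ennreal (4 ^ n)" by (auto simp: not_less)
    with no show False by (meson zero_le_numeral zero_le_power)
  qed
  then obtain bs where bs: "\<And>n. bs n \<in> B" "\<And>n. ennreal (4 ^ n) < (\<integral>\<^sup>+x. ennreal (g x * bs n x) \<partial>M)" by metis
  note [measurable] = meas[OF bs(1)] polarD(1)[OF h(1)]
  have term0: "0 \<le> (1/2) ^ Suc k * bs k x" for k x using nonneg[OF bs(1)] by simp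
  have "(\<integral>\<^sup>+x. (\<Sum>k. ennreal (h x * ((1/2) ^ Suc k * bs k x))) \<partial>M) \<le> 1"
  proof (rule nn_integral_le_of_AE_tendsto[where c="\<lambda>n. 1"])
    show "AE x in M. (\<lambda>n. \<Sum>k<n. ennreal (h x * ((1/2) ^ Suc k * bs k x)))
        \<longlonglongrightarrow> (\<Sum>k. ennreal (h x * ((1/2) ^ Suc k * bs k x)))"
      by (intro AE_I2 summable_LIMSEQ) auto
    show "(\<integral>\<^sup>+x. (\<Sum>k<n. ennreal (h x * ((1/2) ^ Suc k * bs k x))) \<partial>M) \<le> 1" for n
    proof -
      have "(\<integral>\<^sup>+x. (\<Sum>k<n. ennreal (h x * ((1/2) ^ Suc k * bs k x))) \<partial>M)
          = (\<integral>\<^sup>+x. ennreal (h x * (\<Sum>k<n. (1/2) ^ Suc k * bs k x)) \<partial>M)"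
        unfolding sum_distrib_left
        by (intro nn_integral_cong sum_ennreal mult_nonneg_nonneg polarD(2)[OF h(1)] nonneg[OF bs(1)]) simp
      also have "\<dots> \<le> 1" by (rule polarD(3)[OF h(1) dyadic_sum_mem[OF bs(1)]])
      finally show ?thesis .
    qed
  qed auto
  then have "AE x in M. (\<Sum>k. ennreal (h x * ((1/2) ^ Suc k * bs k x))) \<noteq> \<infinity>"
    by (intro nn_integral_PInf_AE) (auto simp: top_unique)
  with h(2) have summ: "AE x in M. summable (\<lambda>k. (1/2) ^ Suc k * bs k x)"
  proof eventually_elim
    case (elim x)
    have "summable (\<lambda>k. h x * ((1/2) ^ Suc k * bs k x))"
      using elim nonneg[OF bs(1)] by (intro summable_suminf_not_top mult_nonneg_nonneg) auto
    then show ?case using elim(1) by (simp add: summable_mult_D)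
  qed
  \<comment> \<open>The extended sum gives a measurable nonnegative function also at points where
    the series diverges.\<close>
  define b where "b x = enn2real (\<Sum>k. ennreal ((1/2) ^ Suc k * bs k x))" for x
  have b_eq: "b x = (\<Sum>k. (1/2) ^ Suc k * bs k x)" if "summable (\<lambda>k. (1/2) ^ Suc k * bs k x)" for x
    unfolding b_def suminf_ennreal2[OF term0 that]
    by (intro enn2real_ennreal suminf_nonneg that term0)
  have [measurable]: "b \<in> borel_measurable M" unfolding b_def by measurable
  have "b \<in> B"
  proof (rule closed[OF dyadic_sum_mem[OF bs(1)]])
    show "0 \<le> b x" for x by (simp add: b_def)
    show "AE x in M. (\<lambda>n. \<Sum>k<n. (1/2) ^ Suc k * bs k x) \<longlonglongrightarrow> b x"
      using summ by eventually_elim (simp only: b_eq summable_LIMSEQ)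
  qed simp
  have "ennreal (2 ^ n / 2) \<le> (\<integral>\<^sup>+x. ennreal (g x * b x) \<partial>M)" for n
  proof -
    have "(4::real) ^ n = 2 ^ n * 2 ^ n" by (simp flip: power_mult_distrib)
    then have "ennreal (2 ^ n / 2) = ennreal ((1/2) ^ Suc n) * ennreal (4 ^ n)"
      by (simp flip: ennreal_mult' add: field_simps)
    also have "\<dots> \<le> ennreal ((1/2) ^ Suc n) * (\<integral>\<^sup>+x. ennreal (g x * bs n x) \<partial>M)"
      by (intro mult_left_mono less_imp_le[OF bs(2)]) simp
    also have "\<dots> = (\<integral>\<^sup>+x. ennreal ((1/2) ^ Suc n * (g x * bs n x)) \<partial>M)"
      by (subst nn_integral_cmult[symmetric]) (simp_all flip: ennreal_mult')
    also have "\<dots> \<le> (\<integral>\<^sup>+x. ennreal (g x * b x) \<partial>M)"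
    proof (intro nn_integral_mono_AE)
      show "AE x in M. ennreal ((1/2) ^ Suc n * (g x * bs n x)) \<le> ennreal (g x * b x)"
        using summ
      proof eventually_elim
        case (elim x)
        then have "(1/2) ^ Suc n * bs n x \<le> b x"
          using sum_le_suminf[OF elim, of "{n}"] term0 by (simp add: b_eq)
        from mult_left_mono[OF this g0[of x]] show ?case by (intro ennreal_leI) (simp add: mult_ac)
      qed
    qed
    finally show ?thesis .
  qed
  moreover obtain R where R: "0 \<le> R" "(\<integral>\<^sup>+x. ennreal (g x * b x) \<partial>M) = ennreal R"
    using fin[OF \<open>b \<in> B\<close>] by (cases "\<integral>\<^sup>+x. ennreal (g x * b x) \<partial>M") auto
  ultimately have "2 ^ n / 2 \<le> R" for n :: nat by (simp add: ennreal_le_iff)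
  moreover obtain n :: nat where "2 * R < 2 ^ n" using real_arch_pow[of 2 "2 * R"] by auto
  ultimately show False using \<open>\<And>n. 2 ^ n / 2 \<le> R\<close>[of n] by simp
qed

end

section \<open>Lozanovskii duality\<close>

text \<open>Multiplying the two bounds gives \<open>F^2\<close> below the product of
  \<open>(a i * b i) powr \<theta> i\<close>, and \<open>a i * b i\<close> is at most the square of
  the mean. It yields the midpoint convexity of the constraint set \<open>K\<close>.\<close>

lemma le_prod_powr_midpoint:
  fixes \<theta> a b :: "'i \<Rightarrow> real"
  assumes I: "finite I" and a: "\<And>i. i \<in> I \<Longrightarrow> 0 \<le> a i" and b: "\<And>i. i \<in> I \<Longrightarrow> 0 \<le> b i"
    and th: "\<And>i. i \<in> I \<Longrightarrow> 0 \<le> \<theta> i" and F: "0 \<le> F"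
    and Fa: "F \<le> (\<Prod>i\<in>I. a i powr \<theta> i)" and Fb: "F \<le> (\<Prod>i\<in>I. b i powr \<theta> i)"
  shows "F \<le> (\<Prod>i\<in>I. ((a i + b i) / 2) powr \<theta> i)"
proof -
  have "F * F \<le> (\<Prod>i\<in>I. a i powr \<theta> i) * (\<Prod>i\<in>I. b i powr \<theta> i)"
    using F Fa Fb by (intro mult_mono) auto
  also have "\<dots> = (\<Prod>i\<in>I. (a i * b i) powr \<theta> i)"
    by (simp add: prod.distrib powr_mult)
  also have "\<dots> \<le> (\<Prod>i\<in>I. (((a i + b i) / 2) * ((a i + b i) / 2)) powr \<theta> i)"
  proof (intro prod_mono conjI powr_mono2)
    fix i assume i: "i \<in> I"
    have "0 \<le> (a i - b i)\<^sup>2" by simp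
    then show "a i * b i \<le> (a i + b i) / 2 * ((a i + b i) / 2)"
      by (simp add: power2_eq_square field_simps)
  qed (use a b th in auto)
  also have "\<dots> = (\<Prod>i\<in>I. ((a i + b i) / 2) powr \<theta> i) * (\<Prod>i\<in>I. ((a i + b i) / 2) powr \<theta> i)"
    by (simp only: prod.distrib powr_mult)
  finally have "F\<^sup>2 \<le> (\<Prod>i\<in>I. ((a i + b i) / 2) powr \<theta> i)\<^sup>2" by (simp add: power2_eq_square)
  then show ?thesis by (rule power2_le_imp_le) (simp add: prod_nonneg)
qed

lemma tendsto_of_exp_half_tendsto:
  fixes a :: "nat \<Rightarrow> real"
  assumes "(\<lambda>n. exp (- a n / 2)) \<longlonglongrightarrow> z" "0 < z"
  shows "a \<longlonglongrightarrow> - 2 * ln z"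
proof -
  have "(\<lambda>n. - 2 * ln (exp (- a n / 2))) \<longlonglongrightarrow> - 2 * ln z"
    using assms by (intro tendsto_intros) auto
  then show ?thesis by simp
qed

text \<open>Convergence is first obtained for \<open>exp (- v / 2)\<close>, where escape of
  \<open>v\<close> to infinity shows up as the limit 0. Here this escape is turned into an infinite
  integrand.\<close>

lemma ennreal_tendsto_top_of_exp_half:
  fixes a :: "nat \<Rightarrow> real"
  assumes "(\<lambda>n. exp (- a n / 2)) \<longlonglongrightarrow> 0" "0 < k"
  shows "(\<lambda>n. ennreal (k * a n)) \<longlonglongrightarrow> \<infinity>"
proof -
  have "filterlim (\<lambda>n. exp (- a n / 2)) (at_right 0) sequentially"
    unfolding filterlim_at using assms(1) by simp
  then have "filterlim (\<lambda>n. ln (exp (- a n / 2))) at_bot sequentially"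
    by (rule filterlim_compose[OF ln_at_0])
  then have "filterlim (\<lambda>n. (2 * k) * (a n / 2)) at_top sequentially"
    using assms(2) by (intro filterlim_tendsto_pos_mult_at_top[OF tendsto_const])
      (simp_all add: filterlim_uminus_at_bot)
  then show ?thesis by (simp add: ennreal_tendsto_top_eq_at_top)
qed

text \<open>
  The factorization of \<open>F\<close> is a minimax problem for the pairing of \<open>u \<in> \<Prod>\<^sub>j B\<^sub>j\<close> with \<open>v\<close> in the convex set
  \<open>F \<le> \<Prod>\<^sub>j v\<^sub>j\<^bsup>\<theta>\<^sub>j\<^esup>\<close>. Adding the small penalty \<open>\<integral> \<rho> \<Sum>\<^sub>j exp (-v\<^sub>j)\<close> makes it strictly convex in \<open>v\<close>, in the sense
  that near-minimizers are close in the \<open>L\<^sup>2(\<rho>)\<close> distance of \<open>exp (-v\<^sub>j/2)\<close>. Thus near-minimizers along a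
  maximizing sequence of \<open>u\<close> converge almost everywhere, and no compactness is needed.
\<close>

locale lozanovskii =
  fixes M :: "'a measure" and B :: "'j::finite \<Rightarrow> ('a \<Rightarrow> real) set" and \<theta> :: "'j \<Rightarrow> real"
    and F :: "'a \<Rightarrow> real"
  assumes sf: "sigma_finite_measure M"
    and \<theta>0: "0 < \<theta> j" and \<theta>1: "(\<Sum>j\<in>UNIV. \<theta> j) = 1"
    and Bm: "b \<in> B j \<Longrightarrow> b \<in> borel_measurable M" and B0: "b \<in> B j \<Longrightarrow> 0 \<le> b x"
    and conv: "b \<in> B j \<Longrightarrow> c \<in> B j \<Longrightarrow> 0 \<le> t \<Longrightarrow> t \<le> 1 \<Longrightarrow> (\<lambda>x. (1 - t) * b x + t * c x) \<in> B j"
    and pos: "\<exists>b\<in>B j. AE x in M. 0 < b x"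
    and Fm [measurable]: "F \<in> borel_measurable M" and F0: "0 \<le> F x"
    and le1: "(\<And>j. u j \<in> B j) \<Longrightarrow> (\<And>j. AE x in M. 0 < u j x) \<Longrightarrow>
      (\<integral>\<^sup>+x. ennreal (F x * (\<Prod>j\<in>UNIV. u j x powr \<theta> j)) \<partial>M) \<le> 1"
begin

text \<open>Positivity allows \<open>optimal_v\<close> to divide by \<open>u j\<close>. The bounds
  return to all of \<open>B\<close> by mixing in a small multiple of a positive member.\<close>

definition Bp :: "('j \<Rightarrow> 'a \<Rightarrow> real) set" where
  "Bp = {u. (\<forall>j. u j \<in> B j) \<and> (\<forall>j. AE x in M. 0 < u j x)}"

definition K :: "('j \<Rightarrow> 'a \<Rightarrow> real) set" where
  "K = {v. (\<forall>j. v j \<in> borel_measurable M) \<and> (\<forall>j x. 0 \<le> v j x) \<and>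
           (AE x in M. F x \<le> (\<Prod>j\<in>UNIV. v j x powr \<theta> j))}"

definition pairing :: "('j \<Rightarrow> 'a \<Rightarrow> real) \<Rightarrow> ('j \<Rightarrow> 'a \<Rightarrow> real) \<Rightarrow> 'a \<Rightarrow> real" where
  "pairing u v x = (\<Sum>j\<in>UNIV. \<theta> j * (u j x * v j x))"

definition pen :: "('a \<Rightarrow> real) \<Rightarrow> ('j \<Rightarrow> 'a \<Rightarrow> real) \<Rightarrow> 'a \<Rightarrow> real" where
  "pen \<rho> v x = \<rho> x * (\<Sum>j\<in>UNIV. exp (- v j x))"

definition G :: "('a \<Rightarrow> real) \<Rightarrow> ('j \<Rightarrow> 'a \<Rightarrow> real) \<Rightarrow> ('j \<Rightarrow> 'a \<Rightarrow> real) \<Rightarrow> ennreal" where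
  "G \<rho> u v = (\<integral>\<^sup>+x. ennreal (pairing u v x + pen \<rho> v x) \<partial>M)"

definition D :: "('a \<Rightarrow> real) \<Rightarrow> ('j \<Rightarrow> 'a \<Rightarrow> real) \<Rightarrow> ('j \<Rightarrow> 'a \<Rightarrow> real) \<Rightarrow> ennreal" where
  "D \<rho> v w = (\<integral>\<^sup>+x. ennreal (\<rho> x * (\<Sum>j\<in>UNIV. (exp (- v j x / 2) - exp (- w j x / 2))\<^sup>2)) \<partial>M)"

lemma BpD: "u \<in> Bp \<Longrightarrow> u j \<in> B j" "u \<in> Bp \<Longrightarrow> AE x in M. 0 < u j x"
    "u \<in> Bp \<Longrightarrow> u j \<in> borel_measurable M" "u \<in> Bp \<Longrightarrow> 0 \<le> u j x"
  using Bm[of "u j" j] B0[of "u j" j] by (auto simp: Bp_def)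

lemma KD: "v \<in> K \<Longrightarrow> v j \<in> borel_measurable M" "v \<in> K \<Longrightarrow> 0 \<le> v j x"
    "v \<in> K \<Longrightarrow> AE x in M. F x \<le> (\<Prod>j\<in>UNIV. v j x powr \<theta> j)"
  by (auto simp: K_def)

lemma Bp_ne: "Bp \<noteq> {}"
proof -
  obtain b where "\<And>j. b j \<in> B j" "\<And>j. AE x in M. 0 < b j x" using pos by metis
  then show ?thesis by (auto simp: Bp_def)
qed

lemma Bp_conv:
  assumes u: "\<And>j. u j \<in> B j" and w: "w \<in> Bp" and t: "0 < t" "t \<le> 1"
  shows "(\<lambda>j x. (1 - t) * u j x + t * w j x) \<in> Bp"
proof -
  have "AE x in M. 0 < (1 - t) * u j x + t * w j x" for j
    using BpD(2)[OF w, of j]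
  proof eventually_elim
    case (elim x)
    then show ?case using B0[OF u[of j], of x] t by (intro add_nonneg_pos) auto
  qed
  then show ?thesis using conv[OF u BpD(1)[OF w]] t by (auto simp: Bp_def)
qed

lemma pairing_nonneg: "(\<And>j. 0 \<le> u j x) \<Longrightarrow> (\<And>j. 0 \<le> v j x) \<Longrightarrow> 0 \<le> pairing u v x"
  unfolding pairing_def by (intro sum_nonneg mult_nonneg_nonneg less_imp_le[OF \<theta>0])

lemma pairing_meas [measurable]:
  assumes [measurable]: "\<And>j. u j \<in> borel_measurable M" "\<And>j. v j \<in> borel_measurable M"
  shows "pairing u v \<in> borel_measurable M"
  unfolding pairing_def by measurable

lemma pen_meas [measurable]:
  assumes [measurable]: "\<rho> \<in> borel_measurable M" "\<And>j. v j \<in> borel_measurable M"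
  shows "pen \<rho> v \<in> borel_measurable M"
  unfolding pen_def by measurable

lemma pairing_lin:
  "pairing (\<lambda>j x. (1 - t) * u j x + t * w j x) v x = (1 - t) * pairing u v x + t * pairing w v x"
  by (simp add: pairing_def sum_distrib_left algebra_simps flip: sum.distrib)

text \<open>Equality case of the weighted arithmetic-geometric inequality:
  \<open>v j = P / u j\<close> with \<open>P = F * \<Prod>j. u j powr \<theta> j\<close> makes all
  products \<open>u j * v j\<close> equal to \<open>P\<close>, while the weighted product of the
  \<open>v j\<close> is \<open>F\<close>. So for fixed \<open>u\<close> the infimum of the pairing
  over \<open>v\<close> is at most 1.\<close>

lemma optimal_v:
  assumes u: "u \<in> Bp"
  obtains v where "v \<in> K" "(\<integral>\<^sup>+x. ennreal (pairing u v x) \<partial>M) \<le> 1"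
proof -
  note [measurable] = BpD(3)[OF u]
  define P where "P x = F x * (\<Prod>j\<in>UNIV. u j x powr \<theta> j)" for x
  have P0: "0 \<le> P x" for x unfolding P_def by (intro mult_nonneg_nonneg F0 prod_nonneg) auto
  define v where "v j x = P x / u j x" for j x
  have vm: "v j \<in> borel_measurable M" for j unfolding v_def P_def by measurable
  have pos: "AE x in M. \<forall>j\<in>UNIV. 0 < u j x" by (intro AE_finite_allI BpD(2)[OF u]) auto
  have "AE x in M. F x \<le> (\<Prod>j\<in>UNIV. v j x powr \<theta> j)"
    using pos
  proof eventually_elim
    case (elim x)
    define Q where "Q = (\<Prod>j\<in>UNIV. u j x powr \<theta> j)"
    have Q: "0 < Q" unfolding Q_def by (rule prod_pos) (metis elim less_irrefl powr_gt_zero)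
    have "(\<Prod>j\<in>UNIV. v j x powr \<theta> j) = (\<Prod>j\<in>UNIV. P x powr \<theta> j / u j x powr \<theta> j)"
      unfolding v_def by (simp add: powr_divide)
    also have "\<dots> = (\<Prod>j\<in>UNIV. P x powr \<theta> j) / Q" by (simp add: prod_dividef Q_def)
    also have "(\<Prod>j\<in>UNIV. P x powr \<theta> j) = P x"
    proof (cases "P x = 0")
      case False
      then show ?thesis using P0[of x] \<theta>1 by (simp flip: powr_sum)
    next
      case True then show ?thesis by simp
    qed
    also have "P x / Q = F x" using Q by (simp add: P_def flip: Q_def)
    finally show ?case by simp
  qed
  moreover have "0 \<le> v j x" for j x using P0[of x] BpD(4)[OF u, of j x] by (simp add: v_def)
  ultimately have "v \<in> K" using vm by (auto simp: K_def)
  moreover have "(\<integral>\<^sup>+x. ennreal (pairing u v x) \<partial>M) \<le> 1"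
  proof -
    have "(\<integral>\<^sup>+x. ennreal (pairing u v x) \<partial>M) \<le> (\<integral>\<^sup>+x. ennreal (P x) \<partial>M)"
    proof (intro nn_integral_mono_AE)
      show "AE x in M. ennreal (pairing u v x) \<le> ennreal (P x)"
        using pos
      proof eventually_elim
        case (elim x)
        then have "pairing u v x = (\<Sum>j\<in>UNIV. \<theta> j * P x)"
          unfolding pairing_def v_def by (intro sum.cong refl) (simp add: less_imp_neq[symmetric])
        then show ?case using \<theta>1 by (simp flip: sum_distrib_right)
      qed
    qed
    also have "\<dots> \<le> 1" unfolding P_def by (rule le1) (auto intro: BpD u)
    finally show ?thesis .
  qed
  ultimately show ?thesis by (rule that)
qed

lemma K_mid:
  assumes v: "v \<in> K" and w: "w \<in> K"
  shows "(\<lambda>j x. (v j x + w j x) / 2) \<in> K"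
proof -
  have "AE x in M. F x \<le> (\<Prod>j\<in>UNIV. ((v j x + w j x) / 2) powr \<theta> j)"
    using KD(3)[OF v] KD(3)[OF w]
    by eventually_elim (intro le_prod_powr_midpoint KD(2)[OF v] KD(2)[OF w] F0 less_imp_le[OF \<theta>0]; simp)
  then show ?thesis using KD(1,2)[OF v] KD(1,2)[OF w] by (auto simp: K_def)
qed

text \<open>The pairing is affine in \<open>v\<close>, and with \<open>a = exp (-v/2)\<close>,
  \<open>b = exp (-w/2)\<close> the penalty at the midpoint is
  \<open>a * b = (a^2 + b^2)/2 - (a - b)^2/2\<close>. Thus \<open>D\<close> measures the convexity
  defect exactly.\<close>

lemma G_mid:
  assumes u: "u \<in> Bp" and v: "v \<in> K" and w: "w \<in> K"
    and [measurable]: "\<rho> \<in> borel_measurable M" and \<rho>: "\<And>x. 0 < \<rho> x"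
  shows "G \<rho> u (\<lambda>j x. (v j x + w j x) / 2) + D \<rho> v w / 2 = G \<rho> u v / 2 + G \<rho> u w / 2"
proof -
  note [measurable] = BpD(3)[OF u] KD(1)[OF v] KD(1)[OF w]
  let ?m = "\<lambda>j x. (v j x + w j x) / 2"
  have nn: "0 \<le> pairing u v x + pen \<rho> v x" if "v \<in> K" for v x
    using pairing_nonneg[of u x v] BpD(4)[OF u] KD(2)[OF that] \<rho>[of x]
    by (auto simp: pen_def intro!: add_nonneg_nonneg mult_nonneg_nonneg sum_nonneg)
  have D0: "0 \<le> \<rho> x * (\<Sum>j\<in>UNIV. (exp (- v j x / 2) - exp (- w j x / 2))\<^sup>2)" for x
    using \<rho>[of x] by (intro mult_nonneg_nonneg sum_nonneg) auto
  have eq: "pairing u ?m x + pen \<rho> ?m x + \<rho> x * (\<Sum>j\<in>UNIV. (exp (- v j x / 2) - exp (- w j x / 2))\<^sup>2) / 2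
    = (pairing u v x + pen \<rho> v x) / 2 + (pairing u w x + pen \<rho> w x) / 2" for x
  proof -
    have 1: "pairing u ?m x = pairing u v x / 2 + pairing u w x / 2"
      by (simp add: pairing_def sum_divide_distrib field_simps flip: sum.distrib)
    have e: "exp (- ((v j x + w j x) / 2)) = exp (- v j x / 2) * exp (- w j x / 2)"
      "exp (- v j x) = exp (- v j x / 2) * exp (- v j x / 2)"
      "exp (- w j x) = exp (- w j x / 2) * exp (- w j x / 2)" for j
      by (simp_all flip: exp_add add: field_simps)
    have "(\<Sum>j\<in>UNIV. exp (- ?m j x)) + (\<Sum>j\<in>UNIV. (exp (- v j x / 2) - exp (- w j x / 2))\<^sup>2) / 2
      = (\<Sum>j\<in>UNIV. exp (- v j x)) / 2 + (\<Sum>j\<in>UNIV. exp (- w j x)) / 2"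
      unfolding e sum_divide_distrib sum.distrib[symmetric]
      by (intro sum.cong refl) (simp add: power2_eq_square field_simps)
    then have "\<rho> x * ((\<Sum>j\<in>UNIV. exp (- ?m j x)) + (\<Sum>j\<in>UNIV. (exp (- v j x / 2) - exp (- w j x / 2))\<^sup>2) / 2)
      = \<rho> x * ((\<Sum>j\<in>UNIV. exp (- v j x)) / 2 + (\<Sum>j\<in>UNIV. exp (- w j x)) / 2)" by (rule arg_cong)
    then show ?thesis unfolding 1 pen_def by (simp add: distrib_left add_divide_distrib)
  qed
  have "G \<rho> u ?m + D \<rho> v w / 2 = (\<integral>\<^sup>+x. ennreal (pairing u ?m x + pen \<rho> ?m x)
      + ennreal (\<rho> x * (\<Sum>j\<in>UNIV. (exp (- v j x / 2) - exp (- w j x / 2))\<^sup>2)) / 2 \<partial>M)"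
    unfolding G_def D_def by (subst nn_integral_add) (auto simp: nn_integral_divide)
  also have "\<dots> = (\<integral>\<^sup>+x. ennreal (pairing u v x + pen \<rho> v x) / 2 + ennreal (pairing u w x + pen \<rho> w x) / 2 \<partial>M)"
  proof (intro nn_integral_cong)
    fix x
    show "ennreal (pairing u ?m x + pen \<rho> ?m x)
      + ennreal (\<rho> x * (\<Sum>j\<in>UNIV. (exp (- v j x / 2) - exp (- w j x / 2))\<^sup>2)) / 2
      = ennreal (pairing u v x + pen \<rho> v x) / 2 + ennreal (pairing u w x + pen \<rho> w x) / 2"
      using arg_cong[OF eq[of x], of ennreal] nn[OF v, of x] nn[OF w, of x] nn[OF K_mid[OF v w], of x] D0[of x]
      by (simp add: ennreal_plus[symmetric] divide_ennreal del: ennreal_plus flip: ennreal_numeral)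
  qed
  also have "\<dots> = G \<rho> u v / 2 + G \<rho> u w / 2"
    unfolding G_def by (subst nn_integral_add) (auto simp: nn_integral_divide)
  finally show ?thesis .
qed

lemma D_triangle:
  assumes v: "\<And>j. v j \<in> borel_measurable M" and w: "\<And>j. w j \<in> borel_measurable M" and y: "\<And>j. y j \<in> borel_measurable M"
    and [measurable]: "\<rho> \<in> borel_measurable M" and \<rho>: "\<And>x. 0 < \<rho> x"
  shows "D \<rho> v y \<le> 2 * D \<rho> v w + 2 * D \<rho> w y"
proof -
  note [measurable] = v w y
  have "D \<rho> v y \<le> (\<integral>\<^sup>+x. 2 * ennreal (\<rho> x * (\<Sum>j\<in>UNIV. (exp (- v j x / 2) - exp (- w j x / 2))\<^sup>2))
     + 2 * ennreal (\<rho> x * (\<Sum>j\<in>UNIV. (exp (- w j x / 2) - exp (- y j x / 2))\<^sup>2)) \<partial>M)"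
    unfolding D_def
  proof (intro nn_integral_mono)
    fix x
    let ?a = "\<lambda>j. exp (- v j x / 2)" and ?b = "\<lambda>j. exp (- w j x / 2)" and ?c = "\<lambda>j. exp (- y j x / 2)"
    have sq: "(a - c)\<^sup>2 \<le> 2 * (a - b)\<^sup>2 + 2 * (b - c)\<^sup>2" for a b c :: real
    proof -
      have "0 \<le> ((a - b) - (b - c))\<^sup>2" by simp
      then show ?thesis by (simp add: power2_eq_square algebra_simps)
    qed
    have "(\<Sum>j\<in>UNIV. (?a j - ?c j)\<^sup>2) \<le> 2 * (\<Sum>j\<in>UNIV. (?a j - ?b j)\<^sup>2) + 2 * (\<Sum>j\<in>UNIV. (?b j - ?c j)\<^sup>2)"
      unfolding sum_distrib_left sum.distrib[symmetric] by (intro sum_mono sq)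
    then have "\<rho> x * (\<Sum>j\<in>UNIV. (?a j - ?c j)\<^sup>2)
       \<le> \<rho> x * (2 * (\<Sum>j\<in>UNIV. (?a j - ?b j)\<^sup>2) + 2 * (\<Sum>j\<in>UNIV. (?b j - ?c j)\<^sup>2))"
      using \<rho>[of x] by (intro mult_left_mono) auto
    also have "\<dots> = 2 * (\<rho> x * (\<Sum>j\<in>UNIV. (?a j - ?b j)\<^sup>2)) + 2 * (\<rho> x * (\<Sum>j\<in>UNIV. (?b j - ?c j)\<^sup>2))"
      by (simp add: algebra_simps)
    finally have "ennreal (\<rho> x * (\<Sum>j\<in>UNIV. (?a j - ?c j)\<^sup>2))
      \<le> ennreal (2 * (\<rho> x * (\<Sum>j\<in>UNIV. (?a j - ?b j)\<^sup>2)) + 2 * (\<rho> x * (\<Sum>j\<in>UNIV. (?b j - ?c j)\<^sup>2)))"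
      by (rule ennreal_leI)
    also have "\<dots> = 2 * ennreal (\<rho> x * (\<Sum>j\<in>UNIV. (?a j - ?b j)\<^sup>2)) + 2 * ennreal (\<rho> x * (\<Sum>j\<in>UNIV. (?b j - ?c j)\<^sup>2))"
      using \<rho>[of x] by (subst ennreal_plus) (auto simp: ennreal_mult' sum_nonneg)
    finally show "ennreal (\<rho> x * (\<Sum>j\<in>UNIV. (?a j - ?c j)\<^sup>2)) \<le> \<dots>" .
  qed
  also have "\<dots> = 2 * D \<rho> v w + 2 * D \<rho> w y"
    unfolding D_def by (subst nn_integral_add) (auto simp: nn_integral_cmult)
  finally show ?thesis .
qed

text \<open>Let \<open>S\<close> be the supremum over \<open>u\<close> of the infimum over
  \<open>v\<close>, and \<open>us k\<close> a maximizing sequence with near-minimizers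
  \<open>vs k\<close>. For arbitrary \<open>u\<close>, a near-minimizer for the slight perturbation
  \<open>(1 - t) * us k + t * u\<close> is still nearly minimal for \<open>us k\<close>, hence close
  to \<open>vs k\<close>, while its value at \<open>u\<close> is at most about \<open>S\<close>. As
  \<open>k\<close> grows these functions share the limit of the \<open>vs k\<close>, whatever
  \<open>u\<close> is, so a single \<open>v\<close> serves all \<open>u\<close>.\<close>

lemma lozanovskii_minimax:
  assumes \<epsilon>: "0 < \<epsilon>"
  obtains v where "v \<in> K" "\<And>u. u \<in> Bp \<Longrightarrow> (\<integral>\<^sup>+x. ennreal (pairing u v x) \<partial>M) \<le> ennreal (1 + \<epsilon>)"
proof -
  obtain \<rho>0 :: "'a \<Rightarrow> real" where \<rho>0 [measurable]: "\<rho>0 \<in> borel_measurable M" and \<rho>0p: "\<And>x. 0 < \<rho>0 x"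
    and \<rho>0i: "integrable M \<rho>0"
    using sigma_finite_measure.obtain_positive_integrable_function[OF sf] by metis
  define n where "n = real CARD('j)"
  have n: "0 < n" by (simp add: n_def)
  define R where "R = (\<integral>x. \<rho>0 x \<partial>M)"
  have R: "0 \<le> R" unfolding R_def using \<rho>0p by (intro integral_nonneg_AE) (auto simp: less_imp_le)
  \<comment> \<open>Scaled so that the penalty, at most \<open>n * \<rho>\<close> since each
    exponential is at most 1, has total integral at most \<epsilon>.\<close>
  define \<kappa> where "\<kappa> = \<epsilon> / (n * (R + 1))"
  have \<kappa>: "0 < \<kappa>" using \<epsilon> n R by (simp add: \<kappa>_def)
  define \<rho> where "\<rho> x = \<kappa> * \<rho>0 x" for x
  have \<rho>m [measurable]: "\<rho> \<in> borel_measurable M" unfolding \<rho>_def by measurable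
  have \<rho>p: "0 < \<rho> x" for x using \<kappa> \<rho>0p by (simp add: \<rho>_def)
  have "(\<integral>\<^sup>+x. ennreal (\<rho> x * n) \<partial>M) = ennreal (\<integral>x. \<rho> x * n \<partial>M)"
    using \<rho>0i \<rho>p n by (intro nn_integral_eq_integral) (auto simp: \<rho>_def less_imp_le)
  also have "(\<integral>x. \<rho> x * n \<partial>M) = \<kappa> * R * n" by (simp add: \<rho>_def R_def)
  also have "\<dots> = \<epsilon> * (R / (R + 1))" using n by (simp add: \<kappa>_def)
  also have "\<dots> \<le> \<epsilon> * 1" using R \<epsilon> by (intro mult_left_mono) auto
  also have "\<dots> = \<epsilon>" by simp
  finally have \<rho>int: "(\<integral>\<^sup>+x. ennreal (\<rho> x * n) \<partial>M) \<le> ennreal \<epsilon>" by (simp add: ennreal_leI)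
  have nn: "0 \<le> pairing u v x" "0 \<le> pen \<rho> v x" if "u \<in> Bp" "v \<in> K" for u v x
    using pairing_nonneg[of u x v] BpD(4)[OF that(1)] KD(2)[OF that(2)] \<rho>p[of x]
    by (auto simp: pen_def intro!: mult_nonneg_nonneg sum_nonneg)
  have penle: "pen \<rho> v x \<le> \<rho> x * n" if "v \<in> K" for v x
  proof -
    have "(\<Sum>j\<in>UNIV. exp (- v j x)) \<le> (\<Sum>j\<in>(UNIV::'j set). 1)"
      using KD(2)[OF that] by (intro sum_mono) simp
    then show ?thesis unfolding pen_def using \<rho>p[of x] by (intro mult_left_mono) (auto simp: n_def)
  qed
  define m where "m u = (INF v\<in>K. G \<rho> u v)" for u
  have m_le: "m u \<le> ennreal (1 + \<epsilon>)" if u: "u \<in> Bp" for u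
  proof -
    obtain v where v: "v \<in> K" "(\<integral>\<^sup>+x. ennreal (pairing u v x) \<partial>M) \<le> 1" using optimal_v[OF u] .
    note [measurable] = BpD(3)[OF u] KD(1)[OF v(1)]
    have "m u \<le> G \<rho> u v" unfolding m_def by (rule INF_lower[OF v(1)])
    also have "\<dots> = (\<integral>\<^sup>+x. ennreal (pairing u v x) \<partial>M) + (\<integral>\<^sup>+x. ennreal (pen \<rho> v x) \<partial>M)"
      unfolding G_def using nn[OF u v(1)] by (subst nn_integral_add[symmetric]) auto
    also have "\<dots> \<le> 1 + (\<integral>\<^sup>+x. ennreal (\<rho> x * n) \<partial>M)"
      by (intro add_mono v nn_integral_mono ennreal_leI penle)
    also have "\<dots> \<le> 1 + ennreal \<epsilon>" by (intro add_left_mono \<rho>int)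
    finally show ?thesis using \<epsilon> by (simp add: ennreal_plus)
  qed
  define s where "s = (SUP u\<in>Bp. m u)"
  have s1: "s \<le> ennreal (1 + \<epsilon>)" unfolding s_def by (rule SUP_least) (rule m_le)
  define S where "S = enn2real s"
  have sS: "s = ennreal S" unfolding S_def by (intro ennreal_enn2real[symmetric] le_less_trans[OF s1]) simp
  have S0: "0 \<le> S" by (simp add: S_def)
  have S1: "S \<le> 1 + \<epsilon>" using s1 \<epsilon> unfolding sS by (subst (asm) ennreal_le_iff) auto
  define \<mu> where "\<mu> u = enn2real (m u)" for u
  have \<mu>: "m u = ennreal (\<mu> u)" if "u \<in> Bp" for u
    unfolding \<mu>_def by (intro ennreal_enn2real[symmetric] le_less_trans[OF m_le[OF that]]) simp
  have \<mu>0: "0 \<le> \<mu> u" for u by (simp add: \<mu>_def)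
  have \<mu>S: "\<mu> u \<le> S" if "u \<in> Bp" for u
  proof -
    have "m u \<le> s" unfolding s_def by (rule SUP_upper[OF that])
    then show ?thesis unfolding \<mu>[OF that] sS using S0 by (simp add: ennreal_le_iff)
  qed
  have \<mu>G: "\<mu> u \<le> a" if "u \<in> Bp" "v \<in> K" "G \<rho> u v = ennreal a" "0 \<le> a" for u v a
  proof -
    have "m u \<le> G \<rho> u v" unfolding m_def by (rule INF_lower[OF that(2)])
    then show ?thesis unfolding \<mu>[OF that(1)] that(3) using that(4) by (simp add: ennreal_le_iff)
  qed
  have near: "\<exists>v\<in>K. G \<rho> u v \<le> ennreal (\<mu> u + \<eta>)" if u: "u \<in> Bp" and \<eta>: "0 < \<eta>" for u \<eta>
  proof -
    have "m u < m u + ennreal \<eta>" using \<mu>[OF u] \<eta> by (intro ennreal_less_add_pos) auto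
    then obtain v where v: "v \<in> K" "G \<rho> u v < m u + ennreal \<eta>" unfolding m_def INF_less_iff by auto
    then show ?thesis using \<mu>[OF u] \<mu>0[of u] \<eta> by (intro bexI[OF _ v(1)]) (simp add: ennreal_plus less_imp_le)
  qed
  \<comment> \<open>The midpoint cannot fall below the infimum, so \<open>G_mid\<close> leaves at
    most \<eta> for half of \<open>D\<close>.\<close>
  have closeD: "D \<rho> v w \<le> ennreal (2 * \<eta>)"
    if u: "u \<in> Bp" and v: "v \<in> K" and w: "w \<in> K" and \<eta>: "0 \<le> \<eta>"
      and "G \<rho> u v \<le> ennreal (\<mu> u + \<eta>)" "G \<rho> u w \<le> ennreal (\<mu> u + \<eta>)" for u v w \<eta>
  proof -
    have "ennreal (\<mu> u) + D \<rho> v w / 2 \<le> G \<rho> u (\<lambda>j x. (v j x + w j x) / 2) + D \<rho> v w / 2"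
      unfolding \<mu>[OF u, symmetric] m_def by (intro add_right_mono INF_lower K_mid v w)
    also have "\<dots> = G \<rho> u v / 2 + G \<rho> u w / 2" by (rule G_mid[OF u v w \<rho>m \<rho>p])
    also have "\<dots> \<le> ennreal (\<mu> u + \<eta>) / 2 + ennreal (\<mu> u + \<eta>) / 2"
      by (intro add_mono divide_right_mono_ennreal that)
    also have "\<dots> = ennreal (\<mu> u) + ennreal \<eta>"
      using \<mu>0[of u] \<eta> by (simp add: ennreal_add_halves ennreal_plus)
    finally have "D \<rho> v w / 2 \<le> ennreal \<eta>" by (auto simp: ennreal_add_left_cancel_le)
    then have "D \<rho> v w / 2 + D \<rho> v w / 2 \<le> ennreal \<eta> + ennreal \<eta>" by (intro add_mono)
    then show ?thesis using \<eta> by (simp add: ennreal_add_halves flip: ennreal_plus)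
  qed
  \<comment> \<open>\<open>G\<close> is affine in \<open>u\<close>, so a bound at a mixture is a
    bound for the weighted mean of the values at its two ends.\<close>
  have split: "\<exists>a b. 0 \<le> a \<and> 0 \<le> b \<and> G \<rho> u v = ennreal a \<and> G \<rho> w v = ennreal b \<and> (1 - t) * a + t * b \<le> c"
    if u: "u \<in> Bp" and w: "w \<in> Bp" and v: "v \<in> K" and t: "0 < t" "t < 1" and c: "0 \<le> c"
      and le: "G \<rho> (\<lambda>j x. (1 - t) * u j x + t * w j x) v \<le> ennreal c" for u w v t c
  proof -
    note [measurable] = BpD(3)[OF u] BpD(3)[OF w] KD(1)[OF v]
    have "G \<rho> (\<lambda>j x. (1 - t) * u j x + t * w j x) v
      = (\<integral>\<^sup>+x. ennreal (1 - t) * ennreal (pairing u v x + pen \<rho> v x)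
             + ennreal t * ennreal (pairing w v x + pen \<rho> v x) \<partial>M)"
      unfolding G_def
    proof (intro nn_integral_cong)
      fix x
      have "pairing (\<lambda>j x. (1 - t) * u j x + t * w j x) v x + pen \<rho> v x
         = (1 - t) * (pairing u v x + pen \<rho> v x) + t * (pairing w v x + pen \<rho> v x)"
        unfolding pairing_lin by (simp add: algebra_simps)
      then show "ennreal (pairing (\<lambda>j x. (1 - t) * u j x + t * w j x) v x + pen \<rho> v x)
        = ennreal (1 - t) * ennreal (pairing u v x + pen \<rho> v x) + ennreal t * ennreal (pairing w v x + pen \<rho> v x)"
        using t nn[OF u v, of x] nn[OF w v, of x] by (simp flip: ennreal_mult' ennreal_plus)
    qed
    also have "\<dots> = ennreal (1 - t) * G \<rho> u v + ennreal t * G \<rho> w v"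
      unfolding G_def by (simp add: nn_integral_add nn_integral_cmult)
    finally have *: "ennreal (1 - t) * G \<rho> u v + ennreal t * G \<rho> w v \<le> ennreal c" using le by simp
    have "G \<rho> u v \<noteq> \<infinity>" "G \<rho> w v \<noteq> \<infinity>"
      using * t by (auto simp: ennreal_mult_top top_unique)
    then obtain a b where ab: "0 \<le> a" "G \<rho> u v = ennreal a" "0 \<le> b" "G \<rho> w v = ennreal b"
      by (metis ennreal_cases infinity_ennreal_def)
    have "(1 - t) * a + t * b \<le> c"
      using * t c ab by (simp flip: ennreal_mult' ennreal_plus add: ennreal_le_iff)
    then show ?thesis using ab by blast
  qed
  have mid_near: "\<exists>v\<in>K. G \<rho> u v \<le> ennreal (S + \<eta>)" if u: "u \<in> Bp" and \<eta>: "0 < \<eta>" for u \<eta>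
  proof -
    obtain v where v: "v \<in> K" "G \<rho> u v \<le> ennreal (\<mu> u + \<eta>)" using near[OF u \<eta>] by auto
    note v(2)
    also have "ennreal (\<mu> u + \<eta>) \<le> ennreal (S + \<eta>)" using \<mu>S[OF u] by (intro ennreal_leI) simp
    finally show ?thesis using v(1) by auto
  qed
  \<comment> \<open>The accuracy \<open>16^-n\<close> is the square of \<open>4^-n\<close>: after
    division by a mixing parameter of order \<open>4^-n\<close> the error is still of order
    \<open>4^-n\<close>.\<close>
  define \<eta> where "\<eta> n = (1 / 16 :: real) ^ n" for n
  have \<eta>: "0 < \<eta> n" for n by (simp add: \<eta>_def)
  have \<eta>le: "\<eta> n \<le> (1 / 4) ^ n" for n unfolding \<eta>_def by (intro power_mono) auto
  have "\<exists>u\<in>Bp. S \<le> \<mu> u + \<eta> n" for n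
  proof (rule ccontr)
    assume "\<not> ?thesis"
    then have *: "\<mu> u < S - \<eta> n" if "u \<in> Bp" for u using that by (auto simp: not_le)
    obtain u where "u \<in> Bp" using Bp_ne by auto
    with *[of u] \<mu>0[of u] have "0 < S - \<eta> n" by linarith
    have "s \<le> ennreal (S - \<eta> n)" unfolding s_def
      using * by (intro SUP_least) (simp add: \<mu> ennreal_leI less_imp_le)
    then show False unfolding sS using \<eta>[of n] \<open>0 < S - \<eta> n\<close> by (simp add: ennreal_le_iff)
  qed
  then obtain us where us: "\<And>n. us n \<in> Bp" "\<And>n. S \<le> \<mu> (us n) + \<eta> n" by metis
  have "\<exists>v. v \<in> K \<and> G \<rho> (us n) v \<le> ennreal (\<mu> (us n) + \<eta> n)" for n
    using near[OF us(1) \<eta>, of n n] by blast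
  then obtain vs where vs: "\<And>n. vs n \<in> K" "\<And>n. G \<rho> (us n) (vs n) \<le> ennreal (\<mu> (us n) + \<eta> n)"
    by metis
  note vsm [measurable] = KD(1)[OF vs(1)]
  have mono: "\<eta> (Suc n) \<le> \<eta> n" for n by (simp add: \<eta>_def)
  have step: "D \<rho> (vs (Suc n)) (vs n) \<le> ennreal (32 / 4 ^ n)" for n
  proof -
    \<comment> \<open>A near-minimizer \<open>v\<close> for the midpoint of consecutive
      \<open>us\<close> is nearly minimal for both, as neither value can be lower than
      \<open>S - \<eta> n\<close> and their mean is at most \<open>S + \<eta> n\<close>. So
      \<open>v\<close> links \<open>vs n\<close> to \<open>vs (Suc n)\<close>.\<close>
    let ?u = "\<lambda>j x. (1 - 1/2) * us n j x + (1/2) * us (Suc n) j x"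
    have "?u \<in> Bp" by (rule Bp_conv[OF BpD(1)[OF us(1)] us(1)]) auto
    then obtain v where v: "v \<in> K" "G \<rho> ?u v \<le> ennreal (S + \<eta> n)" using mid_near[OF _ \<eta>] by blast
    have "0 \<le> S + \<eta> n" using S0 \<eta>[of n] by simp
    from split[OF us(1)[of n] us(1)[of "Suc n"] v(1) _ _ this v(2)]
    obtain a b where ab: "0 \<le> a" "0 \<le> b" "G \<rho> (us n) v = ennreal a" "G \<rho> (us (Suc n)) v = ennreal b"
      "(1 - 1/2) * a + 1/2 * b \<le> S + \<eta> n" by auto
    have b1: "\<mu> (us n) \<le> a" by (rule \<mu>G[OF us(1) v(1) ab(3,1)])
    have b2: "\<mu> (us (Suc n)) \<le> b" by (rule \<mu>G[OF us(1) v(1) ab(4,2)])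
    have "a \<le> \<mu> (us n) + 4 * \<eta> n" "b \<le> \<mu> (us (Suc n)) + 4 * \<eta> n"
      using b1 b2 ab(5) us(2)[of n] us(2)[of "Suc n"] mono[of n] by auto
    have "D \<rho> (vs n) v \<le> ennreal (2 * (4 * \<eta> n))"
    proof (rule closeD[OF us(1) vs(1) v(1)])
      show "G \<rho> (us n) (vs n) \<le> ennreal (\<mu> (us n) + 4 * \<eta> n)"
        using \<eta>[of n] by (intro order_trans[OF vs(2)] ennreal_leI) simp
      show "G \<rho> (us n) v \<le> ennreal (\<mu> (us n) + 4 * \<eta> n)"
        unfolding ab(3) by (intro ennreal_leI) fact
    qed (use \<eta>[of n] in simp)
    moreover have "D \<rho> (vs (Suc n)) v \<le> ennreal (2 * (4 * \<eta> n))"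
    proof (rule closeD[OF us(1) vs(1) v(1)])
      show "G \<rho> (us (Suc n)) (vs (Suc n)) \<le> ennreal (\<mu> (us (Suc n)) + 4 * \<eta> n)"
        using \<eta>[of n] mono[of n] by (intro order_trans[OF vs(2)] ennreal_leI) simp
      show "G \<rho> (us (Suc n)) v \<le> ennreal (\<mu> (us (Suc n)) + 4 * \<eta> n)"
        unfolding ab(4) by (intro ennreal_leI) fact
    qed (use \<eta>[of n] in simp)
    moreover have "D \<rho> v (vs n) = D \<rho> (vs n) v" unfolding D_def by (simp add: power2_commute)
    moreover have "D \<rho> (vs (Suc n)) (vs n) \<le> 2 * D \<rho> (vs (Suc n)) v + 2 * D \<rho> v (vs n)"
      by (rule D_triangle[OF vsm KD(1)[OF v(1)] vsm \<rho>m \<rho>p])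
    ultimately have "D \<rho> (vs (Suc n)) (vs n) \<le> 2 * ennreal (8 * \<eta> n) + 2 * ennreal (8 * \<eta> n)"
      by (elim order_trans) (intro add_mono mult_left_mono; simp)
    also have "\<dots> = ennreal (32 * \<eta> n)"
      using \<eta>[of n] by (simp add: ennreal_mult' flip: ennreal_plus distrib_right)
    also have "\<dots> \<le> ennreal (32 / 4 ^ n)" using \<eta>le[of n] by (intro ennreal_leI) (simp add: power_divide)
    finally show ?thesis .
  qed
  have Dj: "(\<integral>\<^sup>+x. ennreal (\<rho> x * (exp (- v j x / 2) - exp (- w j x / 2))\<^sup>2) \<partial>M) \<le> D \<rho> v w" for v w j
    unfolding D_def
  proof (intro nn_integral_mono ennreal_leI mult_left_mono)
    fix x
    show "(exp (- v j x / 2) - exp (- w j x / 2))\<^sup>2 \<le> (\<Sum>j\<in>UNIV. (exp (- v j x / 2) - exp (- w j x / 2))\<^sup>2)"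
      by (rule member_le_sum[of j UNIV "\<lambda>j. (exp (- v j x / 2) - exp (- w j x / 2))\<^sup>2"]) auto
  qed (use \<rho>p in \<open>simp add: less_imp_le\<close>)
  define z where "z j x = lim (\<lambda>k. exp (- vs k j x / 2))" for j x
  have zm [measurable]: "z j \<in> borel_measurable M" for j unfolding z_def by measurable
  have "AE x in M. convergent (\<lambda>k. exp (- vs k j x / 2))" for j
  proof (rule AE_convergent_of_weighted_squares[OF _ \<rho>m \<rho>p])
    show "(\<integral>\<^sup>+x. ennreal (\<rho> x * (exp (- vs (Suc k) j x / 2) - exp (- vs k j x / 2))\<^sup>2) \<partial>M)
        \<le> ennreal (32 / 4 ^ k)" for k
      by (rule order_trans[OF Dj step])
  qed auto
  then have zlim: "AE x in M. \<forall>j\<in>UNIV. (\<lambda>k. exp (- vs k j x / 2)) \<longlonglongrightarrow> z j x"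
    unfolding z_def convergent_LIMSEQ_iff by (intro AE_finite_allI) auto
  \<comment> \<open>For each \<open>u\<close> an own sequence in \<open>K\<close>, nearly optimal at
    \<open>u\<close>, whose exponentials tend to the \<open>z\<close> that was fixed before
    \<open>u\<close>.\<close>
  have approx: "\<exists>ws. (\<forall>k. ws k \<in> K) \<and> (\<forall>k. G \<rho> u (ws k) \<le> ennreal (S + 4 / 4 ^ k)) \<and>
      (AE x in M. \<forall>j\<in>UNIV. (\<lambda>k. exp (- ws k j x / 2)) \<longlonglongrightarrow> z j x)" if u: "u \<in> Bp" for u
  proof -
    \<comment> \<open>The share of \<open>u\<close> in the mixture: small enough that
      \<open>w\<close> remains close to \<open>vs k\<close>, large enough that
      \<open>2 * \<eta> k / t k = 4 / 4^k\<close> tends to 0.\<close>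
    define t where "t k = 1 / 2 * (1 / 4 :: real) ^ k" for k
    have t: "0 < t k" "t k \<le> 1 / 2" for k
      using power_le_one[of "1/4::real" k] by (auto simp: t_def)
    have "\<exists>w\<in>K. G \<rho> u w \<le> ennreal (S + 4 / 4 ^ k) \<and> D \<rho> w (vs k) \<le> ennreal (2 * (S + 3) / 4 ^ k)" for k
    proof -
      let ?u = "\<lambda>j x. (1 - t k) * us k j x + t k * u j x"
      have "?u \<in> Bp" using t[of k] by (intro Bp_conv[OF BpD(1)[OF us(1)] u]) auto
      then obtain w where w: "w \<in> K" "G \<rho> ?u w \<le> ennreal (S + \<eta> k)" using mid_near[OF _ \<eta>] by blast
      have "0 \<le> S + \<eta> k" "t k < 1" using S0 \<eta>[of k] t(2)[of k] by auto
      from split[OF us(1)[of k] u w(1) t(1) this(2,1) w(2)]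
      obtain a b where ab: "0 \<le> a" "0 \<le> b" "G \<rho> (us k) w = ennreal a" "G \<rho> u w = ennreal b"
        "(1 - t k) * a + t k * b \<le> S + \<eta> k" by auto
      have "\<mu> (us k) \<le> a" by (rule \<mu>G[OF us(1) w(1) ab(3,1)])
      then have a: "S - \<eta> k \<le> a" using us(2)[of k] by linarith
      have "(1 - t k) * (S - \<eta> k) \<le> (1 - t k) * a" using a t(2)[of k] by (intro mult_left_mono) auto
      then have "t k * b \<le> S + \<eta> k - (1 - t k) * (S - \<eta> k)" using ab(5) by linarith
      also have "\<dots> \<le> t k * S + 2 * \<eta> k" using t[of k] \<eta>[of k] by (simp add: algebra_simps)
      also have "\<dots> = t k * (S + 4 / 4 ^ k)"
      proof -
        have "(16::real) ^ k = 4 ^ k * 4 ^ k" by (simp flip: power_mult_distrib)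
        then show ?thesis by (simp add: t_def \<eta>_def field_simps)
      qed
      finally have b: "b \<le> S + 4 / 4 ^ k" using t(1)[of k] by simp
      have "(1 - t k) * a \<le> S + \<eta> k" using ab(5) mult_nonneg_nonneg[OF less_imp_le[OF t(1)] ab(2), of k] by linarith
      moreover have "(1 + 2 * t k) * (1 - t k) \<ge> 1"
        using mult_mono[of "t k" "t k" "t k" "1/2"] t[of k] by (simp add: algebra_simps)
      ultimately have "a \<le> (1 + 2 * t k) * (S + \<eta> k)"
      proof -
        have "1 * a \<le> ((1 + 2 * t k) * (1 - t k)) * a"
          using \<open>(1 + 2 * t k) * (1 - t k) \<ge> 1\<close> ab(1) by (rule mult_right_mono)
        also have "\<dots> \<le> (1 + 2 * t k) * (S + \<eta> k)"
          unfolding mult.assoc using \<open>(1 - t k) * a \<le> S + \<eta> k\<close> t[of k] by (intro mult_left_mono) auto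
        finally show ?thesis by simp
      qed
      also have "\<dots> \<le> S + 2 * t k * S + 2 * \<eta> k"
        using mult_right_mono[OF t(2)[of k], of "\<eta> k"] \<eta>[of k] by (simp add: algebra_simps)
      also have "\<dots> \<le> \<mu> (us k) + (2 * t k * S + 3 * \<eta> k)" using us(2)[of k] by simp
      finally have a': "a \<le> \<mu> (us k) + (2 * t k * S + 3 * \<eta> k)" .
      have "0 \<le> 2 * t k * S + 2 * \<eta> k" using t(1)[of k] S0 \<eta>[of k] by simp
      have "D \<rho> w (vs k) \<le> ennreal (2 * (2 * t k * S + 3 * \<eta> k))"
      proof (rule closeD[OF us(1) w(1) vs(1)])
        show "G \<rho> (us k) w \<le> ennreal (\<mu> (us k) + (2 * t k * S + 3 * \<eta> k))"
          unfolding ab(3) by (intro ennreal_leI a')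
        show "G \<rho> (us k) (vs k) \<le> ennreal (\<mu> (us k) + (2 * t k * S + 3 * \<eta> k))"
          using \<open>0 \<le> 2 * t k * S + 2 * \<eta> k\<close> by (intro order_trans[OF vs(2)] ennreal_leI) simp
      qed (use \<open>0 \<le> 2 * t k * S + 2 * \<eta> k\<close> \<eta>[of k] in simp)
      also have "\<dots> \<le> ennreal (2 * (S + 3) / 4 ^ k)"
        using \<eta>le[of k] by (intro ennreal_leI) (simp add: t_def power_divide field_simps)
      finally show ?thesis using w(1) b ab(4) by (intro bexI[of _ w]) (auto intro: ennreal_leI)
    qed
    then obtain ws where ws: "\<And>k. ws k \<in> K" "\<And>k. G \<rho> u (ws k) \<le> ennreal (S + 4 / 4 ^ k)"
      "\<And>k. D \<rho> (ws k) (vs k) \<le> ennreal (2 * (S + 3) / 4 ^ k)" by metis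
    note [measurable] = KD(1)[OF ws(1)]
    have "AE x in M. summable (\<lambda>k. \<bar>exp (- ws k j x / 2) - exp (- vs k j x / 2)\<bar>)" for j
    proof (rule AE_summable_of_weighted_squares[OF _ \<rho>m \<rho>p])
      show "(\<integral>\<^sup>+x. ennreal (\<rho> x * (exp (- ws k j x / 2) - exp (- vs k j x / 2))\<^sup>2) \<partial>M)
          \<le> ennreal (2 * (S + 3) / 4 ^ k)" for k
        by (rule order_trans[OF Dj ws(3)])
    qed (use S0 in auto)
    then have "AE x in M. \<forall>j\<in>UNIV. summable (\<lambda>k. \<bar>exp (- ws k j x / 2) - exp (- vs k j x / 2)\<bar>)"
      by (intro AE_finite_allI) auto
    with zlim have "AE x in M. \<forall>j\<in>UNIV. (\<lambda>k. exp (- ws k j x / 2)) \<longlonglongrightarrow> z j x"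
    proof eventually_elim
      case (elim x)
      show ?case
      proof
        fix j
        have "(\<lambda>k. exp (- ws k j x / 2) - exp (- vs k j x / 2)) \<longlonglongrightarrow> 0"
          by (rule summable_LIMSEQ_zero[OF summable_rabs_cancel]) (use elim(2) in auto)
        from tendsto_add[OF this, of "\<lambda>k. exp (- vs k j x / 2)" "z j x"] elim(1)
        show "(\<lambda>k. exp (- ws k j x / 2)) \<longlonglongrightarrow> z j x" by simp
      qed
    qed
    then show ?thesis using ws by blast
  qed
  have climit: "(\<lambda>k. ennreal (S + 4 / 4 ^ k)) \<longlonglongrightarrow> ennreal S"
  proof -
    have "(\<lambda>k. S + 4 * (1 / 4) ^ k) \<longlonglongrightarrow> S + 4 * 0" by (intro tendsto_intros LIMSEQ_power_zero) simp
    then show ?thesis by (intro tendsto_ennrealI) (simp add: power_divide)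
  qed
  \<comment> \<open>Were \<open>z j = 0\<close> on a set of positive measure, then
    \<open>ws k j\<close> would tend to infinity there, and its pairing with the positive
    \<open>u j\<close> would contradict the bound \<open>S\<close> by Fatou's lemma.\<close>
  have zpos: "AE x in M. \<forall>j\<in>UNIV. 0 < z j x"
  proof (intro AE_finite_allI)
    fix j
    obtain u where u: "u \<in> Bp" using Bp_ne by auto
    obtain ws where ws: "\<And>k. ws k \<in> K" "\<And>k. G \<rho> u (ws k) \<le> ennreal (S + 4 / 4 ^ k)"
      "AE x in M. \<forall>j\<in>UNIV. (\<lambda>k. exp (- ws k j x / 2)) \<longlonglongrightarrow> z j x" using approx[OF u] by blast
    note [measurable] = BpD(3)[OF u] KD(1)[OF ws(1)]
    let ?E = "\<lambda>x. if z j x = 0 then \<infinity> else ennreal (\<theta> j * u j x * (- 2 * ln (z j x)))"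
    have "(\<integral>\<^sup>+x. ?E x \<partial>M) \<le> ennreal S"
    proof (rule nn_integral_le_of_AE_tendsto[OF _ _ _ climit])
      show "(\<lambda>x. ennreal (\<theta> j * u j x * ws k j x)) \<in> borel_measurable M" for k by measurable
      show "(\<integral>\<^sup>+x. ennreal (\<theta> j * u j x * ws k j x) \<partial>M) \<le> ennreal (S + 4 / 4 ^ k)" for k
      proof (rule order_trans[OF _ ws(2)], unfold G_def, intro nn_integral_mono ennreal_leI)
        fix x
        have "\<theta> j * (u j x * ws k j x) \<le> pairing u (ws k) x"
          unfolding pairing_def
          by (rule member_le_sum[of j UNIV "\<lambda>j. \<theta> j * (u j x * ws k j x)"])
            (auto intro!: mult_nonneg_nonneg less_imp_le[OF \<theta>0] BpD(4)[OF u] KD(2)[OF ws(1)])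
        then show "\<theta> j * u j x * ws k j x \<le> pairing u (ws k) x + pen \<rho> (ws k) x"
          using nn(2)[OF u ws(1), of k x] by (simp add: mult.assoc)
      qed
      show "AE x in M. (\<lambda>k. ennreal (\<theta> j * u j x * ws k j x)) \<longlonglongrightarrow> ?E x"
        using ws(3) BpD(2)[OF u, of j]
      proof eventually_elim
        case (elim x)
        then have l: "(\<lambda>k. exp (- ws k j x / 2)) \<longlonglongrightarrow> z j x" by auto
        have k: "0 < \<theta> j * u j x" using elim \<theta>0 by simp
        show ?case
        proof (cases "z j x = 0")
          case True
          then show ?thesis using ennreal_tendsto_top_of_exp_half[of "\<lambda>k. ws k j x"] l k by simp
        next
          case False
          have "0 \<le> z j x" by (rule LIMSEQ_le_const[OF l]) auto
          then have "(\<lambda>k. ws k j x) \<longlonglongrightarrow> - 2 * ln (z j x)"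
            using False by (intro tendsto_of_exp_half_tendsto l) auto
          then show ?thesis unfolding if_not_P[OF False] by (intro tendsto_intros)
        qed
      qed
    qed
    then have "AE x in M. ?E x \<noteq> \<infinity>" by (intro nn_integral_PInf_AE) (auto simp: top_unique)
    with zlim show "AE x in M. 0 < z j x"
    proof eventually_elim
      case (elim x)
      then have "(\<lambda>k. exp (- vs k j x / 2)) \<longlonglongrightarrow> z j x" by auto
      then have "0 \<le> z j x" by (rule LIMSEQ_le_const) auto
      then show ?case using elim(2) by (auto split: if_splits)
    qed
  qed simp
  \<comment> \<open>The limit is nonnegative almost everywhere; the maximum makes it so at every
    point, as \<open>K\<close> demands.\<close>
  define v where "v j x = max 0 (- 2 * ln (z j x))" for j x
  have vm [measurable]: "v j \<in> borel_measurable M" for j unfolding v_def by measurable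
  have vlim: "AE x in M. \<forall>j\<in>UNIV. (\<lambda>k. ws k j x) \<longlonglongrightarrow> v j x"
    if "\<And>k. ws k \<in> K" "AE x in M. \<forall>j\<in>UNIV. (\<lambda>k. exp (- ws k j x / 2)) \<longlonglongrightarrow> z j x" for ws
    using that(2) zpos
  proof eventually_elim
    case (elim x)
    show ?case
    proof
      fix j
      have l: "(\<lambda>k. ws k j x) \<longlonglongrightarrow> - 2 * ln (z j x)"
        using elim by (intro tendsto_of_exp_half_tendsto) auto
      then have "0 \<le> - 2 * ln (z j x)"
        by (rule LIMSEQ_le_const) (auto intro: KD(2)[OF that(1)])
      then show "(\<lambda>k. ws k j x) \<longlonglongrightarrow> v j x" using l by (simp add: v_def)
    qed
  qed
  have "AE x in M. \<forall>k. F x \<le> (\<Prod>j\<in>UNIV. vs k j x powr \<theta> j)"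
    unfolding AE_all_countable using KD(3)[OF vs(1)] by blast
  with vlim[OF vs(1) zlim] have "AE x in M. F x \<le> (\<Prod>j\<in>UNIV. v j x powr \<theta> j)"
  proof eventually_elim
    case (elim x)
    have "(\<lambda>k. \<Prod>j\<in>UNIV. vs k j x powr \<theta> j) \<longlonglongrightarrow> (\<Prod>j\<in>UNIV. v j x powr \<theta> j)"
      using elim(1) \<theta>0 KD(2)[OF vs(1)] by (intro tendsto_prod tendsto_powr' tendsto_const) auto
    then show ?case by (rule LIMSEQ_le_const) (use elim(2) in auto)
  qed
  then have vK: "v \<in> K" by (auto simp: K_def v_def)
  have "(\<integral>\<^sup>+x. ennreal (pairing u v x) \<partial>M) \<le> ennreal (1 + \<epsilon>)" if u: "u \<in> Bp" for u
  proof -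
    obtain ws where ws: "\<And>k. ws k \<in> K" "\<And>k. G \<rho> u (ws k) \<le> ennreal (S + 4 / 4 ^ k)"
      "AE x in M. \<forall>j\<in>UNIV. (\<lambda>k. exp (- ws k j x / 2)) \<longlonglongrightarrow> z j x" using approx[OF u] by blast
    note [measurable] = BpD(3)[OF u] KD(1)[OF ws(1)]
    have "(\<integral>\<^sup>+x. ennreal (pairing u v x) \<partial>M) \<le> ennreal S"
    proof (rule nn_integral_le_of_AE_tendsto[OF _ _ _ climit])
      show "(\<lambda>x. ennreal (pairing u (ws k) x)) \<in> borel_measurable M" for k by measurable
      show "(\<integral>\<^sup>+x. ennreal (pairing u (ws k) x) \<partial>M) \<le> ennreal (S + 4 / 4 ^ k)" for k
        using nn(2)[OF u ws(1)[of k]]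
        by (intro order_trans[OF _ ws(2)], unfold G_def, intro nn_integral_mono ennreal_leI) auto
      show "AE x in M. (\<lambda>k. ennreal (pairing u (ws k) x)) \<longlonglongrightarrow> ennreal (pairing u v x)"
        using vlim[OF ws(1,3)]
        by eventually_elim (unfold pairing_def, intro tendsto_intros; simp)
    qed
    also have "\<dots> \<le> ennreal (1 + \<epsilon>)" by (intro ennreal_leI S1)
    finally show ?thesis .
  qed
  then show ?thesis by (rule that[OF vK])
qed

text \<open>The minimax lemma bounds a sum over \<open>j\<close> for each choice of
  \<open>u\<close>. The ball of each coordinate can be explored independently, so nearly extremal
  \<open>u j\<close> may be chosen simultaneously, and the bound for this one \<open>u\<close>
  controls the weighted sum of the separate suprema \<open>C j\<close>.\<close>

lemma lozanovskii_factorization: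
  assumes \<delta>: "0 < \<delta>"
  obtains v c where "\<And>j. v j \<in> borel_measurable M" "\<And>j x. 0 \<le> v j x"
    "AE x in M. F x \<le> (\<Prod>j\<in>UNIV. v j x powr \<theta> j)" "\<And>j. 0 < c j"
    "\<And>j b. b \<in> B j \<Longrightarrow> (\<integral>\<^sup>+x. ennreal (v j x * b x) \<partial>M) \<le> ennreal (c j)"
    "(\<Sum>j\<in>UNIV. \<theta> j * c j) \<le> 1 + \<delta>"
proof -
  define e where "e = \<delta> / 4"
  have e: "0 < e" using \<delta> by (simp add: e_def)
  obtain v where v: "v \<in> K" and vp: "\<And>u. u \<in> Bp \<Longrightarrow> (\<integral>\<^sup>+x. ennreal (pairing u v x) \<partial>M) \<le> ennreal (1 + e)"
    by (rule lozanovskii_minimax[OF e]) blast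
  note [measurable] = KD(1)[OF v]
  have all: "(\<integral>\<^sup>+x. ennreal (pairing u v x) \<partial>M) \<le> ennreal (1 + 2 * e)" if u: "\<And>j. u j \<in> B j" for u
  proof -
    note [measurable] = Bm[OF u]
    obtain w where w: "w \<in> Bp" using Bp_ne by auto
    \<comment> \<open>Mixing a share \<open>1 - q\<close> of a positive \<open>w\<close> into
      \<open>u\<close> makes it positive; the loss \<open>1 / q\<close> turns \<open>1 + e\<close>
      into \<open>1 + 2 * e\<close>.\<close>
    define q where "q = (1 + e) / (1 + 2 * e)"
    have q: "0 < q" "q < 1" using e by (simp_all add: q_def)
    have pn: "0 \<le> pairing u v x" "0 \<le> pairing w v x" for x
      using B0[OF u] BpD(4)[OF w] KD(2)[OF v] by (auto intro!: pairing_nonneg)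
    let ?u = "\<lambda>j x. (1 - (1 - q)) * u j x + (1 - q) * w j x"
    have "?u \<in> Bp" using q by (intro Bp_conv[OF u w]) auto
    have "ennreal q * (\<integral>\<^sup>+x. ennreal (pairing u v x) \<partial>M) = (\<integral>\<^sup>+x. ennreal (q * pairing u v x) \<partial>M)"
      using q by (simp add: nn_integral_cmult ennreal_mult' pn)
    also have "\<dots> \<le> (\<integral>\<^sup>+x. ennreal (pairing ?u v x) \<partial>M)"
      unfolding pairing_lin using q pn by (intro nn_integral_mono ennreal_leI) simp
    also have "\<dots> \<le> ennreal (1 + e)" by (rule vp[OF \<open>?u \<in> Bp\<close>])
    finally have "ennreal (1 / q) * (ennreal q * (\<integral>\<^sup>+x. ennreal (pairing u v x) \<partial>M)) \<le> ennreal (1 / q) * ennreal (1 + e)"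
      by (rule mult_left_mono) simp
    moreover have "ennreal (1 / q) * ennreal (1 + e) = ennreal (1 + 2 * e)"
    proof -
      have "1 / q * (1 + e) = 1 + 2 * e" using e by (simp add: q_def)
      moreover have "ennreal (1 / q) * ennreal (1 + e) = ennreal (1 / q * (1 + e))"
        using q by (intro ennreal_mult'[symmetric]) simp
      ultimately show ?thesis by simp
    qed
    moreover have "ennreal (1 / q) * ennreal q = 1" using q by (simp flip: ennreal_mult')
    ultimately show ?thesis by (simp add: mult.assoc[symmetric])
  qed
  have single: "ennreal (\<theta> j) * (\<integral>\<^sup>+x. ennreal (v j x * b x) \<partial>M) \<le> ennreal (1 + 2 * e)" if b: "b \<in> B j" for j b
  proof -
    obtain w where w: "w \<in> Bp" using Bp_ne by auto
    define u where "u = w(j := b)"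
    have u: "u i \<in> B i" for i using BpD(1)[OF w] b by (auto simp: u_def)
    note [measurable] = Bm[OF b]
    have "ennreal (\<theta> j) * (\<integral>\<^sup>+x. ennreal (v j x * b x) \<partial>M) = (\<integral>\<^sup>+x. ennreal (\<theta> j * (u j x * v j x)) \<partial>M)"
      using less_imp_le[OF \<theta>0] by (subst nn_integral_cmult[symmetric]) (auto simp: ennreal_mult' u_def mult.commute)
    also have "\<dots> \<le> (\<integral>\<^sup>+x. ennreal (pairing u v x) \<partial>M)"
      unfolding pairing_def
      by (intro nn_integral_mono ennreal_leI member_le_sum)
        (auto intro!: mult_nonneg_nonneg less_imp_le[OF \<theta>0] B0[OF u] KD(2)[OF v])
    also have "\<dots> \<le> ennreal (1 + 2 * e)" by (rule all[OF u])
    finally show ?thesis .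
  qed
  define C where "C j = (SUP b\<in>B j. \<integral>\<^sup>+x. ennreal (v j x * b x) \<partial>M)" for j
  have Cle: "C j \<le> ennreal ((1 + 2 * e) / \<theta> j)" for j
    unfolding C_def
  proof (rule SUP_least)
    fix b assume b: "b \<in> B j"
    have "ennreal (1 / \<theta> j) * (ennreal (\<theta> j) * (\<integral>\<^sup>+x. ennreal (v j x * b x) \<partial>M)) \<le> ennreal (1 / \<theta> j) * ennreal (1 + 2 * e)"
      by (intro mult_left_mono single b) simp
    moreover have "ennreal (1 / \<theta> j) * ennreal (\<theta> j) = 1" using \<theta>0[of j] by (simp flip: ennreal_mult')
    moreover have "ennreal (1 / \<theta> j) * ennreal (1 + 2 * e) = ennreal ((1 + 2 * e) / \<theta> j)"
    proof -
      have "ennreal (1 / \<theta> j) * ennreal (1 + 2 * e) = ennreal (1 / \<theta> j * (1 + 2 * e))"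
        using \<theta>0[of j] by (intro ennreal_mult'[symmetric]) simp
      then show ?thesis by simp
    qed
    ultimately show "(\<integral>\<^sup>+x. ennreal (v j x * b x) \<partial>M) \<le> ennreal ((1 + 2 * e) / \<theta> j)"
      by (simp add: mult.assoc[symmetric])
  qed
  have Cfin: "C j < \<infinity>" for j using le_less_trans[OF Cle] by simp
  \<comment> \<open>The summand \<open>e\<close> keeps \<open>c j\<close> positive, for later
    division, also when \<open>v j\<close> pairs to 0 with its whole ball.\<close>
  define c where "c j = enn2real (C j) + e" for j
  have "\<exists>b\<in>B j. C j \<le> (\<integral>\<^sup>+x. ennreal (v j x * b x) \<partial>M) + ennreal e" for j
  proof (cases "C j = 0")
    case True
    then show ?thesis using pos[of j] by auto
  next
    case False
    have "C j - ennreal e < C j"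
      using False Cfin[of j] e by (intro ennreal_between) (auto simp: ennreal_eq_0_iff not_le zero_less_iff_neq_zero)
    then obtain b where b: "b \<in> B j" "C j - ennreal e < (\<integral>\<^sup>+x. ennreal (v j x * b x) \<partial>M)"
      unfolding C_def less_SUP_iff by auto
    have "C j \<le> ennreal e + (\<integral>\<^sup>+x. ennreal (v j x * b x) \<partial>M)"
      using less_imp_le[OF b(2)] by (simp add: ennreal_minus_le_iff)
    then show ?thesis using b(1) by (intro bexI[of _ b]) (auto simp: add.commute)
  qed
  then obtain u where u: "\<And>j. u j \<in> B j" "\<And>j. C j \<le> (\<integral>\<^sup>+x. ennreal (v j x * u j x) \<partial>M) + ennreal e" by metis
  note [measurable] = Bm[OF u(1)]
  show ?thesis
  proof (rule that[of v c])
    show "0 < c j" for j using e by (simp add: c_def add_nonneg_pos)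
    show "(\<integral>\<^sup>+x. ennreal (v j x * b x) \<partial>M) \<le> ennreal (c j)" if "b \<in> B j" for j b
    proof -
      have "(\<integral>\<^sup>+x. ennreal (v j x * b x) \<partial>M) \<le> C j" unfolding C_def using that by (rule SUP_upper)
      also have "\<dots> = ennreal (enn2real (C j))" using Cfin[of j] by simp
      also have "\<dots> \<le> ennreal (c j)" using e by (intro ennreal_leI) (simp add: c_def)
      finally show ?thesis .
    qed
    have "ennreal (\<Sum>j\<in>UNIV. \<theta> j * c j) = (\<Sum>j\<in>UNIV. ennreal (\<theta> j) * ennreal (c j))"
      using \<theta>0 e by (subst sum_ennreal[symmetric]) (auto simp: c_def ennreal_mult' less_imp_le)
    also have "\<dots> \<le> (\<Sum>j\<in>UNIV. ennreal (\<theta> j) * (\<integral>\<^sup>+x. ennreal (v j x * u j x) \<partial>M) + ennreal (\<theta> j) * ennreal (2 * e))"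
    proof (intro sum_mono)
      fix j
      have "ennreal (c j) = C j + ennreal e" unfolding c_def using Cfin[of j] e by (simp add: ennreal_plus)
      also have "\<dots> \<le> (\<integral>\<^sup>+x. ennreal (v j x * u j x) \<partial>M) + ennreal e + ennreal e" by (intro add_right_mono u)
      also have "\<dots> = (\<integral>\<^sup>+x. ennreal (v j x * u j x) \<partial>M) + ennreal (2 * e)" using e by (simp add: add.assoc flip: ennreal_plus)
      finally show "ennreal (\<theta> j) * ennreal (c j) \<le> ennreal (\<theta> j) * (\<integral>\<^sup>+x. ennreal (v j x * u j x) \<partial>M) + ennreal (\<theta> j) * ennreal (2 * e)"
        by (simp add: mult_left_mono flip: distrib_left)
    qed
    also have "\<dots> = (\<integral>\<^sup>+x. ennreal (pairing u v x) \<partial>M) + ennreal (2 * e)"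
    proof -
      have "(\<Sum>j\<in>UNIV. ennreal (\<theta> j) * ennreal (2 * e)) = ennreal (2 * e)"
        using \<theta>0 \<theta>1 by (simp add: sum_ennreal less_imp_le flip: sum_distrib_right)
      moreover have "(\<integral>\<^sup>+x. ennreal (pairing u v x) \<partial>M) = (\<Sum>j\<in>UNIV. ennreal (\<theta> j) * (\<integral>\<^sup>+x. ennreal (v j x * u j x) \<partial>M))"
      proof -
        have "ennreal (pairing u v x) = (\<Sum>j\<in>UNIV. ennreal (\<theta> j) * ennreal (v j x * u j x))" for x
          unfolding pairing_def using B0[OF u(1)] KD(2)[OF v] less_imp_le[OF \<theta>0]
          by (subst sum_ennreal[symmetric]) (auto simp: ennreal_mult' mult.commute intro!: sum.cong)
        then show ?thesis by (simp add: nn_integral_sum nn_integral_cmult)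
      qed
      ultimately show ?thesis by (simp add: sum.distrib)
    qed
    also have "\<dots> \<le> ennreal (1 + 2 * e) + ennreal (2 * e)" by (intro add_right_mono all u)
    also have "\<dots> = ennreal (1 + \<delta>)" using e by (simp add: e_def flip: ennreal_plus)
    finally show "(\<Sum>j\<in>UNIV. \<theta> j * c j) \<le> 1 + \<delta>" using \<delta> by (subst (asm) ennreal_le_iff) auto
  qed (use KD[OF v] in auto)
qed

end

section \<open>Associate spaces and powers\<close>

lemma epow_1 [simp]: "epow a 1 = a"
  by (cases a) (auto simp: epow_def)

lemma epow_ennreal: "0 < t \<Longrightarrow> 0 \<le> a \<Longrightarrow> epow (ennreal a) t = ennreal (a powr t)"
  by (simp add: epow_def)

lemma epow_le_1_iff: "0 < t \<Longrightarrow> epow a t \<le> 1 \<longleftrightarrow> a \<le> 1"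
proof (cases a)
  case (real n)
  assume t: "0 < t"
  have "n powr t \<le> 1 \<longleftrightarrow> n \<le> 1"
    using t real powr_le1[of t n] gr_one_powr[of n t] by (auto simp: not_le[symmetric])
  then show ?thesis using t real by (simp add: epow_ennreal)
qed (auto simp: epow_def top_unique)

lemma epow_mono: "0 \<le> t \<Longrightarrow> a \<le> b \<Longrightarrow> epow a t \<le> epow b t"
  by (cases a; cases b) (auto simp: epow_def powr_mono2 top_unique ennreal_leI)

lemma epow_less_top: "a < top \<Longrightarrow> epow a t < top"
  by (auto simp: epow_def)

lemma epow_eq_0_iff: "0 < t \<Longrightarrow> epow a t = 0 \<longleftrightarrow> a = 0"
  by (cases a) (auto simp: epow_def ennreal_eq_0_iff)

lemma Lnorm_1: "Lnorm M 1 f = (\<integral>\<^sup>+x. ennreal (norm (f x)) \<partial>M)"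
  by (simp add: Lnorm_def)

lemma emb_L0: "u \<in> borel_measurable M \<Longrightarrow> emb u \<in> L0 M"
  unfolding L0_def by measurable

lemma L0_norm_meas: "f \<in> L0 M \<Longrightarrow> (\<lambda>x. norm (f x)) \<in> borel_measurable M"
  unfolding L0_def by measurable

text \<open>The part of the axioms that passes to powers and, given enough test functions, to
  associates: ideal property, homogeneity and definiteness. Associates and powers can thus be nested
  as in \<open>space_rs\<close>.\<close>

definition solid_space :: "'a measure \<Rightarrow> ('a, 'k::{real_normed_field,second_countable_topology}) fspace \<Rightarrow> bool"
  where
  "solid_space M Z \<longleftrightarrow> carr Z \<subseteq> L0 M \<and>
     (\<forall>f\<in>carr Z. \<forall>g\<in>L0 M. (AE x in M. norm (g x) \<le> norm (f x)) \<longrightarrow> g \<in> carr Z \<and> nrm Z g \<le> nrm Z f) \<and>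
     (\<forall>c. \<forall>f\<in>carr Z. (\<lambda>x. c * f x) \<in> carr Z \<and> nrm Z (\<lambda>x. c * f x) = ennreal (norm c) * nrm Z f) \<and>
     (\<forall>f\<in>carr Z. nrm Z f = 0 \<longrightarrow> (AE x in M. f x = 0))"

text \<open>Real-valued nonnegative representatives of the unit ball, the objects to which
  \<open>polar\<close> applies whatever the scalar field is.\<close>

definition pball :: "'a measure \<Rightarrow> ('a, 'k::{real_normed_field,second_countable_topology}) fspace
    \<Rightarrow> ('a \<Rightarrow> real) set" where
  "pball M Z = {b \<in> borel_measurable M. (\<forall>x. 0 \<le> b x) \<and> emb b \<in> carr Z \<and> nrm Z (emb b) \<le> 1}"

lemma solid_spaceD:
  assumes "solid_space M Z"
  shows "f \<in> carr Z \<Longrightarrow> f \<in> L0 M"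
    "f \<in> carr Z \<Longrightarrow> g \<in> L0 M \<Longrightarrow> AE x in M. norm (g x) \<le> norm (f x) \<Longrightarrow> g \<in> carr Z"
    "f \<in> carr Z \<Longrightarrow> g \<in> L0 M \<Longrightarrow> AE x in M. norm (g x) \<le> norm (f x) \<Longrightarrow> nrm Z g \<le> nrm Z f"
    "f \<in> carr Z \<Longrightarrow> (\<lambda>x. c * f x) \<in> carr Z"
    "f \<in> carr Z \<Longrightarrow> nrm Z (\<lambda>x. c * f x) = ennreal (norm c) * nrm Z f"
    "f \<in> carr Z \<Longrightarrow> nrm Z f = 0 \<Longrightarrow> AE x in M. f x = 0"
  using assms unfolding solid_space_def by blast+

lemma pballD:
  assumes "b \<in> pball M Z"
  shows "b \<in> borel_measurable M" "0 \<le> b x" "emb b \<in> carr Z" "nrm Z (emb b) \<le> 1"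
  using assms by (auto simp: pball_def)

lemma solid_space_emb_scale:
  assumes Z: "solid_space M Z" and u: "emb u \<in> carr Z"
  shows "emb (\<lambda>x. c * u x) \<in> carr Z" "nrm Z (emb (\<lambda>x. c * u x)) = ennreal \<bar>c\<bar> * nrm Z (emb u)"
  using solid_spaceD(4,5)[OF Z u, of "of_real c"] by simp_all

lemma solid_space_emb_norm:
  assumes Z: "solid_space M Z" and f: "f \<in> carr Z"
  shows "emb (\<lambda>x. norm (f x)) \<in> carr Z" "nrm Z (emb (\<lambda>x. norm (f x))) = nrm Z f"
proof -
  have m: "emb (\<lambda>x. norm (f x)) \<in> L0 M"
    by (rule emb_L0[OF L0_norm_meas[OF solid_spaceD(1)[OF Z f]]])
  show c: "emb (\<lambda>x. norm (f x)) \<in> carr Z" by (rule solid_spaceD(2)[OF Z f m]) simp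
  show "nrm Z (emb (\<lambda>x. norm (f x))) = nrm Z f"
    by (intro antisym solid_spaceD(3)[OF Z f m] solid_spaceD(3)[OF Z c solid_spaceD(1)[OF Z f]]) auto
qed

section \<open>Associate spaces in terms of unit balls\<close>

lemma nrm_kdual: "nrm (kdual M Z) g = (SUP f\<in>{f \<in> carr Z. nrm Z f = 1}. \<integral>\<^sup>+x. ennreal (norm (g x) * norm (f x)) \<partial>M)"
  by (simp add: kdual_def Lnorm_1 norm_mult mult.commute)

lemma carr_kdual: "carr (kdual M Z) = {g \<in> L0 M. \<forall>f\<in>carr Z. (\<integral>\<^sup>+x. ennreal (norm (g x) * norm (f x)) \<partial>M) < \<infinity>}"
  by (simp add: kdual_def Lnorm_1 norm_mult mult.commute)

text \<open>The associate norm tests only against functions of norm exactly 1. Other members of the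
  ball are rescaled, and those of norm 0 vanish almost everywhere by definiteness.\<close>

lemma kdual_pairing_le:
  fixes Z :: "('a, 'k::{real_normed_field,second_countable_topology}) fspace"
  assumes Z: "solid_space M Z" and g: "g \<in> L0 M" and le: "nrm (kdual M Z) g \<le> ennreal C" and b: "b \<in> pball M Z"
  shows "(\<integral>\<^sup>+x. ennreal (norm (g x) * b x) \<partial>M) \<le> ennreal C"
proof -
  note [measurable] = pballD(1)[OF b] L0_norm_meas[OF g]
  have c: "emb b \<in> carr Z" by (rule pballD(3)[OF b])
  obtain N where N: "0 \<le> N" "N \<le> 1" "nrm Z (emb b) = ennreal N"
    using pballD(4)[OF b] by (cases "nrm Z (emb b)") (auto simp: top_unique)
  show ?thesis
  proof (cases "N = 0")
    case True
    then have "AE x in M. (of_real (b x) :: 'k) = 0" using solid_spaceD(6)[OF Z c] N by simp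
    then have "(\<integral>\<^sup>+x. ennreal (norm (g x) * b x) \<partial>M) = (\<integral>\<^sup>+x. 0 \<partial>M)"
      by (intro nn_integral_cong_AE) (auto elim!: eventually_mono)
    then show ?thesis by simp
  next
    case False
    then have N0: "0 < N" using N by simp
    let ?f = "emb (\<lambda>x. 1 / N * b x) :: 'a \<Rightarrow> 'k"
    have f: "?f \<in> carr Z" "nrm Z ?f = 1"
      using solid_space_emb_scale[OF Z c, of "1 / N"] N N0 by (simp_all flip: ennreal_mult')
    have "(\<integral>\<^sup>+x. ennreal (norm (g x) * norm (?f x)) \<partial>M) \<le> ennreal C"
      using f by (intro order_trans[OF _ le]) (auto simp: nrm_kdual intro!: SUP_upper)
    then have "(\<integral>\<^sup>+x. ennreal (norm (g x) * (1 / N * b x)) \<partial>M) \<le> ennreal C"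
      using N0 pballD(2)[OF b] by (simp add: norm_divide)
    moreover have "(\<integral>\<^sup>+x. ennreal (norm (g x) * b x) \<partial>M) \<le> (\<integral>\<^sup>+x. ennreal (norm (g x) * (1 / N * b x)) \<partial>M)"
    proof (intro nn_integral_mono ennreal_leI mult_left_mono)
      fix x
      have "N * b x \<le> 1 * b x" using N pballD(2)[OF b, of x] by (intro mult_right_mono) auto
      then show "b x \<le> 1 / N * b x" using N0 by (simp add: field_simps)
    qed simp
    ultimately show ?thesis by simp
  qed
qed

lemma pball_of_norm:
  assumes Z: "solid_space M Z" and f: "f \<in> carr Z" and le: "nrm Z f \<le> ennreal N" and N: "0 < N"
  shows "(\<lambda>x. norm (f x) / N) \<in> pball M Z"
proof -
  note [measurable] = L0_norm_meas[OF solid_spaceD(1)[OF Z f]]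
  have "nrm Z (emb (\<lambda>x. 1 / N * norm (f x))) = ennreal (1 / N) * nrm Z f"
    using solid_space_emb_scale(2)[OF Z solid_space_emb_norm(1)[OF Z f], of "1 / N"] N
      solid_space_emb_norm(2)[OF Z f] by simp
  also have "\<dots> \<le> ennreal (1 / N) * ennreal N" by (intro mult_left_mono le) simp
  also have "\<dots> = 1" using N by (simp flip: ennreal_mult')
  finally show ?thesis
    using solid_space_emb_scale(1)[OF Z solid_space_emb_norm(1)[OF Z f], of "1 / N"] N
    by (simp add: pball_def)
qed

lemma kdual_memI:
  assumes Z: "solid_space M Z" and fin: "\<And>f. f \<in> carr Z \<Longrightarrow> nrm Z f < \<infinity>" and g: "g \<in> L0 M"
    and le: "\<And>b. b \<in> pball M Z \<Longrightarrow> (\<integral>\<^sup>+x. ennreal (norm (g x) * b x) \<partial>M) \<le> ennreal C"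
  shows "g \<in> carr (kdual M Z)" "nrm (kdual M Z) g \<le> ennreal C"
proof -
  note [measurable] = L0_norm_meas[OF g]
  have "(\<integral>\<^sup>+x. ennreal (norm (g x) * norm (f x)) \<partial>M) < \<infinity>" if f: "f \<in> carr Z" for f
  proof -
    note [measurable] = L0_norm_meas[OF solid_spaceD(1)[OF Z f]]
    define N where "N = enn2real (nrm Z f) + 1"
    have N: "0 < N" "nrm Z f \<le> ennreal N" using fin[OF f] by (auto simp: N_def add_nonneg_pos ennreal_plus less_top)
    have "(\<integral>\<^sup>+x. ennreal (norm (g x) * norm (f x)) \<partial>M) = ennreal N * (\<integral>\<^sup>+x. ennreal (norm (g x) * (norm (f x) / N)) \<partial>M)"
      using N(1) by (subst nn_integral_cmult[symmetric]) (auto simp flip: ennreal_mult')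
    also have "\<dots> \<le> ennreal N * ennreal C" by (intro mult_left_mono le pball_of_norm[OF Z f N(2,1)]) simp
    also have "\<dots> < \<infinity>" by (simp flip: ennreal_mult'' add: ennreal_mult_less_top)
    finally show ?thesis .
  qed
  then show "g \<in> carr (kdual M Z)" using g by (simp add: carr_kdual)
  show "nrm (kdual M Z) g \<le> ennreal C"
    unfolding nrm_kdual
  proof (rule SUP_least)
    fix f assume "f \<in> {f \<in> carr Z. nrm Z f = 1}"
    then have f: "f \<in> carr Z" "nrm Z f \<le> ennreal 1" by auto
    show "(\<integral>\<^sup>+x. ennreal (norm (g x) * norm (f x)) \<partial>M) \<le> ennreal C"
      using le[OF pball_of_norm[OF Z f]] by simp
  qed
qed

text \<open>The bridge between the two languages: \<open>kdual\<close> becomes \<open>polar\<close>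
  on unit balls, for any scalar field.\<close>

lemma pball_kdual:
  fixes Z :: "('a, 'k::{real_normed_field,second_countable_topology}) fspace"
  assumes Z: "solid_space M Z" and fin: "\<And>f. f \<in> carr Z \<Longrightarrow> nrm Z f < \<infinity>"
  shows "pball M (kdual M Z) = polar M (pball M Z)"
proof (intro set_eqI iffI)
  fix g assume g: "g \<in> pball M (kdual M Z)"
  have "(\<integral>\<^sup>+x. ennreal (g x * b x) \<partial>M) \<le> 1" if b: "b \<in> pball M Z" for b
    using kdual_pairing_le[OF Z emb_L0[OF pballD(1)[OF g]] _ b, of 1] pballD(2,4)[OF g] by simp
  then show "g \<in> polar M (pball M Z)" using pballD(1,2)[OF g] by (auto simp: polar_def)
next
  fix g assume g: "g \<in> polar M (pball M Z)"
  have "(\<integral>\<^sup>+x. ennreal (norm (of_real (g x) :: 'k) * b x) \<partial>M) \<le> ennreal 1" if b: "b \<in> pball M Z" for b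
    using polarD(2,3)[OF g] that by simp
  from kdual_memI[OF Z fin emb_L0[OF polarD(1)[OF g]] this]
  show "g \<in> pball M (kdual M Z)" using polarD(1,2)[OF g] by (auto simp: pball_def)
qed

text \<open>Only definiteness needs \<open>total\<close>: a function pairing to 0 with the whole
  ball must vanish, which fails for a ball that does not see all of the space.\<close>

lemma solid_space_kdual:
  fixes Z :: "('a, 'k::{real_normed_field,second_countable_topology}) fspace"
  assumes Z: "solid_space M Z"
    and total: "\<And>g. g \<in> borel_measurable M \<Longrightarrow> (\<And>x. 0 \<le> g x) \<Longrightarrow>
      (\<And>b. b \<in> pball M Z \<Longrightarrow> (\<integral>\<^sup>+x. ennreal (g x * b x) \<partial>M) = 0) \<Longrightarrow> AE x in M. g x = 0"
  shows "solid_space M (kdual M Z)"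
  unfolding solid_space_def
proof (intro conjI ballI allI impI)
  show "carr (kdual M Z) \<subseteq> L0 M" by (auto simp: carr_kdual)
next
  fix g h :: "'a \<Rightarrow> 'k" assume g: "g \<in> carr (kdual M Z)" and h: "h \<in> L0 M" and le: "AE x in M. norm (h x) \<le> norm (g x)"
  have mono: "(\<integral>\<^sup>+x. ennreal (norm (h x) * norm (f x)) \<partial>M) \<le> (\<integral>\<^sup>+x. ennreal (norm (g x) * norm (f x)) \<partial>M)" for f :: "'a \<Rightarrow> 'k"
    using le by (intro nn_integral_mono_AE) (auto elim!: eventually_mono intro!: ennreal_leI mult_right_mono)
  then show "h \<in> carr (kdual M Z)" using g h by (auto simp: carr_kdual intro: le_less_trans)
  show "nrm (kdual M Z) h \<le> nrm (kdual M Z) g" unfolding nrm_kdual by (intro SUP_mono') (rule mono)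
next
  fix c g assume g: "g \<in> carr (kdual M Z)"
  have gm: "g \<in> L0 M" using g by (simp add: carr_kdual)
  have eq: "(\<integral>\<^sup>+x. ennreal (norm (c * g x) * norm (f x)) \<partial>M) = ennreal (norm c) * (\<integral>\<^sup>+x. ennreal (norm (g x) * norm (f x)) \<partial>M)"
    if "f \<in> carr Z" for f
    using L0_norm_meas[OF solid_spaceD(1)[OF Z that]] L0_norm_meas[OF gm]
    by (subst nn_integral_cmult[symmetric]) (auto simp: norm_mult mult.assoc ennreal_mult')
  have "(\<lambda>x. c * g x) \<in> L0 M" using gm unfolding L0_def by measurable
  then show "(\<lambda>x. c * g x) \<in> carr (kdual M Z)"
    using g by (auto simp: carr_kdual eq ennreal_mult_less_top)
  show "nrm (kdual M Z) (\<lambda>x. c * g x) = ennreal (norm c) * nrm (kdual M Z) g"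
    unfolding nrm_kdual SUP_mult_left_ennreal by (intro SUP_cong refl eq) auto
next
  fix g assume g: "g \<in> carr (kdual M Z)" and 0: "nrm (kdual M Z) g = 0"
  have gm: "g \<in> L0 M" using g by (simp add: carr_kdual)
  have "AE x in M. norm (g x) = 0"
    using kdual_pairing_le[OF Z gm, of 0] 0 by (intro total L0_norm_meas[OF gm]) auto
  then show "AE x in M. g x = 0" by simp
qed

lemma solid_space_pow:
  fixes Z :: "('a, 'k::{real_normed_field,second_countable_topology}) fspace"
  assumes Z: "solid_space M Z" and t: "0 < t"
  shows "solid_space M (space_pow M t Z)"
  unfolding solid_space_def
proof (intro conjI ballI allI impI)
  show "carr (space_pow M t Z) \<subseteq> L0 M" by (auto simp: space_pow_def)
next
  fix f g :: "'a \<Rightarrow> 'k" assume f: "f \<in> carr (space_pow M t Z)" and g: "g \<in> L0 M" and le: "AE x in M. norm (g x) \<le> norm (f x)"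
  let ?f = "emb (\<lambda>x. norm (f x) powr (1 / t)) :: 'a \<Rightarrow> 'k" and ?g = "emb (\<lambda>x. norm (g x) powr (1 / t)) :: 'a \<Rightarrow> 'k"
  have fc: "?f \<in> carr Z" using f by (simp add: space_pow_def)
  note [measurable] = L0_norm_meas[OF g]
  have gm: "?g \<in> L0 M" by (intro emb_L0) measurable
  have le': "AE x in M. norm (?g x) \<le> norm (?f x)"
    using le by eventually_elim (use t in \<open>simp add: powr_mono2\<close>)
  show "g \<in> carr (space_pow M t Z)" using solid_spaceD(2)[OF Z fc gm le'] g by (simp add: space_pow_def)
  show "nrm (space_pow M t Z) g \<le> nrm (space_pow M t Z) f"
    using solid_spaceD(3)[OF Z fc gm le'] t by (simp add: space_pow_def epow_mono)
next
  fix c f assume f: "f \<in> carr (space_pow M t Z)"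
  let ?f = "\<lambda>x. norm (f x) powr (1 / t)"
  have fc: "emb ?f \<in> carr Z" and fm: "f \<in> L0 M" using f by (auto simp: space_pow_def)
  have eq: "norm (c * f x) powr (1 / t) = norm c powr (1 / t) * ?f x" for x
    by (simp add: norm_mult powr_mult)
  note sc = solid_space_emb_scale[OF Z fc, of "norm c powr (1 / t)"]
  have "(\<lambda>x. c * f x) \<in> L0 M" using fm unfolding L0_def by measurable
  then show "(\<lambda>x. c * f x) \<in> carr (space_pow M t Z)" using sc(1) by (simp add: space_pow_def eq)
  show "nrm (space_pow M t Z) (\<lambda>x. c * f x) = ennreal (norm c) * nrm (space_pow M t Z) f"
  proof (cases "nrm Z (emb ?f)")
    case (real n)
    have "nrm (space_pow M t Z) (\<lambda>x. c * f x) = epow (ennreal (norm c powr (1 / t) * n)) t"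
      using sc(2) real by (simp add: space_pow_def eq ennreal_mult')
    also have "\<dots> = ennreal (norm c * n powr t)"
      using t real by (simp add: epow_ennreal powr_mult powr_powr)
    finally show ?thesis using t real by (simp add: space_pow_def epow_ennreal ennreal_mult')
  next
    case top
    then show ?thesis using sc(2) t
      by (cases "c = 0") (auto simp: space_pow_def eq epow_def ennreal_mult_top ennreal_top_mult)
  qed
next
  fix f assume f: "f \<in> carr (space_pow M t Z)" and 0: "nrm (space_pow M t Z) f = 0"
  have "emb (\<lambda>x. norm (f x) powr (1 / t)) \<in> carr Z" "nrm Z (emb (\<lambda>x. norm (f x) powr (1 / t))) = 0"
    using f 0 t by (auto simp: space_pow_def epow_eq_0_iff)
  from solid_spaceD(6)[OF Z this] show "AE x in M. f x = 0"
    by eventually_elim simp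
qed

lemma pball_space_pow:
  fixes Z :: "('a, 'k::{real_normed_field,second_countable_topology}) fspace"
  assumes "0 < t"
  shows "b \<in> pball M (space_pow M t Z) \<longleftrightarrow> b \<in> borel_measurable M \<and> (\<forall>x. 0 \<le> b x) \<and> (\<lambda>x. b x powr (1 / t)) \<in> pball M Z"
proof -
  have "emb (\<lambda>x. \<bar>b x\<bar> powr (1 / t)) = (emb (\<lambda>x. b x powr (1 / t)) :: 'a \<Rightarrow> 'k)" if "\<forall>x. 0 \<le> b x"
    using that by simp
  then show ?thesis using assms
    by (auto simp: pball_def space_pow_def epow_le_1_iff emb_L0)
qed


lemma solid_space_qBfs: "qBfs M X \<Longrightarrow> solid_space M X"
  unfolding qBfs_def quasi_normed_on_def solid_space_def by blast

lemma nrm_space_pow_finite: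
  "(\<And>f. f \<in> carr Z \<Longrightarrow> nrm Z f < \<infinity>) \<Longrightarrow> f \<in> carr (space_pow M t Z) \<Longrightarrow> nrm (space_pow M t Z) f < \<infinity>"
  by (auto simp: space_pow_def intro!: epow_less_top)

lemma lp_pair_powr:
  assumes "0 < p" "0 \<le> x" "0 \<le> y"
  shows "lp_pair (ennreal p) (ennreal (x powr (1 / p))) (ennreal (y powr (1 / p))) = ennreal ((x + y) powr (1 / p))"
  using assms by (simp add: lp_pair_def epow_ennreal powr_powr flip: ennreal_plus)

lemma lp_pair_mono:
  assumes "0 < p" "a \<le> a'" "b \<le> b'"
  shows "lp_pair (ennreal p) a b \<le> lp_pair (ennreal p) a' b'"
  using assms by (auto simp: lp_pair_def intro!: epow_mono add_mono)

lemma powr_mult_le_weighted: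
  fixes a b :: real
  assumes "0 \<le> a" "0 \<le> b" "0 \<le> t" "t \<le> 1"
  shows "a powr (1 - t) * b powr t \<le> (1 - t) * a + t * b"
proof -
  have "(\<Prod>i\<in>UNIV. (if i then a else b) powr (if i then 1 - t else t))
      \<le> (\<Sum>i\<in>UNIV. (if i then 1 - t else t) * (if i then a else b))"
    by (rule prod_powr_le_weighted_sum) (use assms in \<open>auto simp: UNIV_bool\<close>)
  then show ?thesis by (simp add: UNIV_bool algebra_simps)
qed

section \<open>The spaces attached to a convex and concave space\<close>

locale convex_concave_space =
  fixes M :: "'a measure" and X :: "('a, 'k::{real_normed_field,second_countable_topology}) fspace"
    and r :: real and s :: ennreal
  assumes sf: "sigma_finite_measure M" and r0: "0 < r" and rs: "ennreal r < s"
    and X: "qBfs M X" and cvx: "p_convex (ennreal r) X" and ccv: "q_concave s X"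
begin

text \<open>The exponent \<alpha> + \<beta>. By \<open>ra\<close>, the number \<open>r * a\<close>
  is the reciprocal of \<open>(s/r)'\<close>.\<close>

definition a :: real where "a = 1 / r - enn2real (inverse s)"

text \<open>
  \<open>B\<close> is the unit ball of \<open>X\<^sup>r\<close>, and \<open>BU\<close> that of \<open>U = [(X\<^sup>r)']\<^bsup>(s/r)'\<^esup>\<close>; the polar of \<open>BU\<close> is the
  unit ball of \<open>X\<^bsub>r,s\<^esub> = U'\<close>.
\<close>

definition B :: "('a \<Rightarrow> real) set" where "B = pball M (space_pow M r X)"

definition U :: "('a, 'k) fspace" where
  "U = space_pow M (1 / (1 - r * enn2real (inverse s))) (kdual M (space_pow M r X))"

definition BU :: "('a \<Rightarrow> real) set" where "BU = pball M U"

lemma space_rs_eq: "space_rs M r s X = kdual M U"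
  by (simp add: space_rs_def U_def)

lemma s_cases: obtains "s = \<infinity>" "enn2real (inverse s) = 0" | S where "s = ennreal S" "r < S" "enn2real (inverse s) = 1 / S"
proof (cases s)
  case (real S)
  then have "r < S" using rs r0 by (simp add: ennreal_less_iff)
  moreover have "enn2real (inverse s) = 1 / S" using real calculation r0 by (simp add: inverse_ennreal divide_inverse)
  ultimately show ?thesis using that(2) real by blast
next
  case top
  then show ?thesis using that(1) by simp
qed

lemma ra: "1 - r * enn2real (inverse s) = r * a"
  using r0 by (simp add: a_def right_diff_distrib)

lemma ra0: "0 < r * a"
  unfolding ra[symmetric]
proof (rule s_cases)
  fix S assume "r < S" and eq: "enn2real (inverse s) = 1 / S"
  then show "0 < 1 - r * enn2real (inverse s)" unfolding eq using r0 by simp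
qed simp

lemma a0: "0 < a"
  using ra0 r0 by (simp add: zero_less_mult_iff)

section \<open>The unit ball of \<open>X^r\<close>\<close>

lemma solidX: "solid_space M X" by (rule solid_space_qBfs[OF X])

lemma finX: "f \<in> carr X \<Longrightarrow> nrm X f < \<infinity>"
  using X by (auto simp: qBfs_def quasi_normed_on_def)

lemma addX: "f \<in> carr X \<Longrightarrow> g \<in> carr X \<Longrightarrow> (\<lambda>x. f x + g x) \<in> carr X"
  using X by (auto simp: qBfs_def quasi_normed_on_def)

lemma solidW: "solid_space M (space_pow M r X)" by (rule solid_space_pow[OF solidX r0])

lemma finW: "f \<in> carr (space_pow M r X) \<Longrightarrow> nrm (space_pow M r X) f < \<infinity>"
  by (rule nrm_space_pow_finite[OF finX])

lemma B_iff: "b \<in> B \<longleftrightarrow> b \<in> borel_measurable M \<and> (\<forall>x. 0 \<le> b x) \<and> (\<lambda>x. b x powr (1 / r)) \<in> pball M X"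
  unfolding B_def by (rule pball_space_pow[OF r0])

lemma BI:
  assumes "b \<in> borel_measurable M" "\<And>x. 0 \<le> b x" "emb (\<lambda>x. b x powr (1 / r)) \<in> carr X"
    "nrm X (emb (\<lambda>x. b x powr (1 / r))) \<le> 1"
  shows "b \<in> B"
  using assms unfolding B_iff pball_def by auto

lemma BD:
  assumes "b \<in> B"
  shows "b \<in> borel_measurable M" "0 \<le> b x" "emb (\<lambda>x. b x powr (1 / r)) \<in> carr X"
    "nrm X (emb (\<lambda>x. b x powr (1 / r))) \<le> 1"
  using assms unfolding B_iff pball_def by auto

lemma B_solid:
  assumes b: "b \<in> B" and c: "c \<in> borel_measurable M" "\<And>x. 0 \<le> c x" "AE x in M. c x \<le> b x"
  shows "c \<in> B"
proof -
  note [measurable] = c(1)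
  have m: "emb (\<lambda>x. c x powr (1 / r)) \<in> L0 M" by (intro emb_L0) measurable
  have le: "AE x in M. norm (of_real (c x powr (1 / r)) :: 'k) \<le> norm (of_real (b x powr (1 / r)) :: 'k)"
    using c(3) by eventually_elim (use c(2) r0 in \<open>simp add: powr_mono2\<close>)
  show ?thesis
    using solid_spaceD(2)[OF solidX BD(3)[OF b] m le] solid_spaceD(3)[OF solidX BD(3)[OF b] m le] BD(4)[OF b] c
    by (intro BI) auto
qed

text \<open>This is \<open>r\<close>-convexity for \<open>((1 - t) * b) powr (1/r)\<close> and
  \<open>(t * c) powr (1/r)\<close>, whose norms are at most \<open>(1 - t) powr (1/r)\<close> and
  \<open>t powr (1/r)\<close>. Since \<open>p_convex\<close> speaks of norms alone, membership in
  the carrier is shown separately, by domination by a sum.\<close>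

lemma B_convex:
  assumes b: "b \<in> B" and c: "c \<in> B" and t: "0 \<le> t" "t \<le> 1"
  shows "(\<lambda>x. (1 - t) * b x + t * c x) \<in> B"
proof (rule BI)
  note [measurable] = BD(1)[OF b] BD(1)[OF c]
  note b0 = BD(2)[OF b] and c0 = BD(2)[OF c]
  let ?d = "\<lambda>x. (1 - t) * b x + t * c x"
  show "?d \<in> borel_measurable M" by measurable
  show d0: "0 \<le> ?d x" for x using b0[of x] c0[of x] t by simp
  have "(\<lambda>x. of_real (b x powr (1 / r)) + of_real (c x powr (1 / r)) :: 'k) \<in> carr X"
    by (rule addX[OF BD(3)[OF b] BD(3)[OF c]])
  then show dX: "emb (\<lambda>x. ?d x powr (1 / r)) \<in> carr X"
  proof (rule solid_spaceD(2)[OF solidX])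
    show "emb (\<lambda>x. ?d x powr (1 / r)) \<in> L0 M" by (intro emb_L0) measurable
    show "AE x in M. norm (of_real (?d x powr (1 / r)) :: 'k) \<le> norm (of_real (b x powr (1 / r)) + of_real (c x powr (1 / r)) :: 'k)"
    proof (intro AE_I2)
      fix x
      have "?d x \<le> (1 - t) * max (b x) (c x) + t * max (b x) (c x)"
        using t by (intro add_mono mult_left_mono) auto
      also have "\<dots> = max (b x) (c x)" by (simp add: algebra_simps)
      finally have "?d x powr (1 / r) \<le> max (b x) (c x) powr (1 / r)"
        using d0[of x] r0 by (intro powr_mono2) auto
      also have "\<dots> \<le> b x powr (1 / r) + c x powr (1 / r)" by (simp add: max_def)
      finally show "norm (of_real (?d x powr (1 / r)) :: 'k) \<le> norm (of_real (b x powr (1 / r)) + of_real (c x powr (1 / r)) :: 'k)"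
        by (simp flip: of_real_add)
    qed
  qed
  let ?f = "emb (\<lambda>x. ((1 - t) * b x) powr (1 / r)) :: 'a \<Rightarrow> 'k" and ?g = "emb (\<lambda>x. (t * c x) powr (1 / r)) :: 'a \<Rightarrow> 'k"
  have f: "?f \<in> carr X" "nrm X ?f \<le> ennreal ((1 - t) powr (1 / r))"
    using solid_space_emb_scale[OF solidX BD(3)[OF b], of "(1 - t) powr (1 / r)"] mult_left_mono[OF BD(4)[OF b], of "ennreal ((1 - t) powr (1 / r))"]
    by (simp_all add: powr_mult)
  have g: "?g \<in> carr X" "nrm X ?g \<le> ennreal (t powr (1 / r))"
    using solid_space_emb_scale[OF solidX BD(3)[OF c], of "t powr (1 / r)"] mult_left_mono[OF BD(4)[OF c], of "ennreal (t powr (1 / r))"]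
    by (simp_all add: powr_mult)
  have eq: "lp_pair_fun (ennreal r) ?f ?g = emb (\<lambda>x. ?d x powr (1 / r))"
    unfolding lp_pair_fun_def using t b0 c0 r0 by (simp add: lp_pair_powr)
  have "nrm X (lp_pair_fun (ennreal r) ?f ?g) \<le> lp_pair (ennreal r) (nrm X ?f) (nrm X ?g)"
    using cvx f(1) g(1) unfolding p_convex_def by blast
  also have "\<dots> \<le> lp_pair (ennreal r) (ennreal ((1 - t) powr (1 / r))) (ennreal (t powr (1 / r)))"
    by (intro lp_pair_mono r0 f g)
  also have "\<dots> = 1" using t r0 by (simp add: lp_pair_powr)
  finally show "nrm X (emb (\<lambda>x. ?d x powr (1 / r))) \<le> 1" unfolding eq .
qed

text \<open>The Fatou property handles increasing sequences only. The infima over the tails increase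
  to the limit and stay below members of the ball, so it applies to their roots.\<close>

lemma B_closed:
  assumes bs: "\<And>n. bs n \<in> B" and c: "c \<in> borel_measurable M" "\<And>x. 0 \<le> c x"
    and lim: "AE x in M. (\<lambda>n. bs n x) \<longlonglongrightarrow> c x"
  shows "c \<in> B"
proof -
  note [measurable] = BD(1)[OF bs] c(1)
  define d where "d n x = (INF k\<in>{n..}. ennreal (bs k x))" for n x
  have d_le: "d n x \<le> ennreal (bs n x)" for n x unfolding d_def by (rule INF_lower) simp
  have d_fin: "d n x < \<infinity>" for n x using le_less_trans[OF d_le] by simp
  have [measurable]: "d n \<in> borel_measurable M" for n unfolding d_def by measurable
  have d_mono: "d n x \<le> d m x" if "n \<le> m" for n m x
    unfolding d_def using that by (intro INF_superset_mono) auto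
  have d_lim: "AE x in M. (\<lambda>n. enn2real (d n x)) \<longlonglongrightarrow> c x"
    using lim
  proof eventually_elim
    case (elim x)
    have "(\<lambda>n. d n x) \<longlonglongrightarrow> (SUP n. d n x)" by (intro LIMSEQ_SUP) (auto simp: incseq_def d_mono)
    also have "(SUP n. d n x) = liminf (\<lambda>n. ennreal (bs n x))" by (simp add: liminf_SUP_INF d_def)
    also have "\<dots> = ennreal (c x)" using elim by (intro lim_imp_Liminf tendsto_intros) auto
    finally show ?case using tendsto_enn2real[of "\<lambda>n. d n x" "c x"] c(2)[of x] by simp
  qed
  define u where "u n x = enn2real (d n x) powr (1 / r)" for n x
  have dB: "(\<lambda>x. enn2real (d n x)) \<in> B" for n
  proof (rule B_solid[OF bs])
    show "AE x in M. enn2real (d n x) \<le> bs n x"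
      using enn2real_mono[OF d_le] BD(2)[OF bs] by (intro AE_I2) auto
  qed auto
  have uX: "emb (u n) \<in> carr X" "nrm X (emb (u n)) \<le> 1" for n
    using BD(3,4)[OF dB[of n]] by (simp_all add: u_def)
  have sup1: "(SUP n. nrm X (emb (u n))) \<le> 1" by (intro SUP_least uX)
  have fatou: "emb v \<in> carr X \<and> nrm X (emb v) = (SUP n. nrm X (emb (u n)))"
    if "\<forall>n. emb (u n) \<in> carr X" "v \<in> borel_measurable M" "AE x in M. \<forall>n. 0 \<le> u n x"
      "AE x in M. incseq (\<lambda>n. u n x) \<and> (\<lambda>n. u n x) \<longlonglongrightarrow> v x" "(SUP n. nrm X (emb (u n))) < \<infinity>" for v
    using X that unfolding qBfs_def by blast
  have "emb (\<lambda>x. c x powr (1 / r)) \<in> carr X \<and> nrm X (emb (\<lambda>x. c x powr (1 / r))) = (SUP n. nrm X (emb (u n)))"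
  proof (rule fatou)
    show "AE x in M. incseq (\<lambda>n. u n x) \<and> (\<lambda>n. u n x) \<longlonglongrightarrow> c x powr (1 / r)"
      using d_lim
    proof eventually_elim
      case (elim x)
      have "incseq (\<lambda>n. u n x)"
        unfolding u_def incseq_def using r0 d_fin d_mono
        by (intro allI impI powr_mono2 enn2real_mono) auto
      moreover have "(\<lambda>n. u n x) \<longlonglongrightarrow> c x powr (1 / r)"
        unfolding u_def using elim r0 by (intro tendsto_powr' tendsto_const) auto
      ultimately show ?case by simp
    qed
    show "(SUP n. nrm X (emb (u n))) < \<infinity>" by (rule le_less_trans[OF sup1]) simp
  qed (use uX in \<open>auto simp: u_def\<close>)
  then show ?thesis using sup1 c by (intro BI) auto
qed

lemma ball: "solid_ball M B"
proof
  have "(\<lambda>x. 0 :: 'k) \<in> carr X" "nrm X (\<lambda>x. 0) = 0"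
    using X by (auto simp: qBfs_def quasi_normed_on_def)
  then show "(\<lambda>x. 0) \<in> B" using r0 by (intro BI) auto
qed (auto intro: BD B_convex B_solid B_closed)

text \<open>Membership of all multiples bounds \<open>n^(1/r)\<close> times the norm of the
  indicator, forcing that norm to be 0. It is the hypothesis of
  \<open>polar_has_positive\<close>.\<close>

lemma B_null:
  assumes A: "A \<in> sets M" and n: "\<And>n::nat. (\<lambda>x. real n * indicator A x) \<in> B"
  shows "emeasure M A = 0"
proof -
  let ?i = "emb (\<lambda>x. indicator A x) :: 'a \<Rightarrow> 'k"
  have ind: "indicator A x powr (1 / r) = (indicator A x :: real)" for x using r0 by (simp add: indicator_def)
  have c: "?i \<in> carr X" using BD(3)[OF n[of 1]] r0 by (simp add: ind)
  have "ennreal (real n powr (1 / r)) * nrm X ?i \<le> 1" for n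
    using BD(4)[OF n[of n]] solid_space_emb_scale(2)[OF solidX c, of "real n powr (1 / r)"]
    by (simp add: powr_mult ind)
  moreover obtain N where N: "0 \<le> N" "nrm X ?i = ennreal N" using finX[OF c] by (cases "nrm X ?i") auto
  ultimately have le: "real n powr (1 / r) * N \<le> 1" for n by (simp flip: ennreal_mult')
  have "N = 0"
  proof (rule ccontr)
    assume "N \<noteq> 0"
    then have N0: "0 < N" using N by simp
    obtain n :: nat where n: "(2 / N) powr r < real n" using reals_Archimedean2 by blast
    then have "((2 / N) powr r) powr (1 / r) \<le> real n powr (1 / r)" using r0 by (intro powr_mono2) auto
    then have "2 / N \<le> real n powr (1 / r)" using r0 N0 by (simp add: powr_powr)
    then have "2 \<le> real n powr (1 / r) * N" using N0 by (simp add: field_simps)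
    then show False using le[of n] by simp
  qed
  then have "AE x in M. ?i x = 0" using solid_spaceD(6)[OF solidX c] N by simp
  then have "AE x in M. x \<notin> A" by eventually_elim (simp add: indicator_def split: if_splits)
  then show ?thesis using AE_iff_null_sets[OF A] by (simp add: null_setsD1)
qed

lemma saturated:
  assumes "A \<in> sets M" "0 < emeasure M A"
  obtains F c where "F \<in> sets M" "F \<subseteq> A" "0 < emeasure M F" "0 < c" "(\<lambda>x. c * indicator F x) \<in> B"
proof -
  obtain F where F: "F \<in> sets M" "F \<subseteq> A" "0 < emeasure M F" "indicator F \<in> carr X"
    using X assms unfolding qBfs_def by blast
  define N where "N = enn2real (nrm X (indicator F)) + 1"
  have N: "0 < N" "nrm X (indicator F) \<le> ennreal N"
    using finX[OF F(4)] by (auto simp: N_def add_nonneg_pos ennreal_plus less_top)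
  have "(\<lambda>x. norm (indicator F x :: 'k) / N) \<in> pball M X" by (rule pball_of_norm[OF solidX F(4) N(2,1)])
  also have "(\<lambda>x. norm (indicator F x :: 'k) / N) = (\<lambda>x. ((1 / N) powr r * indicator F x) powr (1 / r))"
    using N r0 by (auto simp: fun_eq_iff indicator_def powr_powr)
  finally have "(\<lambda>x. (1 / N) powr r * indicator F x) \<in> B"
    using F(1) unfolding B_iff by auto
  then show ?thesis using N(1) by (intro that[of F "(1 / N) powr r"] F) auto
qed

lemma B_total:
  assumes [measurable]: "g \<in> borel_measurable M" and g0: "\<And>x. 0 \<le> g x"
    and 0: "\<And>b. b \<in> B \<Longrightarrow> (\<integral>\<^sup>+x. ennreal (g x * b x) \<partial>M) = 0"
  shows "AE x in M. g x = 0"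
proof (rule ccontr)
  assume no: "\<not> ?thesis"
  define A where "A = {x \<in> space M. g x \<noteq> 0}"
  have A: "A \<in> sets M" unfolding A_def by measurable
  have "0 < emeasure M A" using no by (auto simp: A_def AE_iff_measurable[OF _ refl] zero_less_iff_neq_zero)
  then obtain F c where F: "F \<in> sets M" "F \<subseteq> A" "0 < emeasure M F" "0 < c" "(\<lambda>x. c * indicator F x) \<in> B"
    using saturated[OF A] by blast
  note [measurable] = F(1)
  have "AE x in M. ennreal (g x * (c * indicator F x)) = 0"
    using 0[OF F(5)] by (subst (asm) nn_integral_0_iff_AE) auto
  then have "AE x in M. x \<notin> F"
  proof eventually_elim
    case (elim x)
    show ?case
    proof
      assume "x \<in> F"
      then have "g x \<noteq> 0" using F(2) by (auto simp: A_def)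
      then have "0 < g x" using g0[of x] by simp
      then show False using elim \<open>x \<in> F\<close> F(4) by (simp add: ennreal_eq_0_iff mult_le_0_iff)
    qed
  qed
  then show False using F(1,3) by (simp add: AE_iff_null_sets[symmetric] null_sets_def)
qed

section \<open>The associate of \<open>X^r\<close>, the space \<open>U\<close> and its duals\<close>

lemma polar_unit: obtains g where "g \<in> polar M B" "AE x in M. 0 < g x"
  using solid_ball.polar_has_positive[OF ball sf B_null] by blast

lemma solidW': "solid_space M (kdual M (space_pow M r X))"
  by (rule solid_space_kdual[OF solidW B_total]) (auto simp: B_def)

lemma pballW': "pball M (kdual M (space_pow M r X)) = polar M B"
  unfolding B_def by (rule pball_kdual[OF solidW finW])

text \<open>The carrier of \<open>kdual\<close> asks for finite pairings one function at a time;
  that the norm, a supremum, is finite is the uniform boundedness principle.\<close>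

lemma finW': "f \<in> carr (kdual M (space_pow M r X)) \<Longrightarrow> nrm (kdual M (space_pow M r X)) f < \<infinity>"
proof -
  assume f: "f \<in> carr (kdual M (space_pow M r X))"
  then have fm: "f \<in> L0 M" by (simp add: carr_kdual)
  obtain h where h: "h \<in> polar M B" "AE x in M. 0 < h x" by (rule polar_unit)
  have "(\<integral>\<^sup>+x. ennreal (norm (f x) * b x) \<partial>M) < \<infinity>" if b: "b \<in> B" for b
  proof -
    have "emb b \<in> carr (space_pow M r X)" "\<And>x. 0 \<le> b x" using b by (auto simp: B_def pball_def)
    then show ?thesis using f by (auto simp: carr_kdual)
  qed
  then obtain C :: real where "\<And>b. b \<in> B \<Longrightarrow> (\<integral>\<^sup>+x. ennreal (norm (f x) * b x) \<partial>M) \<le> ennreal C"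
    using solid_ball.uniformly_bounded[OF ball h L0_norm_meas[OF fm]] by auto
  then have "nrm (kdual M (space_pow M r X)) f \<le> ennreal C"
    by (intro kdual_memI[OF solidW finW fm]) (auto simp: B_def)
  then show ?thesis by (rule le_less_trans) simp
qed

lemma solidU: "solid_space M U"
  unfolding U_def ra using ra0 by (intro solid_space_pow solidW') simp

lemma finU: "f \<in> carr U \<Longrightarrow> nrm U f < \<infinity>"
  unfolding U_def by (rule nrm_space_pow_finite[OF finW'])

lemma BU_iff: "u \<in> BU \<longleftrightarrow> u \<in> borel_measurable M \<and> (\<forall>x. 0 \<le> u x) \<and> (\<lambda>x. u x powr (r * a)) \<in> polar M B"
  unfolding BU_def U_def ra pballW'[symmetric] using ra0 by (subst pball_space_pow) auto

lemma BU_unit: obtains u where "u \<in> BU" "AE x in M. 0 < u x"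
proof -
  obtain h where h: "h \<in> polar M B" "AE x in M. 0 < h x" by (rule polar_unit)
  note [measurable] = polarD(1)[OF h(1)]
  have "(h x powr (1 / (r * a))) powr (r * a) = h x" for x
    using polarD(2)[OF h(1)] r0 a0 by (simp add: powr_powr)
  then have "(\<lambda>x. h x powr (1 / (r * a))) \<in> BU" using h(1) by (auto simp: BU_iff)
  moreover have "AE x in M. 0 < h x powr (1 / (r * a))" using h(2) by eventually_elim simp
  ultimately show ?thesis by (rule that)
qed

lemma BU_total:
  assumes [measurable]: "g \<in> borel_measurable M" and g0: "\<And>x. 0 \<le> g x"
    and 0: "\<And>b. b \<in> BU \<Longrightarrow> (\<integral>\<^sup>+x. ennreal (g x * b x) \<partial>M) = 0"
  shows "AE x in M. g x = 0"
proof -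
  obtain u where u: "u \<in> BU" "AE x in M. 0 < u x" by (rule BU_unit)
  then have [measurable]: "u \<in> borel_measurable M" by (simp add: BU_iff)
  have "AE x in M. ennreal (g x * u x) = 0"
    using 0[OF u(1)] by (subst (asm) nn_integral_0_iff_AE) auto
  with u(2) show ?thesis
  proof eventually_elim
    case (elim x)
    then show ?case using g0[of x] by (auto simp: ennreal_eq_0_iff mult_le_0_iff)
  qed
qed

lemma solidY: "solid_space M (kdual M U)"
  by (rule solid_space_kdual[OF solidU BU_total]) (auto simp: BU_def)

lemma pballY: "pball M (kdual M U) = polar M BU"
  unfolding BU_def by (rule pball_kdual[OF solidU finU])

text \<open>The contractive embedding of \<open>U\<close> into its second associate, here
  \<open>X\<^sub>r\<^sub>,\<^sub>s'\<close>, in whose norm the second maximal bound is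
  given.\<close>

lemma BU_in_Y':
  assumes k: "k \<in> BU"
  shows "emb k \<in> carr (kdual M (kdual M U))" "nrm (kdual M (kdual M U)) (emb k) \<le> 1"
proof -
  have kc: "emb k \<in> carr U" and k0: "\<And>x. 0 \<le> k x" and km: "k \<in> borel_measurable M"
    using k by (auto simp: BU_def pball_def)
  show "emb k \<in> carr (kdual M (kdual M U))"
    unfolding carr_kdual[of M "kdual M U"] using kc by (auto simp: carr_kdual mult.commute emb_L0 km)
  show "nrm (kdual M (kdual M U)) (emb k) \<le> 1"
    unfolding nrm_kdual[of M "kdual M U"]
  proof (rule SUP_least)
    fix h assume "h \<in> {h \<in> carr (kdual M U). nrm (kdual M U) h = 1}"
    then show "(\<integral>\<^sup>+x. ennreal (norm (of_real (k x) :: 'k) * norm (h x)) \<partial>M) \<le> 1"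
      using kdual_pairing_le[OF solidU _ _ k[unfolded BU_def], of h 1] k0
      by (auto simp: carr_kdual mult.commute)
  qed
qed

end

lemma polar_convex:
  assumes B: "\<And>b. b \<in> B \<Longrightarrow> b \<in> borel_measurable M" "\<And>b x. b \<in> B \<Longrightarrow> 0 \<le> b x"
    and g: "g \<in> polar M B" and h: "h \<in> polar M B" and t: "0 \<le> t" "t \<le> 1"
  shows "(\<lambda>x. (1 - t) * g x + t * h x) \<in> polar M B"
proof -
  note [measurable] = polarD(1)[OF g] polarD(1)[OF h]
  have "(\<integral>\<^sup>+x. ennreal (((1 - t) * g x + t * h x) * b x) \<partial>M) \<le> 1" if b: "b \<in> B" for b
  proof -
    note [measurable] = B(1)[OF b]
    have "(\<integral>\<^sup>+x. ennreal (((1 - t) * g x + t * h x) * b x) \<partial>M)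
      = (\<integral>\<^sup>+x. ennreal (1 - t) * ennreal (g x * b x) + ennreal t * ennreal (h x * b x) \<partial>M)"
    proof (intro nn_integral_cong)
      fix x
      have "((1 - t) * g x + t * h x) * b x = (1 - t) * (g x * b x) + t * (h x * b x)"
        by (simp add: algebra_simps)
      then show "ennreal (((1 - t) * g x + t * h x) * b x)
          = ennreal (1 - t) * ennreal (g x * b x) + ennreal t * ennreal (h x * b x)"
        using t polarD(2)[OF g, of x] polarD(2)[OF h, of x] B(2)[OF b, of x]
        by (simp flip: ennreal_mult')
    qed
    also have "\<dots> = ennreal (1 - t) * (\<integral>\<^sup>+x. ennreal (g x * b x) \<partial>M) + ennreal t * (\<integral>\<^sup>+x. ennreal (h x * b x) \<partial>M)"
      by (simp add: nn_integral_add nn_integral_cmult)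
    also have "\<dots> \<le> ennreal (1 - t) * 1 + ennreal t * 1"
      by (intro add_mono mult_left_mono polarD(3)[OF g b] polarD(3)[OF h b]) auto
    also have "\<dots> = 1" using t by (simp flip: ennreal_plus)
    finally show ?thesis .
  qed
  then show ?thesis using polarD(2)[OF g] polarD(2)[OF h] t by (auto simp: polar_def)
qed

section \<open>Convexity of \<open>U\<close> and the splitting of \<open>X\<close>\<close>

context convex_concave_space
begin

lemma pairing_power_le:
  assumes g: "g \<in> polar M B" and [measurable]: "y \<in> borel_measurable M" and y0: "\<And>x. 0 \<le> y x"
    and y: "emb y \<in> carr X" "nrm X (emb y) = ennreal n" and n: "0 \<le> n"
  shows "(\<integral>\<^sup>+x. ennreal (g x * y x powr r) \<partial>M) \<le> ennreal (n powr r)"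
proof (cases "n = 0")
  case True
  then have "AE x in M. (of_real (y x) :: 'k) = 0" using solid_spaceD(6)[OF solidX y(1)] y(2) by simp
  then have "(\<integral>\<^sup>+x. ennreal (g x * y x powr r) \<partial>M) = (\<integral>\<^sup>+x. 0 \<partial>M)"
    by (intro nn_integral_cong_AE) (auto elim!: eventually_mono)
  then show ?thesis by simp
next
  case False
  then have n0: "0 < n" using n by simp
  note [measurable] = polarD(1)[OF g]
  have p: "((y x / n) powr r) powr (1 / r) = 1 / n * y x" for x
    using r0 n0 y0[of x] by (simp add: powr_powr)
  have "(\<lambda>x. (y x / n) powr r) \<in> B"
  proof (rule BI)
    show "emb (\<lambda>x. ((y x / n) powr r) powr (1 / r)) \<in> carr X"
      unfolding p by (rule solid_space_emb_scale[OF solidX y(1)])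
    show "nrm X (emb (\<lambda>x. ((y x / n) powr r) powr (1 / r))) \<le> 1"
      unfolding p solid_space_emb_scale(2)[OF solidX y(1)] y(2) using n0 by (simp flip: ennreal_mult')
  qed auto
  then have "(\<integral>\<^sup>+x. ennreal (g x * (y x / n) powr r) \<partial>M) \<le> 1" by (rule polarD(3)[OF g])
  then have "ennreal (n powr r) * (\<integral>\<^sup>+x. ennreal (g x * (y x / n) powr r) \<partial>M) \<le> ennreal (n powr r) * 1"
    by (rule mult_left_mono) simp
  also have "ennreal (n powr r) * (\<integral>\<^sup>+x. ennreal (g x * (y x / n) powr r) \<partial>M) = (\<integral>\<^sup>+x. ennreal (g x * y x powr r) \<partial>M)"
    using n0 y0 by (subst nn_integral_cmult[symmetric]) (auto simp: powr_divide simp flip: ennreal_mult')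
  finally show ?thesis by simp
qed

text \<open>Abstractly, \<open>s\<close>-concavity of \<open>X\<close> is
  \<open>(s/r)'\<close>-convexity of \<open>(X^r)'\<close>, hence convexity of its power
  \<open>U\<close>. Concretely, a test function \<open>b\<close> is divided between
  \<open>u1\<close> and \<open>u2\<close> according to their shares in the convex combination
  \<open>w\<close>; concavity bounds the norms of the two pieces jointly, and Young's inequality
  recombines the pairings.\<close>

lemma BU_convex:
  assumes sS: "s = ennreal S" "r < S" "enn2real (inverse s) = 1 / S"
    and u: "u1 \<in> BU" "u2 \<in> BU" and t: "0 \<le> t" "t \<le> 1"
  shows "(\<lambda>x. (1 - t) * u1 x + t * u2 x) \<in> BU"
proof -
  have S0: "0 < S" using sS(2) r0 by simp
  have ra': "r * a = 1 - r / S" using ra unfolding sS(3) by simp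
  note um [measurable] = u[unfolded BU_iff, THEN conjunct1]
  have u0: "0 \<le> u1 x" "0 \<le> u2 x" for x using u by (auto simp: BU_iff)
  have up: "(\<lambda>x. u1 x powr (r * a)) \<in> polar M B" "(\<lambda>x. u2 x powr (r * a)) \<in> polar M B" using u by (auto simp: BU_iff)
  define w where "w x = (1 - t) * u1 x + t * u2 x" for x
  have w0: "0 \<le> w x" for x unfolding w_def using t u0 by simp
  have [measurable]: "w \<in> borel_measurable M" unfolding w_def by measurable
  have "(\<integral>\<^sup>+x. ennreal (w x powr (r * a) * b x) \<partial>M) \<le> 1" if b: "b \<in> B" for b
  proof -
    note [measurable] = BD(1)[OF b]
    note b0 = BD(2)[OF b]
    \<comment> \<open>The \<open>S\<close>-th powers of \<open>y1\<close> and \<open>y2\<close> are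
      the shares of \<open>(1 - t) * u1\<close> and \<open>t * u2\<close> in \<open>w\<close>, times
      \<open>b^(S/r)\<close>. Where \<open>w x = 0\<close> the shares are 0, so their sum is at most
      1 in every case.\<close>
    define y where "y l v x = ((l * v x / w x) * b x powr (S / r)) powr (1 / S)" for l :: real and v :: "'a \<Rightarrow> real" and x
    define y1 where "y1 = y (1 - t) u1"
    define y2 where "y2 = y t u2"
    have ym [measurable]: "y1 \<in> borel_measurable M" "y2 \<in> borel_measurable M" unfolding y1_def y2_def y_def by measurable
    have q: "0 \<le> (1 - t) * u1 x / w x" "0 \<le> t * u2 x / w x" "(1 - t) * u1 x / w x + t * u2 x / w x \<le> 1" for x
      using t u0[of x] w0[of x] by (auto simp: w_def simp flip: add_divide_distrib)
    have ybound: "((q1 + q2) * b x powr (S / r)) powr (1 / S) \<le> b x powr (1 / r)"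
      if "0 \<le> q1" "0 \<le> q2" "q1 + q2 \<le> 1" for q1 q2 x
    proof -
      have "((q1 + q2) * b x powr (S / r)) powr (1 / S) \<le> (1 * b x powr (S / r)) powr (1 / S)"
        using that S0 by (intro powr_mono2 mult_right_mono) auto
      also have "\<dots> = b x powr (1 / r)" using S0 by (simp add: powr_powr)
      finally show ?thesis .
    qed
    have yX: "emb v \<in> carr X" if "v \<in> borel_measurable M" "\<And>x. 0 \<le> v x" "\<And>x. v x \<le> b x powr (1 / r)" for v
      by (rule solid_spaceD(2)[OF solidX BD(3)[OF b] emb_L0[OF that(1)]]) (use that in auto)
    have y1X: "emb y1 \<in> carr X"
      using ybound[OF q(1) order_refl] q(2,3)
      by (intro yX) (auto simp: y1_def y_def, smt (verit, best))
    have y2X: "emb y2 \<in> carr X"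
      using ybound[OF order_refl q(2)] q(1,3)
      by (intro yX) (auto simp: y2_def y_def, smt (verit, best))
    obtain n1 n2 where n: "0 \<le> n1" "nrm X (emb y1) = ennreal n1" "0 \<le> n2" "nrm X (emb y2) = ennreal n2"
      using finX[OF y1X] finX[OF y2X] by (metis ennreal_cases infinity_ennreal_def less_irrefl)
    have lp: "lp_pair (ennreal S) (ennreal (y1 x)) (ennreal (y2 x))
      = ennreal ((((1 - t) * u1 x / w x) * b x powr (S / r) + (t * u2 x / w x) * b x powr (S / r)) powr (1 / S))" for x
      unfolding y1_def y2_def y_def by (rule lp_pair_powr[OF S0]) (intro mult_nonneg_nonneg q; simp)+
    have y0: "0 \<le> y1 x" "0 \<le> y2 x" for x by (simp_all add: y1_def y2_def y_def)
    have "lp_pair s (nrm X (emb y1)) (nrm X (emb y2)) \<le> nrm X (lp_pair_fun s (emb y1) (emb y2))"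
      using ccv y1X y2X unfolding q_concave_def by blast
    also have "lp_pair_fun s (emb y1) (emb y2)
      = (emb (\<lambda>x. (((1 - t) * u1 x / w x + t * u2 x / w x) * b x powr (S / r)) powr (1 / S)) :: 'a \<Rightarrow> 'k)"
      unfolding lp_pair_fun_def sS(1) using y0 lp by (simp add: distrib_right)
    also have "nrm X \<dots> \<le> nrm X (emb (\<lambda>x. b x powr (1 / r)))"
      using ybound[OF q] by (intro solid_spaceD(3)[OF solidX BD(3)[OF b]] emb_L0) auto
    also have "\<dots> \<le> 1" by (rule BD(4)[OF b])
    finally have "epow (ennreal (n1 powr S + n2 powr S)) (1 / S) \<le> 1"
      using n S0 unfolding sS(1) by (simp add: lp_pair_def epow_ennreal)
    then have "ennreal (n1 powr S + n2 powr S) \<le> 1" using S0 by (subst (asm) epow_le_1_iff) auto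
    then have nS: "n1 powr S + n2 powr S \<le> 1" by (simp add: ennreal_le_1 del: ennreal_plus)
    \<comment> \<open>An equality where \<open>w x > 0\<close>: because
      \<open>r * a + r / S = 1\<close>, each term on the right is its share of \<open>w\<close>
      times \<open>w powr (r * a) / w * b\<close>.\<close>
    have pw: "w x powr (r * a) * b x \<le> (1 - t) powr (r * a) * (u1 x powr (r * a) * y1 x powr r)
        + t powr (r * a) * (u2 x powr (r * a) * y2 x powr r)" for x
    proof (cases "w x = 0")
      case True
      then show ?thesis using S0 r0 a0 by (auto intro!: add_nonneg_nonneg)
    next
      case False
      then have wp: "0 < w x" using w0[of x] by simp
      have part: "l powr (r * a) * (v x powr (r * a) * y l v x powr r) = l * v x * (w x powr (r * a) / w x * b x)"
        if l: "0 \<le> l" "0 \<le> v x" for l and v :: "'a \<Rightarrow> real"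
      proof -
        have "y l v x powr r = (l * v x / w x) powr (r / S) * (b x powr (S / r)) powr (r / S)"
        proof -
          have "y l v x powr r = ((l * v x / w x) * b x powr (S / r)) powr (r / S)"
            by (simp add: y_def powr_powr)
          also have "\<dots> = (l * v x / w x) powr (r / S) * (b x powr (S / r)) powr (r / S)"
            by (rule powr_mult)
          finally show ?thesis .
        qed
        also have "(b x powr (S / r)) powr (r / S) = b x" using b0[of x] r0 S0 by (simp add: powr_powr)
        also have "(l * v x / w x) powr (r / S) = (l * v x) powr (r / S) / w x powr (r / S)" by (rule powr_divide)
        finally have 1: "y l v x powr r = (l * v x) powr (r / S) / w x powr (r / S) * b x" .
        have 2: "(l * v x) powr (r * a) * (l * v x) powr (r / S) = l * v x"
          using l unfolding ra' by (simp flip: powr_add)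
        have 3: "1 / w x powr (r / S) = w x powr (r * a) / w x"
          unfolding ra' using wp by (simp add: powr_diff)
        have "l powr (r * a) * (v x powr (r * a) * y l v x powr r)
          = ((l * v x) powr (r * a) * (l * v x) powr (r / S)) * (1 / w x powr (r / S)) * b x"
          unfolding 1 by (simp add: powr_mult)
        then show ?thesis unfolding 2 3 by simp
      qed
      have "(1 - t) powr (r * a) * (u1 x powr (r * a) * y1 x powr r) + t powr (r * a) * (u2 x powr (r * a) * y2 x powr r)
        = w x * (w x powr (r * a) / w x * b x)"
      proof -
        define Z where "Z = w x powr (r * a) / w x * b x"
        have "(1 - t) powr (r * a) * (u1 x powr (r * a) * y1 x powr r) = (1 - t) * u1 x * Z"
          "t powr (r * a) * (u2 x powr (r * a) * y2 x powr r) = t * u2 x * Z"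
          unfolding y1_def y2_def Z_def by (intro part; use t u0[of x] in simp)+
        then show ?thesis unfolding Z_def[symmetric] by (simp add: w_def distrib_right)
      qed
      then show ?thesis using wp by simp
    qed
    have "(\<integral>\<^sup>+x. ennreal (w x powr (r * a) * b x) \<partial>M)
      \<le> (\<integral>\<^sup>+x. ennreal ((1 - t) powr (r * a)) * ennreal (u1 x powr (r * a) * y1 x powr r)
          + ennreal (t powr (r * a)) * ennreal (u2 x powr (r * a) * y2 x powr r) \<partial>M)"
      using ennreal_leI[OF pw] by (intro nn_integral_mono) (simp add: ennreal_mult')
    also have "\<dots> = ennreal ((1 - t) powr (r * a)) * (\<integral>\<^sup>+x. ennreal (u1 x powr (r * a) * y1 x powr r) \<partial>M)
          + ennreal (t powr (r * a)) * (\<integral>\<^sup>+x. ennreal (u2 x powr (r * a) * y2 x powr r) \<partial>M)"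
      by (simp add: nn_integral_add nn_integral_cmult)
    also have "\<dots> \<le> ennreal ((1 - t) powr (r * a)) * ennreal (n1 powr r) + ennreal (t powr (r * a)) * ennreal (n2 powr r)"
      by (intro add_mono mult_left_mono pairing_power_le up y1X y2X n ym) (auto simp: y1_def y2_def y_def)
    also have "\<dots> = ennreal ((1 - t) powr (r * a) * n1 powr r + t powr (r * a) * n2 powr r)"
      by (simp add: ennreal_mult')
    also have "\<dots> \<le> ennreal 1"
    proof (rule ennreal_leI)
      \<comment> \<open>Young's inequality. The coefficients \<open>l\<close> add up to 1 and the
        \<open>m powr S\<close> to at most 1, so the two terms together stay below
        \<open>r * a + r / S = 1\<close>.\<close>
      have "l powr (r * a) * m powr r \<le> r * a * l + r / S * m powr S" if "0 \<le> l" "0 \<le> m" for l m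
        using powr_mult_le_weighted[of l "m powr S" "r / S"] that r0 S0 sS(2)
        by (simp add: powr_powr ra')
      from add_mono[OF this[of "1 - t" n1] this[of t n2]]
      have "(1 - t) powr (r * a) * n1 powr r + t powr (r * a) * n2 powr r
        \<le> r * a + r / S * (n1 powr S + n2 powr S)" using t n by (simp add: algebra_simps)
      also have "\<dots> \<le> r * a + r / S * 1" using nS r0 S0 by (intro add_left_mono mult_left_mono) auto
      also have "\<dots> = 1" by (simp add: ra')
      finally show "(1 - t) powr (r * a) * n1 powr r + t powr (r * a) * n2 powr r \<le> 1" .
    qed
    finally show ?thesis by simp
  qed
  then have "w \<in> BU" using w0 by (auto simp: BU_iff polar_def)
  then show ?thesis by (simp add: w_def[abs_def])
qed

text \<open>The isometric factorization \<open>X = X\<^bsub>r,s\<^esub>\<^bsup>1/r - 1/s\<^esup> \<cdot> L\<^sup>s\<close>, raised to the power \<open>r\<close>.\<close>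

lemma factorization:
  assumes b: "b \<in> B" and \<delta>: "0 < \<delta>"
  obtains h g where "h \<in> polar M BU" "g \<in> borel_measurable M" "\<And>x. 0 \<le> g x"
    "AE x in M. b x \<le> (1 + \<delta>) * (h x powr (r * a) * g x powr r)" "Lnorm M s g \<le> 1"
proof (rule s_cases)
  \<comment> \<open>Here \<open>r * a = 1\<close> and \<open>BU\<close> is the polar of
    \<open>B\<close>, so \<open>b\<close> itself lies in the polar of \<open>BU\<close> and
    \<open>g = 1\<close> completes the splitting.\<close>
  assume s: "s = \<infinity>" "enn2real (inverse s) = 0"
  have ra1: "r * a = 1" using ra s by simp
  note b0 = BD(2)[OF b]
  have "b \<in> polar M BU"
    using b0 BD(1)[OF b] by (auto simp: polar_def BU_iff ra1 b mult.commute)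
  moreover have "b x \<le> (1 + \<delta>) * (b x powr (r * a) * 1 powr r)" for x
    using b0[of x] \<delta> mult_right_mono[of 1 "1 + \<delta>" "b x"] by (simp add: ra1)
  moreover have "Lnorm M s (\<lambda>x. 1 :: real) \<le> 1"
    unfolding Lnorm_def s by (simp, intro esssup_I) auto
  ultimately show ?thesis by (intro that[of b "\<lambda>x. 1"]) auto
next
  fix S assume sS: "s = ennreal S" "r < S" "enn2real (inverse s) = 1 / S"
  have S0: "0 < S" using sS(2) r0 by simp
  have ra': "r * a = 1 - r / S" using ra unfolding sS(3) by simp
  \<comment> \<open>The two-factor case of the duality. The second ball is that of
    \<open>L^\<infinity>\<close>, so a bound on it controls an integral; as its members are at most
    1, the hypothesis on the product reduces to the pairing of \<open>b\<close> with the polar of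
    \<open>B\<close>.\<close>
  define C where "C i = (if i then BU else {u \<in> borel_measurable M. \<forall>x. 0 \<le> u x \<and> u x \<le> 1})" for i :: bool
  define \<theta> where "\<theta> i = (if i then r * a else r / S)" for i :: bool
  interpret L: lozanovskii M C \<theta> b
  proof
    show "0 < \<theta> i" for i using r0 a0 S0 by (simp add: \<theta>_def)
    show "(\<Sum>i\<in>UNIV. \<theta> i) = 1" by (simp add: \<theta>_def UNIV_bool ra')
    show "u \<in> borel_measurable M" if "u \<in> C i" for u i using that by (auto simp: C_def BU_iff split: if_splits)
    show "0 \<le> u x" if "u \<in> C i" for u i x using that by (auto simp: C_def BU_iff split: if_splits)
    show "(\<lambda>x. (1 - t) * u x + t * v x) \<in> C i" if "u \<in> C i" "v \<in> C i" "0 \<le> t" "t \<le> 1" for u v i t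
      using that BU_convex[OF sS, of u v t] by (auto simp: C_def convex_bound_le split: if_splits)
    show "\<exists>u\<in>C i. AE x in M. 0 < u x" for i
    proof (cases i)
      case True
      obtain u where "u \<in> BU" "AE x in M. 0 < u x" by (rule BU_unit)
      then show ?thesis using True by (auto simp: C_def)
    next
      case False
      then show ?thesis by (intro bexI[of _ "\<lambda>x. 1"]) (auto simp: C_def)
    qed
    show "(\<integral>\<^sup>+x. ennreal (b x * (\<Prod>i\<in>UNIV. u i x powr \<theta> i)) \<partial>M) \<le> 1"
      if u: "\<And>i. u i \<in> C i" for u
    proof -
      have u1: "u True \<in> BU" using u[of True] by (simp add: C_def)
      have u2: "0 \<le> u False x" "u False x \<le> 1" for x using u[of False] by (auto simp: C_def)
      have "b x * (\<Prod>i\<in>UNIV. u i x powr \<theta> i) \<le> u True x powr (r * a) * b x" for x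
      proof -
        have "u False x powr (r / S) \<le> 1" using u2[of x] r0 S0 by (intro powr_le1) auto
        then have "u True x powr (r * a) * b x * u False x powr (r / S) \<le> u True x powr (r * a) * b x * 1"
          using BD(2)[OF b, of x] by (intro mult_left_mono) auto
        then show ?thesis by (simp add: UNIV_bool \<theta>_def mult_ac)
      qed
      then have "(\<integral>\<^sup>+x. ennreal (b x * (\<Prod>i\<in>UNIV. u i x powr \<theta> i)) \<partial>M)
          \<le> (\<integral>\<^sup>+x. ennreal (u True x powr (r * a) * b x) \<partial>M)" by (intro nn_integral_mono ennreal_leI)
      also have "\<dots> \<le> 1" using u1 b by (auto simp: BU_iff polar_def)
      finally show ?thesis .
    qed
  qed (rule sigma_finite_measure.sigma_finite_countable[OF sf] BD(1,2)[OF b])+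
  obtain v c where v: "\<And>i. v i \<in> borel_measurable M" "\<And>i x. 0 \<le> v i x"
      "AE x in M. b x \<le> (\<Prod>i\<in>UNIV. v i x powr \<theta> i)" "\<And>i. (0::real) < c i"
      "\<And>i u. u \<in> C i \<Longrightarrow> (\<integral>\<^sup>+x. ennreal (v i x * u x) \<partial>M) \<le> ennreal (c i)"
      "(\<Sum>i\<in>UNIV. \<theta> i * c i) \<le> 1 + \<delta>"
    by (rule L.lozanovskii_factorization[OF \<delta>]) blast
  note [measurable] = v(1)
  have pc: "(\<Prod>i\<in>UNIV. c i powr \<theta> i) \<le> 1 + \<delta>"
    by (rule order_trans[OF prod_powr_le_weighted_sum v(6)])
      (auto simp: less_imp_le[OF L.\<theta>0] L.\<theta>1 less_imp_le[OF v(4)])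
  define h where "h x = v True x / c True" for x
  define g where "g x = (v False x / c False) powr (1 / S)" for x
  have h: "h \<in> polar M BU"
    unfolding polar_def
  proof (clarsimp, intro conjI allI ballI)
    show "h \<in> borel_measurable M" unfolding h_def by measurable
    show "0 \<le> h x" for x using v(2,4) by (simp add: h_def less_imp_le)
    fix u assume u: "u \<in> BU"
    then have "u \<in> C True" by (simp add: C_def)
    then show "(\<integral>\<^sup>+x. ennreal (h x * u x) \<partial>M) \<le> 1"
      unfolding h_def using v(5)[of u True] v(4) u by (intro nn_integral_scale_le) (auto simp: BU_iff)
  qed
  have gm: "g \<in> borel_measurable M" unfolding g_def by measurable
  have gS: "g x powr S = v False x / c False" for x
    using v(2)[of False x] v(4)[of False] S0 by (simp add: g_def powr_powr)
  have gr: "g x powr r = (v False x / c False) powr (r / S)" for x by (simp add: g_def powr_powr)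
  have "(\<lambda>x. 1) \<in> C False" by (auto simp: C_def)
  then have "(\<integral>\<^sup>+x. ennreal (v False x / c False * 1) \<partial>M) \<le> 1"
    using v(5)[of "\<lambda>x. 1" False] v(4) by (intro nn_integral_scale_le) auto
  then have "Lnorm M s g \<le> 1"
    unfolding Lnorm_def sS(1) using S0 v(2,4) gS by (simp add: epow_ennreal epow_le_1_iff g_def)
  moreover have "AE x in M. b x \<le> (1 + \<delta>) * (h x powr (r * a) * g x powr r)"
    using v(3)
  proof eventually_elim
    case (elim x)
    have "(\<Prod>i\<in>UNIV. v i x powr \<theta> i) = (\<Prod>i\<in>UNIV. c i powr \<theta> i) * (\<Prod>i\<in>UNIV. (v i x / c i) powr \<theta> i)"
      unfolding prod.distrib[symmetric]
    proof (intro prod.cong refl)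
      fix i
      show "v i x powr \<theta> i = c i powr \<theta> i * (v i x / c i) powr \<theta> i"
        using v(4)[of i] by (simp add: powr_mult[symmetric])
    qed
    also have "\<dots> \<le> (1 + \<delta>) * (\<Prod>i\<in>UNIV. (v i x / c i) powr \<theta> i)"
      by (intro mult_right_mono pc prod_nonneg) auto
    also have "(\<Prod>i\<in>UNIV. (v i x / c i) powr \<theta> i) = h x powr (r * a) * g x powr r"
      by (simp add: UNIV_bool \<theta>_def h_def gr mult.commute)
    finally show ?case using elim by linarith
  qed
  ultimately show ?thesis using gm by (intro that[OF h]) (auto simp: g_def)
qed

end

section \<open>Rubio de Francia algorithm and Muckenhoupt weights\<close>

lemma avg_1: "avg M 1 E f = (\<integral>\<^sup>+x. ennreal (norm (f x)) * indicator E x \<partial>M) / emeasure M E"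
proof -
  have "ennreal (norm (indicator E x *\<^sub>R f x)) = ennreal (norm (f x)) * indicator E x" for x
    by (simp add: indicator_def)
  then show ?thesis by (simp add: avg_def Lnorm_1)
qed

lemma ex_AE_and_not_AE:
  assumes "AE x in M. P x" "\<not> (AE x in M. \<not> Q x)"
  obtains x where "x \<in> space M" "P x" "Q x"
proof -
  have "\<exists>x\<in>space M. P x \<and> Q x"
  proof (rule ccontr)
    assume "\<not> ?thesis"
    then have "\<forall>x\<in>space M. P x \<longrightarrow> \<not> Q x" by blast
    moreover have "AE x in M. x \<in> space M" by simp
    ultimately have "AE x in M. \<not> Q x" using assms(1) by (auto elim: eventually_mono simp: eventually_conj_iff dest: eventually_conj)
    with assms(2) show False by simp
  qed
  then show ?thesis using that by blast
qed

locale measure_basis =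
  fixes M :: "'a measure" and \<E> :: "'a set set"
  assumes sf: "sigma_finite_measure M" and basis: "set_basis M \<E>"
begin

lemma basisD:
  assumes "E \<in> \<E>"
  shows "E \<in> sets M" "0 < emeasure M E" "emeasure M E < \<infinity>"
  using assms basis by (auto simp: set_basis_def)

text \<open>Any two points share a basis set, so the basis sets through a single point cover
  everything. Each is contained in a member of the countable subfamily, which then also contains the
  point.\<close>

lemma countable_cover:
  assumes x: "x \<in> space M"
  obtains \<C> where "countable \<C>" "\<C> \<subseteq> \<E>" "\<And>E. E \<in> \<C> \<Longrightarrow> x \<in> E" "space M \<subseteq> \<Union>\<C>"
proof -
  obtain \<E>' where E': "\<E>' \<subseteq> \<E>" "countable \<E>'" "\<And>E. E \<in> \<E> \<Longrightarrow> \<exists>E'\<in>\<E>'. E \<subseteq> E'"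
    using basis zero_less_one[where 'a=real] unfolding set_basis_def by metis
  show ?thesis
  proof (rule that[of "{E \<in> \<E>'. x \<in> E}"])
    show "space M \<subseteq> \<Union> {E \<in> \<E>'. x \<in> E}"
    proof
      fix y assume "y \<in> space M"
      then obtain E where "E \<in> \<E>" "x \<in> E" "y \<in> E" using basis x unfolding set_basis_def by blast
      with E'(3) show "y \<in> \<Union> {E \<in> \<E>'. x \<in> E}" by blast
    qed
  qed (use E' in auto)
qed

lemma AE_of_AE_on_cover:
  assumes x: "x \<in> space M" and P: "\<And>E. E \<in> \<E> \<Longrightarrow> x \<in> E \<Longrightarrow> AE y in M. y \<in> E \<longrightarrow> P y"
  shows "AE y in M. P y"
proof -
  obtain \<C> where C: "countable \<C>" "\<C> \<subseteq> \<E>" "\<And>E. E \<in> \<C> \<Longrightarrow> x \<in> E" "space M \<subseteq> \<Union>\<C>"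
    using countable_cover[OF x] by metis
  have "AE y in M. \<forall>E\<in>\<C>. y \<in> E \<longrightarrow> P y"
    unfolding AE_ball_countable[OF C(1)] using P C(2,3) by blast
  moreover have "AE y in M. y \<in> space M" by simp
  ultimately show ?thesis by eventually_elim (use C(4) in blast)
qed

text \<open>By the countable cover, averages over basis sets through one fixed point already see the
  whole space.\<close>

lemma AE_0_of_avg_0:
  assumes x: "x \<in> space M" and [measurable]: "h \<in> borel_measurable M"
    and 0: "\<And>E. E \<in> \<E> \<Longrightarrow> x \<in> E \<Longrightarrow> avg M 1 E h = 0"
  shows "AE y in M. (h y :: real) = 0"
proof (rule AE_of_AE_on_cover[OF x])
  fix E assume E: "E \<in> \<E>" "x \<in> E"
  note [measurable] = basisD(1)[OF E(1)]
  have "(\<integral>\<^sup>+x. ennreal (norm (h x)) * indicator E x \<partial>M) = 0"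
    using 0[OF E] basisD[OF E(1)] by (auto simp: avg_1 ennreal_divide_eq_0_iff)
  then have "AE y in M. ennreal (norm (h y)) * indicator E y = 0"
    by (subst (asm) nn_integral_0_iff_AE) auto
  then show "AE y in M. y \<in> E \<longrightarrow> h y = 0"
    by eventually_elim (auto simp: indicator_def)
qed

text \<open>The pointwise \<open>A_1\<close> condition with constant \<kappa>, outside one null set
  common to all \<open>E\<close>. It is stated through averages, so that the maximal function, a
  supremum over a possibly uncountable family, does not enter.\<close>

definition A1 :: "real \<Rightarrow> ('a \<Rightarrow> real) \<Rightarrow> bool" where
  "A1 \<kappa> h \<longleftrightarrow> (AE x in M. \<forall>E\<in>\<E>. x \<in> E \<longrightarrow> avg M 1 E h \<le> ennreal (\<kappa> * h x))"

text \<open>\<open>maximal_norm\<close> is an infimum of admissible constants; this is the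
  inequality with the infimum itself, which the iteration must apply repeatedly without
  loss.\<close>

lemma maximal_norm_attained:
  assumes bdd: "maximal_bounded M \<E> Z" and f: "f \<in> carr Z" "nrm Z f \<le> ennreal n" and n: "0 \<le> n"
  shows "nrm Z (maximal_fun M \<E> f) \<le> ennreal (enn2real (maximal_norm M \<E> Z) * n)"
proof -
  define K where "K = enn2real (maximal_norm M \<E> Z)"
  have K: "maximal_norm M \<E> Z = ennreal K" "0 \<le> K" using bdd by (auto simp: K_def maximal_bounded_def less_top)
  have "nrm Z (maximal_fun M \<E> f) \<le> ennreal (K * n)"
  proof (rule ennreal_le_epsilon)
    fix e :: real assume e: "0 < e"
    define d where "d = e / (n + 1)"
    have d: "0 < d" "d * n \<le> e" using e n by (auto simp: d_def field_simps)
    have "maximal_norm M \<E> Z < ennreal (K + d)" unfolding K(1) using K(2) d(1) by (simp add: ennreal_less_iff)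
    then obtain C where C: "\<And>f. f \<in> carr Z \<Longrightarrow> nrm Z (maximal_fun M \<E> f) \<le> C * nrm Z f" "C < ennreal (K + d)"
      unfolding maximal_norm_def Inf_less_iff by auto
    have "nrm Z (maximal_fun M \<E> f) \<le> C * nrm Z f" by (rule C(1)[OF f(1)])
    also have "\<dots> \<le> ennreal (K + d) * ennreal n" by (intro mult_mono less_imp_le[OF C(2)] f) auto
    also have "\<dots> = ennreal (K * n + d * n)" using K(2) d(1) n by (simp add: ennreal_mult'[symmetric] distrib_right)
    also have "\<dots> \<le> ennreal (K * n + e)" using d(2) by (intro ennreal_leI) simp
    also have "\<dots> = ennreal (K * n) + ennreal e" using K(2) n e by (simp add: ennreal_plus)
    finally show "nrm Z (maximal_fun M \<E> f) \<le> ennreal (K * n) + ennreal e" .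
  qed
  then show ?thesis by (simp add: K_def)
qed

text \<open>The sum \<open>\<Sum>\<^sub>k M\<^sup>k h0 / (2 \<kappa>)\<^sup>k\<close> is finite and positive almost everywhere because a single point
  where its averages are controlled sees all of \<open>\<Omega>\<close> through countably many sets of the basis.\<close>

lemma rubio_de_francia:
  fixes Z :: "('a, 'k::{real_normed_field,second_countable_topology}) fspace"
  assumes bdd: "maximal_bounded M \<E> Z" and Z: "carr Z \<subseteq> L0 M"
    and pair: "\<And>H u N. (\<And>x. 0 \<le> H x) \<Longrightarrow> emb H \<in> carr Z \<Longrightarrow> nrm Z (emb H) \<le> ennreal N \<Longrightarrow> u \<in> P \<Longrightarrow>
       (\<integral>\<^sup>+x. ennreal (u x * H x) \<partial>M) \<le> ennreal N"
    and P: "\<And>u. u \<in> P \<Longrightarrow> u \<in> borel_measurable M" "\<And>u x. u \<in> P \<Longrightarrow> 0 \<le> u x"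
    and u0: "u0 \<in> P" "\<not> (AE x in M. u0 x = 0)"
    and h0 [measurable]: "h0 \<in> borel_measurable M" and h0n: "\<And>x. 0 \<le> h0 x"
    and h0Z: "emb h0 \<in> carr Z" "nrm Z (emb h0) \<le> 1" and h0nz: "\<not> (AE x in M. h0 x = 0)"
  obtains h where "h \<in> borel_measurable M" "\<And>x. 0 \<le> h x" "AE x in M. 0 < h x" "AE x in M. h0 x \<le> h x"
    "\<And>u. u \<in> P \<Longrightarrow> (\<integral>\<^sup>+x. ennreal (u x * h x) \<partial>M) \<le> 2" "A1 (2 * enn2real (maximal_norm M \<E> Z)) h"
proof -
  define \<kappa> where "\<kappa> = enn2real (maximal_norm M \<E> Z)"
  have \<kappa>0: "0 \<le> \<kappa>" by (simp add: \<kappa>_def)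
  \<comment> \<open>The iterates of the maximal operator. \<open>enn2real\<close> replaces the value
    \<infinity> by 0, which by \<open>maximal_bounded\<close> happens only on null sets.\<close>
  define H where "H = rec_nat h0 (\<lambda>k g x. enn2real (maximal M \<E> (emb g :: 'a \<Rightarrow> 'k) x))"
  have H0: "H 0 = h0" by (simp add: H_def)
  have HS: "emb (H (Suc k)) = maximal_fun M \<E> (emb (H k) :: 'a \<Rightarrow> 'k)"
    and HS': "H (Suc k) x = enn2real (maximal M \<E> (emb (H k) :: 'a \<Rightarrow> 'k) x)" for k x
    by (simp_all add: H_def maximal_fun_def)
  have Hn: "0 \<le> H k x" for k x by (cases k) (auto simp: H0 h0n HS')
  have HZ: "emb (H k) \<in> carr Z \<and> nrm Z (emb (H k)) \<le> ennreal (\<kappa> ^ k)" for k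
  proof (induction k)
    case 0
    then show ?case using h0Z by (simp add: H0)
  next
    case (Suc k)
    then show ?case using bdd maximal_norm_attained[OF bdd, of "emb (H k)" "\<kappa> ^ k"] \<kappa>0
      unfolding HS by (auto simp: maximal_bounded_def \<kappa>_def)
  qed
  have Hm [measurable]: "H k \<in> borel_measurable M" for k
    using L0_norm_meas[of "emb (H k) :: 'a \<Rightarrow> 'k" M] HZ[of k] Z Hn by auto
  have avg_emb: "avg M 1 E (emb g :: 'a \<Rightarrow> 'k) = avg M 1 E g" for E g by (simp add: avg_1)
  have HA: "AE x in M. \<forall>k. \<forall>E\<in>\<E>. x \<in> E \<longrightarrow> avg M 1 E (H k) \<le> ennreal (H (Suc k) x)"
    unfolding AE_all_countable
  proof
    fix k
    have "AE x in M. maximal M \<E> (emb (H k) :: 'a \<Rightarrow> 'k) x < \<infinity>"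
      using bdd HZ[of k] by (auto simp: maximal_bounded_def)
    then show "AE x in M. \<forall>E\<in>\<E>. x \<in> E \<longrightarrow> avg M 1 E (H k) \<le> ennreal (H (Suc k) x)"
    proof eventually_elim
      case (elim x)
      show ?case
      proof (intro ballI impI)
        fix E assume "E \<in> \<E>" "x \<in> E"
        then have "avg M 1 E (H k) * 1 \<le> maximal M \<E> (emb (H k) :: 'a \<Rightarrow> 'k) x"
          unfolding maximal_def avg_emb[symmetric] by (intro SUP_upper2[of E]) auto
        also have "\<dots> = ennreal (H (Suc k) x)" using elim by (simp add: HS')
        finally show "avg M 1 E (H k) \<le> ennreal (H (Suc k) x)" by simp
      qed
    qed
  qed
  note [measurable] = P(1)[OF u0(1)]
  \<comment> \<open>Needed to divide by \<open>2 * \<kappa>\<close>. If \<kappa> were 0, the first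
    iterate would vanish at almost every point where \<open>u0\<close> does not; at one such point
    all averages of \<open>h0\<close> are 0, so \<open>h0 = 0\<close> almost everywhere.\<close>
  have \<kappa>: "0 < \<kappa>"
  proof (rule ccontr)
    assume "\<not> 0 < \<kappa>"
    then have "\<kappa> = 0" using \<kappa>0 by simp
    then have "(\<integral>\<^sup>+x. ennreal (u0 x * H 1 x) \<partial>M) \<le> ennreal 0"
      using HZ[of 1] by (intro pair u0(1) Hn) auto
    then have "AE x in M. ennreal (u0 x * H 1 x) = 0"
      by (subst nn_integral_0_iff_AE[symmetric]) auto
    with HA have "AE x in M. ennreal (u0 x * H 1 x) = 0 \<and> (\<forall>E\<in>\<E>. x \<in> E \<longrightarrow> avg M 1 E (H 0) \<le> ennreal (H 1 x))"
      by eventually_elim (metis One_nat_def)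
    moreover have "\<not> (AE x in M. \<not> u0 x \<noteq> 0)" using u0(2) by simp
    ultimately obtain x where x: "x \<in> space M" "ennreal (u0 x * H 1 x) = 0 \<and>
      (\<forall>E\<in>\<E>. x \<in> E \<longrightarrow> avg M 1 E (H 0) \<le> ennreal (H 1 x))" "u0 x \<noteq> 0"
      by (rule ex_AE_and_not_AE)
    have "H 1 x = 0" using x(2,3) P(2)[OF u0(1), of x] Hn[of 1 x]
      by (auto simp: ennreal_eq_0_iff mult_le_0_iff)
    then have "AE y in M. H 0 y = 0" using x(1,2) \<open>H 1 x = 0\<close> by (intro AE_0_of_avg_0[of x]) auto
    then show False using h0nz by (simp add: H0)
  qed
  define G where "G x = (\<Sum>k. ennreal (H k x / (2 * \<kappa>) ^ k))" for x
  have Gm [measurable]: "G \<in> borel_measurable M" unfolding G_def by measurable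
  have Gu: "(\<integral>\<^sup>+x. ennreal (u x) * G x \<partial>M) \<le> 2" if u: "u \<in> P" for u
  proof -
    note [measurable] = P(1)[OF u]
    have "(\<integral>\<^sup>+x. ennreal (u x) * G x \<partial>M) = (\<integral>\<^sup>+x. (\<Sum>k. ennreal (1 / (2 * \<kappa>) ^ k) * ennreal (u x * H k x)) \<partial>M)"
      unfolding G_def ennreal_suminf_cmult[symmetric]
      using P(2)[OF u] Hn \<kappa> by (intro nn_integral_cong suminf_cong) (simp flip: ennreal_mult')
    also have "\<dots> = (\<Sum>k. ennreal (1 / (2 * \<kappa>) ^ k) * (\<integral>\<^sup>+x. ennreal (u x * H k x) \<partial>M))"
      by (subst nn_integral_suminf) (auto simp: nn_integral_cmult)
    also have "\<dots> \<le> (\<Sum>k. ennreal ((1/2) ^ k))"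
    proof (intro suminf_le)
      fix k
      have "ennreal (1 / (2 * \<kappa>) ^ k) * (\<integral>\<^sup>+x. ennreal (u x * H k x) \<partial>M) \<le> ennreal (1 / (2 * \<kappa>) ^ k) * ennreal (\<kappa> ^ k)"
        using HZ[of k] by (intro mult_left_mono pair u Hn) auto
      also have "\<dots> = ennreal ((1/2) ^ k)" using \<kappa> by (simp add: power_mult_distrib power_divide flip: ennreal_mult')
      finally show "ennreal (1 / (2 * \<kappa>) ^ k) * (\<integral>\<^sup>+x. ennreal (u x * H k x) \<partial>M) \<le> ennreal ((1/2) ^ k)" .
    qed auto
    also have "\<dots> = ennreal (\<Sum>k. (1/2) ^ k)" by (intro suminf_ennreal2) auto
    also have "(\<Sum>k. (1/2::real) ^ k) = 2" by (subst suminf_geometric) auto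
    finally show ?thesis by simp
  qed
  \<comment> \<open>Averaging term \<open>k\<close> over \<open>E\<close> gives at most
    \<open>H (Suc k) x / (2 * \<kappa>)^k\<close>, which is \<open>2 * \<kappa>\<close> times term
    \<open>k + 1\<close>: the series is shifted by one.\<close>
  have GA: "AE x in M. \<forall>E\<in>\<E>. x \<in> E \<longrightarrow>
      (\<integral>\<^sup>+y. G y * indicator E y \<partial>M) / emeasure M E \<le> ennreal (2 * \<kappa>) * G x"
    using HA
  proof eventually_elim
    case (elim x)
    show ?case
    proof (intro ballI impI)
      fix E assume E: "E \<in> \<E>" "x \<in> E"
      note [measurable] = basisD(1)[OF E(1)]
      have "(\<integral>\<^sup>+y. G y * indicator E y \<partial>M) = (\<integral>\<^sup>+y. (\<Sum>k. ennreal (1 / (2 * \<kappa>) ^ k) * (ennreal (norm (H k y)) * indicator E y)) \<partial>M)"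
        unfolding G_def ennreal_suminf_multc[symmetric]
        using Hn \<kappa> by (intro nn_integral_cong suminf_cong) (simp add: mult.assoc[symmetric] flip: ennreal_mult')
      also have "\<dots> = (\<Sum>k. ennreal (1 / (2 * \<kappa>) ^ k) * (\<integral>\<^sup>+y. ennreal (norm (H k y)) * indicator E y \<partial>M))"
        by (subst nn_integral_suminf) (auto simp: nn_integral_cmult)
      finally have "(\<integral>\<^sup>+y. G y * indicator E y \<partial>M) / emeasure M E = (\<Sum>k. ennreal (1 / (2 * \<kappa>) ^ k) * avg M 1 E (H k))"
        by (simp add: avg_1 divide_ennreal_def ennreal_suminf_multc mult.assoc[symmetric])
      also have "\<dots> \<le> (\<Sum>k. ennreal (2 * \<kappa>) * ennreal (H (Suc k) x / (2 * \<kappa>) ^ Suc k))"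
      proof (intro suminf_le)
        fix k
        have "ennreal (1 / (2 * \<kappa>) ^ k) * avg M 1 E (H k) \<le> ennreal (1 / (2 * \<kappa>) ^ k) * ennreal (H (Suc k) x)"
          using elim E by (intro mult_left_mono) auto
        also have "\<dots> = ennreal (2 * \<kappa>) * ennreal (H (Suc k) x / (2 * \<kappa>) ^ Suc k)"
          using \<kappa> by (simp flip: ennreal_mult')
        finally show "ennreal (1 / (2 * \<kappa>) ^ k) * avg M 1 E (H k) \<le> ennreal (2 * \<kappa>) * ennreal (H (Suc k) x / (2 * \<kappa>) ^ Suc k)" .
      qed auto
      also have "\<dots> = ennreal (2 * \<kappa>) * (\<Sum>k. ennreal (H (Suc k) x / (2 * \<kappa>) ^ Suc k))" by simp
      also have "(\<Sum>k. ennreal (H (Suc k) x / (2 * \<kappa>) ^ Suc k)) \<le> G x"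
        unfolding G_def using suminf_offset[of "\<lambda>k. ennreal (H k x / (2 * \<kappa>) ^ k)" 1] by simp
      finally show "(\<integral>\<^sup>+y. G y * indicator E y \<partial>M) / emeasure M E \<le> ennreal (2 * \<kappa>) * G x"
        by (simp add: mult_left_mono)
    qed
  qed
  \<comment> \<open>Pick one point with \<open>u0 > 0\<close> and \<open>G\<close> finite. There
    \<open>GA\<close> makes the integral of \<open>G\<close> over each basis set through the point
    finite, and these sets cover the space.\<close>
  have Gfin: "AE x in M. G x < \<infinity>"
  proof -
    have "AE x in M. ennreal (u0 x) * G x \<noteq> \<infinity>"
      using Gu[OF u0(1)] by (intro nn_integral_PInf_AE) (auto simp: top_unique)
    with GA have "AE x in M. ennreal (u0 x) * G x \<noteq> \<infinity> \<and> (\<forall>E\<in>\<E>. x \<in> E \<longrightarrow>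
      (\<integral>\<^sup>+y. G y * indicator E y \<partial>M) / emeasure M E \<le> ennreal (2 * \<kappa>) * G x)" by eventually_elim simp
    moreover have "\<not> (AE x in M. \<not> u0 x \<noteq> 0)" using u0(2) by simp
    ultimately obtain x where x: "x \<in> space M" "ennreal (u0 x) * G x \<noteq> \<infinity> \<and> (\<forall>E\<in>\<E>. x \<in> E \<longrightarrow>
      (\<integral>\<^sup>+y. G y * indicator E y \<partial>M) / emeasure M E \<le> ennreal (2 * \<kappa>) * G x)" "u0 x \<noteq> 0"
      by (rule ex_AE_and_not_AE)
    have "0 < u0 x" using x(3) P(2)[OF u0(1), of x] by simp
    then have Gx: "G x < \<infinity>" using x(2) by (auto simp: ennreal_mult_eq_top_iff less_top)
    show ?thesis
    proof (rule AE_of_AE_on_cover[OF x(1)])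
      fix E assume E: "E \<in> \<E>" "x \<in> E"
      note [measurable] = basisD(1)[OF E(1)]
      have "(\<integral>\<^sup>+y. G y * indicator E y \<partial>M) / emeasure M E \<le> ennreal (2 * \<kappa>) * G x" using x(2) E by blast
      also have "\<dots> < \<infinity>" using Gx by (simp add: ennreal_mult_less_top)
      finally have "(\<integral>\<^sup>+y. G y * indicator E y \<partial>M) \<noteq> \<infinity>"
        using basisD[OF E(1)] by (auto simp: ennreal_top_divide split: if_splits)
      then have "AE y in M. G y * indicator E y \<noteq> \<infinity>" by (intro nn_integral_PInf_AE) auto
      then show "AE y in M. y \<in> E \<longrightarrow> G y < \<infinity>" by eventually_elim (auto simp: less_top)
    qed
  qed
  define h where "h x = enn2real (G x)" for x
  have hm [measurable]: "h \<in> borel_measurable M" unfolding h_def by measurable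
  have hn: "0 \<le> h x" for x by (simp add: h_def)
  have hG: "AE x in M. ennreal (h x) = G x" using Gfin by eventually_elim (simp add: h_def)
  have h0h: "AE x in M. h0 x \<le> h x"
    using hG
  proof eventually_elim
    case (elim x)
    have "ennreal (h0 x) \<le> G x"
      unfolding G_def using sum_le_suminf[of "\<lambda>k. ennreal (H k x / (2 * \<kappa>) ^ k)" "{0}"] by (simp add: H0)
    then show ?case unfolding elim[symmetric] using hn[of x] by (simp add: ennreal_le_iff)
  qed
  have hA: "A1 (2 * \<kappa>) h"
    unfolding A1_def using GA hG
  proof eventually_elim
    case (elim x)
    show ?case
    proof (intro ballI impI)
      fix E assume E: "E \<in> \<E>" "x \<in> E"
      have "(\<integral>\<^sup>+y. ennreal (norm (h y)) * indicator E y \<partial>M) = (\<integral>\<^sup>+y. G y * indicator E y \<partial>M)"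
        using hG by (intro nn_integral_cong_AE) (auto elim!: eventually_mono simp: hn)
      then have "avg M 1 E h \<le> ennreal (2 * \<kappa>) * G x" using elim(1) E by (simp add: avg_1)
      also have "\<dots> = ennreal (2 * \<kappa> * h x)" unfolding elim(2)[symmetric] using \<kappa> by (simp add: ennreal_mult')
      finally show "avg M 1 E h \<le> ennreal (2 * \<kappa> * h x)" .
    qed
  qed
  \<comment> \<open>A zero of \<open>h\<close> at a point obeying the \<open>A_1\<close> condition
    would make all averages of \<open>h\<close> through it vanish, hence \<open>h\<close> and the
    smaller \<open>h0\<close>.\<close>
  have "AE x in M. 0 < h x"
  proof (rule ccontr)
    assume "\<not> ?thesis"
    then have "\<not> (AE x in M. \<not> h x = 0)"
      by (metis (mono_tags, lifting) eventually_mono hn less_eq_real_def)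
    then obtain x where x: "x \<in> space M" "\<forall>E\<in>\<E>. x \<in> E \<longrightarrow> avg M 1 E h \<le> ennreal (2 * \<kappa> * h x)" "h x = 0"
      by (rule ex_AE_and_not_AE[OF hA[unfolded A1_def]])
    then have "AE y in M. h y = 0" by (intro AE_0_of_avg_0[of x]) auto
    with h0h have "AE y in M. h0 y = 0"
    proof eventually_elim
      case (elim y)
      then show ?case using h0n[of y] by simp
    qed
    with h0nz show False by simp
  qed
  moreover have "(\<integral>\<^sup>+x. ennreal (u x * h x) \<partial>M) \<le> 2" if u: "u \<in> P" for u
  proof -
    have "(\<integral>\<^sup>+x. ennreal (u x * h x) \<partial>M) = (\<integral>\<^sup>+x. ennreal (u x) * G x \<partial>M)"
      using hG by (intro nn_integral_cong_AE) (auto elim!: eventually_mono simp: ennreal_mult' P(2)[OF u])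
    then show ?thesis using Gu[OF u] by simp
  qed
  ultimately show ?thesis using hA unfolding \<kappa>_def by (intro that[OF hm hn _ h0h]) auto
qed

end

section \<open>From pairs of \<open>A_1\<close> functions to weights\<close>

context measure_basis
begin

text \<open>The \<open>L^(1/t)\<close> average of \<open>h powr t\<close> is the power
  \<open>t\<close> of the ordinary average of \<open>h\<close>. For \<open>t = 0\<close> the
  exponent is \<infinity>, and the pointwise bound \<open>c\<close> is used instead.\<close>

lemma avg_le_of_le_powr:
  fixes g h :: "'a \<Rightarrow> real"
  assumes E: "E \<in> \<E>" and [measurable]: "g \<in> borel_measurable M" "h \<in> borel_measurable M"
    and h0: "\<And>x. 0 \<le> h x" and t: "0 \<le> t" and c: "0 \<le> c" and d: "0 < d"
    and le: "AE x in M. x \<in> E \<longrightarrow> \<bar>g x\<bar> \<le> c * h x powr t" and avg: "avg M 1 E h \<le> ennreal d"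
  shows "avg M (inverse (ennreal t)) E g \<le> ennreal (c * d powr t)"
proof (cases "t = 0")
  case True
  note [measurable] = basisD(1)[OF E]
  have "AE x in M. ennreal (norm (indicator E x *\<^sub>R g x)) \<le> ennreal c"
    using le
  proof eventually_elim
    case (elim x)
    have "c * h x powr 0 \<le> c" using c by simp
    then show ?case using elim c by (auto simp: True indicator_def intro!: ennreal_leI)
  qed
  then have "esssup M (\<lambda>x. ennreal (norm (indicator E x *\<^sub>R g x))) \<le> ennreal c"
    by (intro esssup_I) simp_all
  then show ?thesis using True d by (simp add: avg_def Lnorm_def epow_def divide_ennreal_def)
next
  case False
  then have t0: "0 < t" using t by simp
  note [measurable] = basisD(1)[OF E]
  obtain e where e: "0 < e" "emeasure M E = ennreal e"
    using basisD(2,3)[OF E] by (cases "emeasure M E") auto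
  have inv: "inverse (ennreal t) = ennreal (1 / t)" "inverse (ennreal (1 / t)) = ennreal t"
    using t0 by (simp_all add: inverse_ennreal divide_inverse)
  have "(\<integral>\<^sup>+x. epow (ennreal (norm (indicator E x *\<^sub>R g x))) (1 / t) \<partial>M)
    \<le> (\<integral>\<^sup>+x. ennreal (c powr (1 / t)) * (ennreal (norm (h x)) * indicator E x) \<partial>M)"
  proof (intro nn_integral_mono_AE)
    show "AE x in M. epow (ennreal (norm (indicator E x *\<^sub>R g x))) (1 / t)
      \<le> ennreal (c powr (1 / t)) * (ennreal (norm (h x)) * indicator E x)"
      using le
    proof eventually_elim
      case (elim x)
      show ?case
      proof (cases "x \<in> E")
        case True
        then have "\<bar>g x\<bar> powr (1 / t) \<le> (c * h x powr t) powr (1 / t)"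
          using elim t0 by (intro powr_mono2) auto
        also have "\<dots> = c powr (1 / t) * h x" using t0 h0[of x] by (simp add: powr_mult powr_powr)
        finally show ?thesis using True t0 h0[of x] by (simp add: epow_ennreal ennreal_leI flip: ennreal_mult')
      qed (use t0 in \<open>simp add: epow_def\<close>)
    qed
  qed
  also have "\<dots> = ennreal (c powr (1 / t)) * (\<integral>\<^sup>+x. ennreal (norm (h x)) * indicator E x \<partial>M)"
    by (simp add: nn_integral_cmult)
  also have "(\<integral>\<^sup>+x. ennreal (norm (h x)) * indicator E x \<partial>M) = avg M 1 E h * emeasure M E"
    using e by (simp add: avg_1 ennreal_divide_times ennreal_divide_self)
  also have "\<dots> \<le> ennreal d * ennreal e" unfolding e(2) by (intro mult_right_mono avg) simp
  finally have "(\<integral>\<^sup>+x. epow (ennreal (norm (indicator E x *\<^sub>R g x))) (1 / t) \<partial>M) \<le> ennreal (c powr (1 / t) * (d * e))"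
    using c d e by (simp add: mult_left_mono ennreal_mult')
  then have "epow (\<integral>\<^sup>+x. epow (ennreal (norm (indicator E x *\<^sub>R g x))) (1 / t) \<partial>M) t \<le> epow (ennreal (c powr (1 / t) * (d * e))) t"
    using t by (rule epow_mono[rotated])
  also have "\<dots> = ennreal (c * d powr t * e powr t)"
    using t0 c d e by (simp add: epow_ennreal powr_mult powr_powr)
  finally have "Lnorm M (inverse (ennreal t)) (\<lambda>x. indicator E x *\<^sub>R g x) \<le> ennreal (c * d powr t * e powr t)"
    using t0 by (simp add: Lnorm_def inv)
  then have "avg M (inverse (ennreal t)) E g \<le> ennreal (c * d powr t * e powr t) / ennreal (e powr t)"
    using t0 e by (simp add: avg_def inv epow_ennreal divide_right_mono_ennreal)
  also have "\<dots> = ennreal (c * d powr t)" using e c d by (simp add: divide_ennreal)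
  finally show ?thesis .
qed

text \<open>On a set \<open>E\<close> with averages \<open>dh\<close> and \<open>dk\<close>, the
  \<open>A_1\<close> conditions give \<open>h \<ge> dh / \<kappa>\<close> and
  \<open>k \<ge> dk / \<kappa>'\<close>. They bound the negative powers pointwise, the positive
  powers are averaged exactly, and \<open>dh\<close>, \<open>dk\<close> cancel in the
  product.\<close>

lemma Ap_of_A1:
  assumes [measurable]: "h \<in> borel_measurable M" "k \<in> borel_measurable M"
    and nn: "\<And>x. 0 \<le> h x" "\<And>x. 0 \<le> k x" and pos: "AE x in M. 0 < h x" "AE x in M. 0 < k x"
    and A1: "A1 \<kappa> h" "A1 \<kappa>' k" and \<kappa>: "0 \<le> \<kappa>" "0 \<le> \<kappa>'"
    and \<alpha>: "0 \<le> \<alpha>" "inverse (ennreal r) - inverse p = ennreal \<alpha>"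
    and \<beta>: "0 \<le> \<beta>" "inverse p - inverse s = ennreal \<beta>"
  defines "w \<equiv> \<lambda>x. h x powr (- \<alpha>) * k x powr \<beta>"
  shows "w \<in> Ap M \<E> p r s" "Ap_const M \<E> p r s w \<le> ennreal (\<kappa> powr \<alpha> * \<kappa>' powr \<beta>)"
proof -
  have wm [measurable]: "w \<in> borel_measurable M" unfolding w_def by measurable
  have "AE x in M. 0 < w x" using pos by eventually_elim (simp add: w_def)
  then have "weight M w" by (simp add: weight_def)
  have "avg M (inverse (inverse (ennreal r) - inverse p)) E (\<lambda>x. inverse (w x)) * avg M (inverse (inverse p - inverse s)) E w
    \<le> ennreal (\<kappa> powr \<alpha> * \<kappa>' powr \<beta>)" if E: "E \<in> \<E>" for E
  proof -
    note [measurable] = basisD(1)[OF E]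
    have E_nonnull: "\<not> (AE x in M. \<not> x \<in> E)"
      using basisD(1,2)[OF E] AE_iff_null_sets[of E M] by (auto dest: null_setsD1)
    have pos_avg: "0 < avg M 1 E v" if "v \<in> borel_measurable M" "AE x in M. 0 < v x" for v :: "'a \<Rightarrow> real"
    proof (rule ccontr)
      assume "\<not> 0 < avg M 1 E v"
      then have "(\<integral>\<^sup>+x. ennreal (norm (v x)) * indicator E x \<partial>M) = 0"
        using basisD[OF E] by (auto simp: avg_1 ennreal_divide_eq_0_iff zero_less_iff_neq_zero)
      then have "AE x in M. ennreal (norm (v x)) * indicator E x = 0"
        using that(1) by (subst (asm) nn_integral_0_iff_AE) auto
      with that(2) have "AE x in M. \<not> x \<in> E" by eventually_elim (auto simp: indicator_def)
      with E_nonnull show False by simp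
    qed
    \<comment> \<open>The \<open>A_1\<close> bound at a single point of \<open>E\<close> shows that
      the average is finite; as the average is positive, the constant \<open>K\<close> must be
      positive too.\<close>
    have fin: "\<exists>d>0. avg M 1 E v = ennreal d \<and> (AE x in M. x \<in> E \<longrightarrow> d \<le> K * v x) \<and> 0 < K"
      if "v \<in> borel_measurable M" "AE x in M. 0 < v x" "A1 K v" "0 \<le> K" for v K
    proof -
      have a: "AE x in M. x \<in> E \<longrightarrow> avg M 1 E v \<le> ennreal (K * v x)"
        using that(3) unfolding A1_def by eventually_elim (use E in blast)
      obtain x where "x \<in> E \<longrightarrow> avg M 1 E v \<le> ennreal (K * v x)" "x \<in> E"
        using ex_AE_and_not_AE[OF a E_nonnull] by blast
      then have le: "avg M 1 E v \<le> ennreal (K * v x)" by blast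
      moreover obtain d where d: "0 \<le> d" "avg M 1 E v = ennreal d"
        using le_less_trans[OF le ennreal_less_top] by (cases "avg M 1 E v") auto
      moreover have "0 < d" using pos_avg[OF that(1,2)] unfolding d(2) by simp
      moreover have "0 < K"
        using le \<open>0 < d\<close> that(4) unfolding d(2) by (cases "K = 0") (auto simp: ennreal_le_iff2)
      moreover have "AE x in M. x \<in> E \<longrightarrow> d \<le> K * v x"
        using a that(2) by eventually_elim (use \<open>0 < d\<close> \<open>0 < K\<close> in \<open>auto simp: d(2) ennreal_le_iff\<close>)
      ultimately show ?thesis by blast
    qed
    obtain dh where dh: "0 < dh" "avg M 1 E h = ennreal dh" "AE x in M. x \<in> E \<longrightarrow> dh \<le> \<kappa> * h x" "0 < \<kappa>"
      using fin[OF _ pos(1) A1(1) \<kappa>(1)] by auto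
    obtain dk where dk: "0 < dk" "avg M 1 E k = ennreal dk" "AE x in M. x \<in> E \<longrightarrow> dk \<le> \<kappa>' * k x" "0 < \<kappa>'"
      using fin[OF _ pos(2) A1(2) \<kappa>(2)] by auto
    have neg: "y powr (- t) \<le> (K / d) powr t" if "0 < y" "d \<le> K * y" "0 < d" "0 < K" "0 \<le> t" for y d K t :: real
    proof -
      have "(1 / y) powr t \<le> (K / d) powr t" using that by (intro powr_mono2) (auto simp: field_simps)
      then show ?thesis using that by (simp add: powr_minus powr_divide inverse_eq_divide)
    qed
    have "avg M (inverse (ennreal \<alpha>)) E (\<lambda>x. inverse (w x)) \<le> ennreal ((\<kappa>' / dk) powr \<beta> * dh powr \<alpha>)"
    proof (rule avg_le_of_le_powr[OF E _ _ nn(1) \<alpha>(1) _ dh(1)])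
      show "AE x in M. x \<in> E \<longrightarrow> \<bar>inverse (w x)\<bar> \<le> (\<kappa>' / dk) powr \<beta> * h x powr \<alpha>"
        using dk(3) pos
      proof eventually_elim
        case (elim x)
        show ?case
        proof
          assume "x \<in> E"
          then have "k x powr (- \<beta>) \<le> (\<kappa>' / dk) powr \<beta>" using elim dk(1,4) \<beta>(1) by (intro neg) auto
          then have "k x powr (- \<beta>) * h x powr \<alpha> \<le> (\<kappa>' / dk) powr \<beta> * h x powr \<alpha>" by (rule mult_right_mono) simp
          then show "\<bar>inverse (w x)\<bar> \<le> (\<kappa>' / dk) powr \<beta> * h x powr \<alpha>"
            by (simp add: w_def powr_minus abs_mult mult.commute)
        qed
      qed
    qed (use dh in auto)
    moreover have "avg M (inverse (ennreal \<beta>)) E w \<le> ennreal ((\<kappa> / dh) powr \<alpha> * dk powr \<beta>)"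
    proof (rule avg_le_of_le_powr[OF E _ _ nn(2) \<beta>(1) _ dk(1)])
      show "AE x in M. x \<in> E \<longrightarrow> \<bar>w x\<bar> \<le> (\<kappa> / dh) powr \<alpha> * k x powr \<beta>"
        using dh(3) pos
      proof eventually_elim
        case (elim x)
        show ?case
        proof
          assume "x \<in> E"
          then have "h x powr (- \<alpha>) \<le> (\<kappa> / dh) powr \<alpha>" using elim dh(1,4) \<alpha>(1) by (intro neg) auto
          then show "\<bar>w x\<bar> \<le> (\<kappa> / dh) powr \<alpha> * k x powr \<beta>"
            by (simp add: w_def abs_mult mult_right_mono)
        qed
      qed
    qed (use dk in auto)
    ultimately have "avg M (inverse (ennreal \<alpha>)) E (\<lambda>x. inverse (w x)) * avg M (inverse (ennreal \<beta>)) E w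
      \<le> ennreal ((\<kappa>' / dk) powr \<beta> * dh powr \<alpha>) * ennreal ((\<kappa> / dh) powr \<alpha> * dk powr \<beta>)"
      by (intro mult_mono) auto
    also have "\<dots> = ennreal ((\<kappa>' / dk) powr \<beta> * dh powr \<alpha> * ((\<kappa> / dh) powr \<alpha> * dk powr \<beta>))"
      by (intro ennreal_mult'[symmetric] mult_nonneg_nonneg) auto
    also have "(\<kappa>' / dk) powr \<beta> * dh powr \<alpha> * ((\<kappa> / dh) powr \<alpha> * dk powr \<beta>) = \<kappa> powr \<alpha> * \<kappa>' powr \<beta>"
      using dh(1) dk(1) by (simp add: powr_divide)
    finally show ?thesis by (simp add: \<alpha>(2) \<beta>(2))
  qed
  then show c: "Ap_const M \<E> p r s w \<le> ennreal (\<kappa> powr \<alpha> * \<kappa>' powr \<beta>)"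
    unfolding Ap_const_def by (rule SUP_least)
  show "w \<in> Ap M \<E> p r s"
    using \<open>weight M w\<close> le_less_trans[OF c] by (simp add: Ap_def)
qed

lemma A1_const: "A1 1 (\<lambda>x. 1)"
  unfolding A1_def
proof (intro AE_I2 ballI impI)
  fix E assume "E \<in> \<E>"
  from basisD[OF this] have "emeasure M E / emeasure M E = 1"
    by (intro ennreal_divide_self) auto
  then show "avg M 1 E (\<lambda>x. 1 :: real) \<le> ennreal (1 * 1)"
    using basisD(1)[OF \<open>E \<in> \<E>\<close>] by (simp add: avg_1)
qed

end

section \<open>Choice of the weights\<close>

text \<open>One coordinate of the multilinear problem. A nonempty space contains a basis set of
  positive measure, which is what makes the nonvanishing arguments meaningful.\<close>

locale extrapolation = convex_concave_space M X r s + measure_basis M \<E>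
  for M :: "'a measure" and X :: "('a, 'k::{real_normed_field,second_countable_topology}) fspace"
    and r :: real and s :: ennreal and \<E> :: "'a set set" +
  fixes p :: ennreal
  assumes rp: "ennreal r \<le> p" and ps: "p \<le> s"
    and bdd: "p \<noteq> ennreal r \<Longrightarrow> maximal_bounded M \<E> (space_rs M r s X)"
    and bdd': "p \<noteq> s \<Longrightarrow> maximal_bounded M \<E> (kdual M (space_rs M r s X))"
    and nonempty: "space M \<noteq> {}"
begin

definition \<alpha> :: real where "\<alpha> = 1 / r - enn2real (inverse p)"

definition \<beta> :: real where "\<beta> = enn2real (inverse p) - enn2real (inverse s)"

section \<open>The exponents and the existence of nonzero elements\<close>

lemma p_cases: obtains "p = \<infinity>" "enn2real (inverse p) = 0" "inverse p = ennreal 0"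
  | P where "p = ennreal P" "r \<le> P" "enn2real (inverse p) = 1 / P" "inverse p = ennreal (1 / P)"
proof (cases p)
  case (real P)
  then have "r \<le> P" using rp by (simp add: ennreal_le_iff)
  moreover have "inverse p = ennreal (1 / P)" using real calculation r0 by (simp add: inverse_ennreal divide_inverse)
  ultimately show ?thesis using that(2) real r0 by simp
qed (use that(1) in simp)

lemma inverse_s: "inverse s = ennreal (enn2real (inverse s))"
  using rs r0 by (cases s) (auto simp: inverse_ennreal ennreal_less_iff)

lemma inverse_p: "inverse p = ennreal (enn2real (inverse p))"
  by (rule p_cases) auto

lemma sum_exponents: "\<alpha> + \<beta> = a" by (simp add: \<alpha>_def \<beta>_def a_def)

lemma \<alpha>0: "0 \<le> \<alpha>"
  unfolding \<alpha>_def by (rule p_cases) (use r0 in \<open>auto simp: frac_le\<close>)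

lemma \<beta>0: "0 \<le> \<beta>"
proof -
  have "enn2real (inverse s) \<le> enn2real (inverse p)"
  proof (rule s_cases)
    fix S assume S: "s = ennreal S" "r < S" "enn2real (inverse s) = 1 / S"
    show ?thesis
    proof (rule p_cases)
      fix P assume P: "p = ennreal P" "r \<le> P" "enn2real (inverse p) = 1 / P"
      then have "P \<le> S" using ps S r0 by (simp add: ennreal_le_iff)
      then show ?thesis unfolding S(3) P(3) using P(2) r0 by (simp add: frac_le)
    qed (use ps S in \<open>simp add: top_unique\<close>)
  qed simp
  then show ?thesis by (simp add: \<beta>_def)
qed

lemma exponent_\<alpha>: "inverse (ennreal r) - inverse p = ennreal \<alpha>"
proof -
  have "inverse (ennreal r) = ennreal (1 / r)" using r0 by (simp add: inverse_ennreal divide_inverse)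
  then show ?thesis by (subst inverse_p) (simp add: \<alpha>_def ennreal_minus)
qed

lemma exponent_\<beta>: "inverse p - inverse s = ennreal \<beta>"
  by (subst inverse_p, subst inverse_s) (simp add: \<beta>_def ennreal_minus)

lemma \<alpha>_pos_imp: "0 < \<alpha> \<Longrightarrow> p \<noteq> ennreal r"
  using r0 by (auto simp: \<alpha>_def inverse_ennreal divide_inverse)

lemma \<beta>_pos_imp: "0 < \<beta> \<Longrightarrow> p \<noteq> s"
  by (auto simp: \<beta>_def)

lemma space_nonnull: "\<not> (AE x in M. False)"
proof
  assume *: "AE x in M. False"
  obtain x where "x \<in> space M" using nonempty by auto
  then obtain E where "E \<in> \<E>" using basis by (auto simp: set_basis_def)
  from basisD(1,2)[OF this] * show False
    by (auto simp: AE_iff_measurable[OF sets.top, of M] dest!: emeasure_mono[OF sets.sets_into_space sets.top])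
qed

lemma not_AE_0: "AE x in M. 0 < (u x :: real) \<Longrightarrow> \<not> (AE x in M. u x = 0)"
proof
  assume "AE x in M. 0 < u x" "AE x in M. u x = 0"
  then have "AE x in M. False" by eventually_elim simp
  with space_nonnull show False ..
qed

lemma nonzero_mem: obtains e where "e \<in> B" "\<not> (AE x in M. e x = 0)"
proof -
  have "0 < emeasure M (space M)"
    using space_nonnull by (auto simp: AE_iff_measurable[OF sets.top, of M] zero_less_iff_neq_zero)
  then obtain F c where F: "F \<in> sets M" "0 < emeasure M F" "0 < c" "(\<lambda>x. c * indicator F x) \<in> B"
    by (rule saturated[OF sets.top]) blast
  have "\<not> (AE x in M. c * indicator F x = 0)"
  proof
    assume "AE x in M. c * indicator F x = 0"
    then have "AE x in M. x \<notin> F" by eventually_elim (use F(3) in \<open>auto simp: indicator_def split: if_splits\<close>)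
    then show False using F(1,2) AE_iff_null_sets[OF F(1)] by (auto dest: null_setsD1)
  qed
  then show ?thesis by (rule that[OF F(4)])
qed

text \<open>The algorithm must start from a nonzero \<open>h\<close>, also when
  \<open>f = 0\<close>. The gap between the norm of \<open>f\<close> and \<open>N\<close> is
  therefore split in three: to normalize \<open>f\<close>, to mix in a nonzero member of the ball,
  and to absorb the factor \<open>1 + \<delta>\<close> of the factorization.\<close>

lemma factor_element:
  assumes f: "f \<in> carr X" and N: "nrm X f < ennreal N"
  obtains h g where "h \<in> polar M BU" "\<not> (AE x in M. h x = 0)" "g \<in> borel_measurable M" "\<And>x. 0 \<le> g x"
    "Lnorm M s g \<le> 1" "AE x in M. norm (f x) \<le> N * (h x powr a * g x)"
proof -
  obtain N' where N': "0 \<le> N'" "nrm X f = ennreal N'" using finX[OF f] by (cases "nrm X f") auto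
  then have N'N: "N' < N" using N by (simp add: ennreal_less_iff)
  define N1 where "N1 = N' + (N - N') / 3"
  define N2 where "N2 = N' + 2 * (N - N') / 3"
  have N12: "N' < N1" "N1 < N2" "N2 < N" "0 < N1" "0 < N2" "0 < N"
    using N'(1) N'N by (auto simp: N1_def N2_def field_simps)
  note [measurable] = L0_norm_meas[OF solid_spaceD(1)[OF solidX f]]
  have "(\<lambda>x. norm (f x) / N1) \<in> pball M X"
    using N12 N' by (intro pball_of_norm[OF solidX f]) (auto intro: ennreal_leI)
  also have "(\<lambda>x. norm (f x) / N1) = (\<lambda>x. ((norm (f x) / N1) powr r) powr (1 / r))"
    using N12(4) r0 by (auto simp: powr_powr)
  finally have b1: "(\<lambda>x. (norm (f x) / N1) powr r) \<in> B" unfolding B_iff by auto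
  obtain e where e: "e \<in> B" "\<not> (AE x in M. e x = 0)" by (rule nonzero_mem)
  \<comment> \<open>Then \<open>1 - t = (N1 / N2) powr r\<close>, so that
    \<open>N2 powr r * b\<close> still dominates \<open>norm f powr r\<close>.\<close>
  define t where "t = 1 - (N1 / N2) powr r"
  have "(N1 / N2) powr r < 1 powr r" using N12 r0 by (intro powr_less_mono2) auto
  then have t: "0 < t" "t \<le> 1" by (auto simp: t_def)
  define b where "b x = (1 - t) * (norm (f x) / N1) powr r + t * e x" for x
  have b: "b \<in> B" unfolding b_def using t by (intro B_convex[OF b1 e(1)]) auto
  have fb: "norm (f x) powr r \<le> N2 powr r * b x" for x
  proof -
    have "norm (f x) powr r = N2 powr r * ((1 - t) * (norm (f x) / N1) powr r)"
      using N12 by (simp add: t_def powr_divide)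
    also have "\<dots> \<le> N2 powr r * b x" unfolding b_def using t BD(2)[OF e(1), of x] by (intro mult_left_mono) auto
    finally show ?thesis .
  qed
  have bnz: "\<not> (AE x in M. b x = 0)"
  proof
    assume "AE x in M. b x = 0"
    then have "AE x in M. e x = 0"
    proof eventually_elim
      case (elim x)
      have "0 \<le> (1 - t) * (norm (f x) / N1) powr r" "0 \<le> t * e x" using t BD(2)[OF e(1), of x] by auto
      then have "t * e x = 0" using elim by (simp add: b_def add_nonneg_eq_0_iff)
      then show ?case using t by simp
    qed
    with e(2) show False ..
  qed
  \<comment> \<open>Chosen so that \<open>N2 powr r * (1 + \<delta>) = N powr r\<close>.\<close>
  define \<delta> where "\<delta> = (N / N2) powr r - 1"
  have "1 powr r < (N / N2) powr r" using N12 r0 by (intro powr_less_mono2) auto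
  then have \<delta>: "0 < \<delta>" by (simp add: \<delta>_def)
  obtain h g where hg: "h \<in> polar M BU" "g \<in> borel_measurable M" "\<And>x. 0 \<le> g x"
    "AE x in M. b x \<le> (1 + \<delta>) * (h x powr (r * a) * g x powr r)" "Lnorm M s g \<le> 1"
    by (rule factorization[OF b \<delta>]) blast
  have "AE x in M. norm (f x) \<le> N * (h x powr a * g x)"
    using hg(4)
  proof eventually_elim
    case (elim x)
    have "norm (f x) powr r \<le> N2 powr r * ((1 + \<delta>) * (h x powr (r * a) * g x powr r))"
      using fb[of x] elim by (meson mult_left_mono order_trans powr_ge_zero)
    also have "\<dots> = (N * (h x powr a * g x)) powr r"
      using N12 hg(3) by (simp add: \<delta>_def powr_mult powr_divide powr_powr mult.commute)
    finally have le: "norm (f x) powr r \<le> (N * (h x powr a * g x)) powr r" .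
    have "0 \<le> N * (h x powr a * g x)" using N12(6) hg(3)[of x] by simp
    with le show ?case using r0 powr_less_mono2[of r "N * (h x powr a * g x)" "norm (f x)"] by (meson not_less)
  qed
  moreover have "\<not> (AE x in M. h x = 0)"
  proof
    assume "AE x in M. h x = 0"
    with hg(4) have "AE x in M. b x = 0"
      by eventually_elim (use BD(2)[OF b] in \<open>simp add: antisym\<close>)
    with bnz show False ..
  qed
  ultimately show ?thesis using hg by (intro that[of h g]) auto
qed

text \<open>Majorant and pairing bound are promised only for \<open>0 < \<alpha>\<close>. At
  \<open>\<alpha> = 0\<close> the constant 1 is returned, and the last equation reads
  \<open>1 = 1\<close> since \<open>epow\<close> with exponent 0 is 1.\<close>

lemma A1_majorant_Y:
  assumes h: "h \<in> polar M BU" "\<not> (AE x in M. h x = 0)"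
  obtains h' \<kappa> where "h' \<in> borel_measurable M" "\<And>x. 0 \<le> h' x" "AE x in M. 0 < h' x" "A1 \<kappa> h'" "0 \<le> \<kappa>"
    "0 < \<alpha> \<Longrightarrow> AE x in M. h x \<le> h' x" "\<And>u. 0 < \<alpha> \<Longrightarrow> u \<in> BU \<Longrightarrow> (\<integral>\<^sup>+x. ennreal (u x * h' x) \<partial>M) \<le> 2"
    "\<kappa> powr \<alpha> = 2 powr \<alpha> * enn2real (epow (maximal_norm M \<E> (space_rs M r s X)) \<alpha>)"
proof (cases "\<alpha> = 0")
  case True
  then show ?thesis using A1_const by (intro that[of "\<lambda>x. 1" 1]) (auto simp: epow_def)
next
  case False
  then have \<alpha>: "0 < \<alpha>" using \<alpha>0 by simp
  have bd: "maximal_bounded M \<E> (kdual M U)" using bdd[OF \<alpha>_pos_imp[OF \<alpha>]] by (simp add: space_rs_eq)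
  obtain u where u: "u \<in> BU" "AE x in M. 0 < u x" by (rule BU_unit)
  have hY: "h \<in> pball M (kdual M U)" using h(1) by (simp add: pballY)
  obtain h' where h': "h' \<in> borel_measurable M" "\<And>x. 0 \<le> h' x" "AE x in M. 0 < h' x" "AE x in M. h x \<le> h' x"
    "\<And>u. u \<in> BU \<Longrightarrow> (\<integral>\<^sup>+x. ennreal (u x * h' x) \<partial>M) \<le> 2" "A1 (2 * enn2real (maximal_norm M \<E> (kdual M U))) h'"
  proof (rule rubio_de_francia[OF bd, where P = BU and ?u0.0 = u and ?h0.0 = h])
    show "(\<integral>\<^sup>+x. ennreal (v x * H x) \<partial>M) \<le> ennreal N"
      if "\<And>x. 0 \<le> H x" "emb H \<in> carr (kdual M U)" "nrm (kdual M U) (emb H) \<le> ennreal N" "v \<in> BU" for H v N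
      using kdual_pairing_le[OF solidU solid_spaceD(1)[OF solidY that(2)] that(3) that(4)[unfolded BU_def]] that(1)
      by (simp add: mult.commute)
  qed (use u h pballD[OF hY] not_AE_0[OF u(2)] in \<open>auto simp: carr_kdual BU_iff\<close>)
  have "maximal_norm M \<E> (kdual M U) = ennreal (enn2real (maximal_norm M \<E> (kdual M U)))"
    using bd by (simp add: maximal_bounded_def less_top)
  then have "enn2real (epow (maximal_norm M \<E> (kdual M U)) \<alpha>) = enn2real (maximal_norm M \<E> (kdual M U)) powr \<alpha>"
    using \<alpha> by (metis enn2real_ennreal enn2real_nonneg epow_ennreal powr_ge_zero)
  then show ?thesis using h'
    by (intro that[of h' "2 * enn2real (maximal_norm M \<E> (kdual M U))"]) (auto simp: powr_mult space_rs_eq)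
qed

text \<open>The same in the associate of \<open>X\<^sub>r\<^sub>,\<^sub>s\<close>, tested against
  the unit ball of \<open>X\<^sub>r\<^sub>,\<^sub>s\<close>. The function \<open>h\<close> enters
  only as a nonzero test function.\<close>

lemma A1_majorant_Y':
  assumes k: "k \<in> BU" "\<not> (AE x in M. k x = 0)" and h: "h \<in> polar M BU" "\<not> (AE x in M. h x = 0)"
  obtains k' \<kappa> where "k' \<in> borel_measurable M" "\<And>x. 0 \<le> k' x" "AE x in M. 0 < k' x" "A1 \<kappa> k'" "0 \<le> \<kappa>"
    "0 < \<beta> \<Longrightarrow> AE x in M. k x \<le> k' x" "\<And>v. 0 < \<beta> \<Longrightarrow> v \<in> polar M BU \<Longrightarrow> (\<integral>\<^sup>+x. ennreal (v x * k' x) \<partial>M) \<le> 2"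
    "\<kappa> powr \<beta> = 2 powr \<beta> * enn2real (epow (maximal_norm M \<E> (kdual M (space_rs M r s X))) \<beta>)"
proof (cases "\<beta> = 0")
  case True
  then show ?thesis using A1_const by (intro that[of "\<lambda>x. 1" 1]) (auto simp: epow_def)
next
  case False
  then have \<beta>: "0 < \<beta>" using \<beta>0 by simp
  let ?Z = "kdual M (kdual M U)"
  have bd: "maximal_bounded M \<E> ?Z" using bdd'[OF \<beta>_pos_imp[OF \<beta>]] by (simp add: space_rs_eq)
  obtain k' where k': "k' \<in> borel_measurable M" "\<And>x. 0 \<le> k' x" "AE x in M. 0 < k' x" "AE x in M. k x \<le> k' x"
    "\<And>v. v \<in> polar M BU \<Longrightarrow> (\<integral>\<^sup>+x. ennreal (v x * k' x) \<partial>M) \<le> 2" "A1 (2 * enn2real (maximal_norm M \<E> ?Z)) k'"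
  proof (rule rubio_de_francia[OF bd, where P = "polar M BU" and ?u0.0 = h and ?h0.0 = k])
    show "(\<integral>\<^sup>+x. ennreal (v x * H x) \<partial>M) \<le> ennreal N"
      if "\<And>x. 0 \<le> H x" "emb H \<in> carr ?Z" "nrm ?Z (emb H) \<le> ennreal N" "v \<in> polar M BU" for H v N
    proof -
      have "(emb H :: 'a \<Rightarrow> 'k) \<in> L0 M" using that(2) by (simp add: carr_kdual[of M "kdual M U"])
      from kdual_pairing_le[OF solidY this that(3) that(4)[folded pballY]] that(1)
      show ?thesis by (simp add: mult.commute)
    qed
    show "carr ?Z \<subseteq> L0 M" by (auto simp: carr_kdual[of M "kdual M U"])
  qed (use k h BU_in_Y'[OF k(1)] polarD[OF h(1)] in \<open>auto simp: BU_iff polar_def\<close>)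
  have "maximal_norm M \<E> ?Z = ennreal (enn2real (maximal_norm M \<E> ?Z))"
    using bd by (simp add: maximal_bounded_def less_top)
  then have "enn2real (epow (maximal_norm M \<E> ?Z) \<beta>) = enn2real (maximal_norm M \<E> ?Z) powr \<beta>"
    using \<beta> by (metis enn2real_ennreal enn2real_nonneg epow_ennreal powr_ge_zero)
  then show ?thesis using k'
    by (intro that[of k' "2 * enn2real (maximal_norm M \<E> ?Z)"]) (auto simp: powr_mult space_rs_eq)
qed


text \<open>Hoelder's inequality for \<open>H\<close> in \<open>L^1\<close> and \<open>g\<close> in
  \<open>L^s\<close>, with weights \<open>P * \<beta> + P / s = 1\<close>. The bound 2 on the
  integral of \<open>H\<close> contributes \<open>2 powr \<beta>\<close>.\<close>

lemma weighted_norm_le: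
  assumes [measurable]: "H \<in> borel_measurable M" "g \<in> borel_measurable M" "F \<in> borel_measurable M"
    and nn: "\<And>x. 0 \<le> H x" "\<And>x. 0 \<le> g x" and N: "0 < N"
    and H: "0 < \<beta> \<Longrightarrow> (\<integral>\<^sup>+x. ennreal (H x) \<partial>M) \<le> 2" and g: "Lnorm M s g \<le> 1"
    and F: "AE x in M. \<bar>F x\<bar> \<le> N * (H x powr \<beta> * g x)"
  shows "Lnorm M p F \<le> ennreal (2 powr \<beta> * N)"
proof -
  define \<sigma> where "\<sigma> = enn2real (inverse s)"
  define k where "k x = (if s = \<infinity> then 1 else g x powr enn2real s)" for x
  have k0: "0 \<le> k x" for x by (simp add: k_def)
  have [measurable]: "k \<in> borel_measurable M" unfolding k_def by measurable
  have gk: "AE x in M. g x \<le> k x powr \<sigma>"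
  proof (rule s_cases)
    assume s: "s = \<infinity>" "enn2real (inverse s) = 0"
    have "AE x in M. ennreal (norm (g x)) \<le> esssup M (\<lambda>x. ennreal (norm (g x)))" by (rule esssup_AE)
    then show ?thesis
    proof eventually_elim
      case (elim x)
      have "ennreal (norm (g x)) \<le> 1" using order_trans[OF elim, of 1] g s by (simp add: Lnorm_def)
      then show ?case using nn(2)[of x] s by (simp add: k_def \<sigma>_def)
    qed
  next
    fix S assume "s = ennreal S" "r < S" "enn2real (inverse s) = 1 / S"
    then show ?thesis using r0 nn(2) by (intro AE_I2) (simp add: k_def \<sigma>_def powr_powr)
  qed
  have ks: "(\<integral>\<^sup>+x. ennreal (k x) \<partial>M) \<le> 1" if "0 < \<sigma>"
  proof (rule s_cases)
    fix S assume S: "s = ennreal S" "r < S" "enn2real (inverse s) = 1 / S"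
    then show ?thesis using g r0 nn(2) by (simp add: Lnorm_def k_def epow_ennreal epow_le_1_iff)
  qed (use that in \<open>simp add: \<sigma>_def\<close>)
  have \<sigma>0: "0 \<le> \<sigma>" by (simp add: \<sigma>_def)
  show ?thesis
  proof (rule p_cases)
    assume p: "p = \<infinity>" "enn2real (inverse p) = 0"
    \<comment> \<open>With \<open>1/p = 0\<close> the nonnegative numbers \<beta> and \<sigma>
      satisfy \<open>\<beta> = - \<sigma>\<close>, so both vanish and a pointwise bound
      remains.\<close>
    then have b0: "\<beta> = 0" "\<sigma> = 0" using \<beta>0 \<sigma>0 unfolding \<beta>_def \<sigma>_def p(2) by auto
    have "AE x in M. ennreal (norm (F x)) \<le> ennreal N"
      using F gk
    proof eventually_elim
      case (elim x)
      have "g x \<le> 1" using elim(2) b0 by (auto split: if_splits)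
      then have "H x powr \<beta> * g x \<le> 1 * 1" using b0 nn(2) by (intro mult_mono) auto
      then have "N * (H x powr \<beta> * g x) \<le> N * 1" using N by (intro mult_left_mono) auto
      then show ?case using elim by (intro ennreal_leI) simp
    qed
    then have "esssup M (\<lambda>x. ennreal (norm (F x))) \<le> ennreal N" by (intro esssup_I) auto
    then show ?thesis using p b0 by (simp add: Lnorm_def)
  next
    fix P assume p: "p = ennreal P" "r \<le> P" "enn2real (inverse p) = 1 / P"
    have P: "0 < P" using p r0 by simp
    define \<theta> where "\<theta> i = (if i then P * \<beta> else P * \<sigma>)" for i :: bool
    define A where "A i = (if i then H else k)" for i :: bool
    define c where "c i = (if i then 2 else 1 :: real)" for i :: bool
    have "\<beta> + \<sigma> = 1 / P" unfolding \<beta>_def \<sigma>_def p(3) by simp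
    then have th1: "P * \<beta> + P * \<sigma> = 1" using P by (simp flip: distrib_left)
    have "(\<integral>\<^sup>+x. ennreal (\<Prod>i\<in>UNIV. A i x powr \<theta> i) \<partial>M) \<le> ennreal (\<Prod>i\<in>UNIV. c i powr \<theta> i)"
    proof (rule nn_integral_prod_powr_le)
      show "(\<integral>\<^sup>+x. ennreal (A i x) \<partial>M) \<le> ennreal (c i)" if "0 < \<theta> i" for i
        using that H ks P by (cases i) (auto simp: A_def c_def \<theta>_def zero_less_mult_iff)
    qed (use th1 P \<beta>0 \<sigma>0 nn k0 in \<open>auto simp: \<theta>_def A_def c_def UNIV_bool\<close>)
    then have int: "(\<integral>\<^sup>+x. ennreal (H x powr (P * \<beta>) * k x powr (P * \<sigma>)) \<partial>M) \<le> ennreal (2 powr (P * \<beta>))"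
      by (simp add: UNIV_bool A_def c_def \<theta>_def mult.commute)
    have "(\<integral>\<^sup>+x. epow (ennreal (norm (F x))) P \<partial>M)
      \<le> (\<integral>\<^sup>+x. ennreal (N powr P) * ennreal (H x powr (P * \<beta>) * k x powr (P * \<sigma>)) \<partial>M)"
    proof (intro nn_integral_mono_AE)
      show "AE x in M. epow (ennreal (norm (F x))) P
        \<le> ennreal (N powr P) * ennreal (H x powr (P * \<beta>) * k x powr (P * \<sigma>))"
        using F gk
      proof eventually_elim
        case (elim x)
        have "\<bar>F x\<bar> \<le> N * (H x powr \<beta> * k x powr \<sigma>)"
          using elim N by (intro order_trans[OF elim(1)] mult_left_mono) auto
        then have "\<bar>F x\<bar> powr P \<le> (N * (H x powr \<beta> * k x powr \<sigma>)) powr P"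
          using P by (intro powr_mono2) auto
        also have "\<dots> = N powr P * (H x powr (P * \<beta>) * k x powr (P * \<sigma>))"
          by (simp add: powr_mult powr_powr mult.commute)
        finally show ?case using P by (simp add: epow_ennreal ennreal_leI flip: ennreal_mult')
      qed
    qed
    also have "\<dots> \<le> ennreal (N powr P) * ennreal (2 powr (P * \<beta>))"
      by (subst nn_integral_cmult) (auto intro: mult_left_mono int)
    also have "\<dots> = ennreal ((N * 2 powr \<beta>) powr P)"
      by (simp add: powr_mult powr_powr mult.commute flip: ennreal_mult')
    finally have "epow (\<integral>\<^sup>+x. epow (ennreal (norm (F x))) P \<partial>M) (1 / P) \<le> epow (ennreal ((N * 2 powr \<beta>) powr P)) (1 / P)"
      using P by (intro epow_mono) auto
    also have "\<dots> = ennreal (2 powr \<beta> * N)"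
      using P N by (simp add: epow_ennreal powr_powr mult.commute)
    finally show ?thesis using P unfolding p(1) by (simp add: Lnorm_def)
  qed
qed

text \<open>From \<open>h0 \<le> h\<close> comes
  \<open>w * h0 powr a \<le> (h0 * k) powr \<beta>\<close>, and from \<open>k0 \<le> k\<close> comes
  \<open>u powr (1/r) = k0 powr a \<le> w * (h * k0) powr \<alpha>\<close>. Each product pairs one
  majorant with one original function, hence integrates to at most 2, and \<open>A\<close> is
  \<open>h * k0\<close>.\<close>

lemma weight_exists:
  assumes f: "f \<in> carr X" and N: "nrm X f < ennreal N"
    and u: "u \<in> polar M B" and unz: "\<not> (AE x in M. u x = 0)"
  obtains w A where "w \<in> Ap M \<E> p r s" "Ap_const M \<E> p r s w \<le> ennreal (extrap_const M \<E> p r s X)"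
    "wLnorm M p w f \<le> ennreal (2 powr \<beta> * N)" "A \<in> borel_measurable M" "\<And>x. 0 \<le> A x"
    "0 < \<alpha> \<Longrightarrow> (\<integral>\<^sup>+x. ennreal (A x) \<partial>M) \<le> 2" "\<And>x. 0 \<le> w x"
    "AE x in M. u x powr (1 / r) \<le> w x * A x powr \<alpha>"
proof -
  note [measurable] = L0_norm_meas[OF solid_spaceD(1)[OF solidX f]] polarD(1)[OF u]
  have N0: "0 < N" using le_less_trans[OF zero_le N] by simp
  obtain h0 g where h0: "h0 \<in> polar M BU" "\<not> (AE x in M. h0 x = 0)" and g [measurable]: "g \<in> borel_measurable M"
    and g0: "\<And>x. 0 \<le> g x" and gs: "Lnorm M s g \<le> 1" and fhg: "AE x in M. norm (f x) \<le> N * (h0 x powr a * g x)"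
    by (rule factor_element[OF f N]) blast
  \<comment> \<open>The root that turns a member \<open>u\<close> of the polar of \<open>B\<close>
    into one of the ball of \<open>U\<close>.\<close>
  define k0 where "k0 x = u x powr (1 / (r * a))" for x
  have k0n: "0 \<le> k0 x" for x by (simp add: k0_def)
  have k0m [measurable]: "k0 \<in> borel_measurable M" unfolding k0_def by measurable
  have k0u: "k0 x powr (r * a) = u x" "k0 x powr a = u x powr (1 / r)" for x
    using polarD(2)[OF u, of x] r0 a0 by (simp_all add: k0_def powr_powr)
  have k0: "k0 \<in> BU" using u k0n by (simp add: BU_iff k0u)
  have k0nz: "\<not> (AE x in M. k0 x = 0)"
  proof
    assume "AE x in M. k0 x = 0"
    then have "AE x in M. u x = 0" by eventually_elim (simp add: k0_def)
    with unz show False ..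
  qed
  obtain h \<kappa> where h [measurable]: "h \<in> borel_measurable M" and hn: "\<And>x. 0 \<le> h x" and hp: "AE x in M. 0 < h x"
    and hA: "A1 \<kappa> h" "0 \<le> \<kappa>" and hh0: "0 < \<alpha> \<Longrightarrow> AE x in M. h0 x \<le> h x"
    and hU: "\<And>v. 0 < \<alpha> \<Longrightarrow> v \<in> BU \<Longrightarrow> (\<integral>\<^sup>+x. ennreal (v x * h x) \<partial>M) \<le> 2"
    and \<kappa>: "\<kappa> powr \<alpha> = 2 powr \<alpha> * enn2real (epow (maximal_norm M \<E> (space_rs M r s X)) \<alpha>)"
    by (rule A1_majorant_Y[OF h0]) blast
  obtain k \<kappa>' where k [measurable]: "k \<in> borel_measurable M" and kn: "\<And>x. 0 \<le> k x" and kp: "AE x in M. 0 < k x"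
    and kA: "A1 \<kappa>' k" "0 \<le> \<kappa>'" and kk0: "0 < \<beta> \<Longrightarrow> AE x in M. k0 x \<le> k x"
    and kU: "\<And>v. 0 < \<beta> \<Longrightarrow> v \<in> polar M BU \<Longrightarrow> (\<integral>\<^sup>+x. ennreal (v x * k x) \<partial>M) \<le> 2"
    and \<kappa>': "\<kappa>' powr \<beta> = 2 powr \<beta> * enn2real (epow (maximal_norm M \<E> (kdual M (space_rs M r s X))) \<beta>)"
    by (rule A1_majorant_Y'[OF k0 k0nz h0]) blast
  note [measurable] = polarD(1)[OF h0(1)]
  note h0n = polarD(2)[OF h0(1)]
  define w where "w x = h x powr (- \<alpha>) * k x powr \<beta>" for x
  have w_eq: "w = (\<lambda>x. h x powr (- \<alpha>) * k x powr \<beta>)" by (simp add: w_def[abs_def])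
  note Ap = Ap_of_A1[OF h k hn kn hp kp hA(1) kA(1) hA(2) kA(2) \<alpha>0 exponent_\<alpha> \<beta>0 exponent_\<beta>, folded w_eq]
  have [measurable]: "w \<in> borel_measurable M" unfolding w_def by measurable
  have w0: "0 \<le> w x" for x by (simp add: w_def)
  have "\<kappa> powr \<alpha> * \<kappa>' powr \<beta> = extrap_const M \<E> p r s X"
  proof -
    have "(2::real) powr (1 / r - enn2real (inverse s)) = 2 powr \<alpha> * 2 powr \<beta>"
      by (simp add: \<alpha>_def \<beta>_def flip: powr_add)
    then show ?thesis unfolding \<kappa> \<kappa>' by (simp add: extrap_const_def \<alpha>_def \<beta>_def mult_ac)
  qed
  with Ap(2) have c: "Ap_const M \<E> p r s w \<le> ennreal (extrap_const M \<E> p r s X)" by simp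
  have hh0': "AE x in M. h0 x powr \<alpha> \<le> h x powr \<alpha>"
  proof (cases "\<alpha> = 0")
    case True
    then show ?thesis using hp by (auto elim!: eventually_mono)
  next
    case False
    then have "AE x in M. h0 x \<le> h x" using hh0 \<alpha>0 by simp
    then show ?thesis by eventually_elim (use h0n \<alpha>0 in \<open>auto intro: powr_mono2\<close>)
  qed
  have kk0': "AE x in M. k0 x powr \<beta> \<le> k x powr \<beta>"
  proof (cases "\<beta> = 0")
    case True
    then show ?thesis using kp by (auto elim!: eventually_mono)
  next
    case False
    then have "AE x in M. k0 x \<le> k x" using kk0 \<beta>0 by simp
    then show ?thesis by eventually_elim (use k0n \<beta>0 in \<open>auto intro: powr_mono2\<close>)
  qed
  have "Lnorm M p (\<lambda>x. w x * norm (f x)) \<le> ennreal (2 powr \<beta> * N)"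
  proof (rule weighted_norm_le[where H = "\<lambda>x. h0 x * k x" and g = g])
    show "(\<integral>\<^sup>+x. ennreal (h0 x * k x) \<partial>M) \<le> 2" if "0 < \<beta>" by (rule kU[OF that h0(1)])
    show "AE x in M. \<bar>w x * norm (f x)\<bar> \<le> N * ((h0 x * k x) powr \<beta> * g x)"
      using fhg hp hh0'
    proof eventually_elim
      case (elim x)
      have "w x * norm (f x) \<le> w x * (N * (h0 x powr a * g x))" using elim(1) w0 by (rule mult_left_mono)
      also have "\<dots> = (h0 x powr \<alpha> / h x powr \<alpha>) * (N * ((h0 x * k x) powr \<beta> * g x))"
        unfolding sum_exponents[symmetric] by (simp add: w_def powr_add powr_mult powr_minus field_simps)
      also have "\<dots> \<le> 1 * (N * ((h0 x * k x) powr \<beta> * g x))"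
        using elim(2,3) N0 g0[of x] by (intro mult_right_mono) auto
      finally show ?case using w0[of x] by (simp add: abs_mult)
    qed
  qed (use h0n kn g0 gs N0 in auto)
  moreover have "wLnorm M p w f = Lnorm M p (\<lambda>x. w x * norm (f x))"
    using w0 by (simp add: wLnorm_def Lnorm_def)
  ultimately have wn: "wLnorm M p w f \<le> ennreal (2 powr \<beta> * N)" by simp
  have uw: "AE x in M. u x powr (1 / r) \<le> w x * (h x * k0 x) powr \<alpha>"
    using kk0' hp
  proof eventually_elim
    case (elim x)
    have "u x powr (1 / r) = k0 x powr \<alpha> * k0 x powr \<beta>"
      unfolding k0u(2)[symmetric] sum_exponents[symmetric] by (rule powr_add)
    also have "\<dots> \<le> k0 x powr \<alpha> * k x powr \<beta>" using elim by (intro mult_left_mono) auto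
    also have "\<dots> = w x * (h x * k0 x) powr \<alpha>"
      using elim(2) by (simp add: w_def powr_mult powr_minus)
    finally show ?case .
  qed
  show ?thesis
  proof (rule that[of w "\<lambda>x. h x * k0 x"])
    show "(\<integral>\<^sup>+x. ennreal (h x * k0 x) \<partial>M) \<le> 2" if "0 < \<alpha>"
      using hU[OF that k0] by (simp add: mult.commute)
  qed (use Ap(1) c wn uw hn k0n w0 in auto)
qed

end

section \<open>Extrapolation\<close>

text \<open>Monotonicity is given one variable at a time, so the coordinates are exchanged
  successively, by induction on the set of those already exchanged.\<close>

lemma increasing_nonneg_mono:
  fixes \<phi> :: "('m::finite \<Rightarrow> real) \<Rightarrow> real"
  assumes \<phi>: "increasing_nonneg \<phi>" and x: "\<And>j. 0 \<le> x j" and xy: "\<And>j. x j \<le> y j"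
  shows "\<phi> x \<le> \<phi> y"
proof -
  have "\<phi> x \<le> \<phi> (\<lambda>j. if j \<in> A then y j else x j)" if "finite A" for A
    using that
  proof (induction A)
    case empty
    then show ?case by simp
  next
    case (insert i A)
    let ?z = "\<lambda>j. if j \<in> A then y j else x j"
    have z: "\<forall>j. 0 \<le> ?z j" using x order_trans[OF x xy] by simp
    have m: "mono_on {0..} (\<lambda>t. \<phi> (?z(i := t)))"
      using \<phi>[unfolded increasing_nonneg_def, THEN spec, THEN mp, OF z] by (rule conjunct2[THEN spec])
    have xi: "x i \<in> {0..}" "y i \<in> {0..}" using x[of i] xy[of i] by auto
    have "\<phi> (?z(i := x i)) \<le> \<phi> (?z(i := y i))"
      by (rule mono_onD[OF m xi xy[of i]])
    also have "?z(i := x i) = ?z" using insert.hyps by auto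
    also have "?z(i := y i) = (\<lambda>j. if j \<in> insert i A then y j else x j)" by auto
    finally show ?case using insert.IH by linarith
  qed
  from this[of UNIV] show ?thesis by simp
qed

text \<open>Hoelder's inequality with one extra factor: the index type is enlarged to
  \<open>'m option\<close>, with \<open>None\<close> for \<open>G\<close>. For
  \<open>p = \<infinity>\<close> that factor is bounded pointwise and taken out.\<close>

lemma nn_integral_powr_prod_le:
  fixes G :: "'a \<Rightarrow> real" and A :: "'m::finite \<Rightarrow> 'a \<Rightarrow> real"
  assumes [measurable]: "G \<in> borel_measurable M" "\<And>j. A j \<in> borel_measurable M"
    and nn: "\<And>x. 0 \<le> G x" "\<And>j x. 0 \<le> A j x"
    and G: "Lnorm M p G \<le> ennreal \<gamma>" and \<gamma>: "0 < \<gamma>" and p: "p \<noteq> 0" and q: "0 < q"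
    and \<tau>: "\<And>j. 0 \<le> \<tau> j" "q * enn2real (inverse p) + (\<Sum>j\<in>UNIV. \<tau> j) = 1"
    and A: "\<And>j. 0 < \<tau> j \<Longrightarrow> (\<integral>\<^sup>+x. ennreal (A j x) \<partial>M) \<le> 2"
  shows "(\<integral>\<^sup>+x. ennreal (G x powr q * (\<Prod>j\<in>UNIV. A j x powr \<tau> j)) \<partial>M)
     \<le> ennreal (\<gamma> powr q * (\<Prod>j\<in>UNIV. 2 powr \<tau> j))"
proof (cases p)
  case top
  have "AE x in M. ennreal (norm (G x)) \<le> esssup M (\<lambda>x. ennreal (norm (G x)))" by (rule esssup_AE)
  then have "AE x in M. G x \<le> \<gamma>"
  proof eventually_elim
    case (elim x)
    have "ennreal (norm (G x)) \<le> ennreal \<gamma>" using order_trans[OF elim, of "ennreal \<gamma>"] G top by (simp add: Lnorm_def)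
    then show ?case using nn(1)[of x] \<gamma> by (simp add: ennreal_le_iff)
  qed
  then have "(\<integral>\<^sup>+x. ennreal (G x powr q * (\<Prod>j\<in>UNIV. A j x powr \<tau> j)) \<partial>M)
      \<le> (\<integral>\<^sup>+x. ennreal (\<gamma> powr q) * ennreal (\<Prod>j\<in>UNIV. A j x powr \<tau> j) \<partial>M)"
  proof (intro nn_integral_mono_AE, eventually_elim)
    case (elim x)
    then have "G x powr q \<le> \<gamma> powr q" using nn(1)[of x] q by (intro powr_mono2) auto
    then show ?case by (simp add: ennreal_leI mult_right_mono prod_nonneg flip: ennreal_mult')
  qed
  also have "\<dots> = ennreal (\<gamma> powr q) * (\<integral>\<^sup>+x. ennreal (\<Prod>j\<in>UNIV. A j x powr \<tau> j) \<partial>M)"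
    by (simp add: nn_integral_cmult)
  also have "\<dots> \<le> ennreal (\<gamma> powr q) * ennreal (\<Prod>j\<in>(UNIV::'m set). 2 powr \<tau> j)"
  proof (intro mult_left_mono)
    show "(\<integral>\<^sup>+x. ennreal (\<Prod>j\<in>UNIV. A j x powr \<tau> j) \<partial>M) \<le> ennreal (\<Prod>j\<in>(UNIV::'m set). 2 powr \<tau> j)"
      using \<tau> top nn(2) A by (intro nn_integral_prod_powr_le) auto
  qed simp
  finally show ?thesis by (simp add: ennreal_mult')
next
  case (real P)
  then have P: "0 < P" "p = ennreal P" using p by (auto simp: ennreal_eq_0_iff not_le)
  have inv: "enn2real (inverse p) = 1 / P" using P by (simp add: inverse_ennreal divide_inverse)
  define \<theta> where "\<theta> i = (case i of None \<Rightarrow> q / P | Some j \<Rightarrow> \<tau> j)" for i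
  define A' where "A' i = (case i of None \<Rightarrow> (\<lambda>x. G x powr P) | Some j \<Rightarrow> A j)" for i
  define c where "c i = (case i of None \<Rightarrow> \<gamma> powr P | Some (j::'m) \<Rightarrow> 2)" for i
  have prod_opt: "(\<Prod>i\<in>UNIV. F i) = F None * (\<Prod>j\<in>UNIV. F (Some j))" for F :: "'m option \<Rightarrow> real"
    by (simp add: UNIV_option_conv prod.reindex)
  have sum_opt: "(\<Sum>i\<in>UNIV. F i) = F None + (\<Sum>j\<in>UNIV. F (Some j))" for F :: "'m option \<Rightarrow> real"
    by (simp add: UNIV_option_conv sum.reindex)
  have GP: "(\<integral>\<^sup>+x. ennreal (G x powr P) \<partial>M) \<le> ennreal (\<gamma> powr P)"
  proof -
    have "epow (\<integral>\<^sup>+x. ennreal (G x powr P) \<partial>M) (1 / P) \<le> ennreal \<gamma>"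
      using G P nn(1) by (simp add: Lnorm_def epow_ennreal)
    then have "epow (epow (\<integral>\<^sup>+x. ennreal (G x powr P) \<partial>M) (1 / P)) P \<le> epow (ennreal \<gamma>) P"
      using P by (intro epow_mono) auto
    moreover have "epow (epow y (1 / P)) P = y" for y
      using P by (cases y) (auto simp: epow_ennreal powr_powr epow_def)
    ultimately show ?thesis using P \<gamma> by (simp add: epow_ennreal)
  qed
  have "(\<integral>\<^sup>+x. ennreal (\<Prod>i\<in>UNIV. A' i x powr \<theta> i) \<partial>M) \<le> ennreal (\<Prod>i\<in>UNIV. c i powr \<theta> i)"
  proof (rule nn_integral_prod_powr_le)
    show "(\<Sum>i\<in>UNIV. \<theta> i) = 1" using \<tau>(2) by (simp add: sum_opt \<theta>_def inv)
    show "A' i \<in> borel_measurable M" for i by (cases i) (simp_all add: A'_def)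
    show "(\<integral>\<^sup>+x. ennreal (A' i x) \<partial>M) \<le> ennreal (c i)" if "0 < \<theta> i" for i
      using GP A that by (cases i) (simp_all add: A'_def c_def \<theta>_def)
    show "0 \<le> \<theta> i" "0 \<le> A' i x" "0 < c i" for i x
      using q P \<tau>(1) nn \<gamma> by (cases i; simp add: \<theta>_def A'_def c_def)+
  qed simp
  then show ?thesis using P q by (simp add: prod_opt A'_def \<theta>_def c_def powr_powr)
qed

lemma space_prodI:
  fixes X :: "'m::finite \<Rightarrow> ('a, 'k::{real_normed_field,second_countable_topology}) fspace"
  assumes "F \<in> L0 M" "\<And>j. emb (g j) \<in> carr (X j)" "\<And>j. AE x in M. 0 \<le> g j x"
    and "AE x in M. norm (F x) \<le> (\<Prod>j\<in>UNIV. g j x)"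
  shows "F \<in> carr (space_prod M X)" "nrm (space_prod M X) F \<le> (\<Prod>j\<in>UNIV. nrm (X j) (emb (g j)))"
proof -
  define dom where "dom = {g :: 'm \<Rightarrow> 'a \<Rightarrow> real. (\<forall>j. emb (g j) \<in> carr (X j) \<and> (AE x in M. 0 \<le> g j x)) \<and>
                   (AE x in M. norm (F x) \<le> (\<Prod>j\<in>UNIV. g j x))}"
  have g: "g \<in> dom" using assms by (simp add: dom_def)
  have "F \<in> carr (space_prod M X) \<longleftrightarrow> dom \<noteq> {}"
    using assms(1) by (simp add: space_prod_def dom_def)
  then show "F \<in> carr (space_prod M X)" using g by blast
  have "nrm (space_prod M X) F = (INF g\<in>dom. \<Prod>j\<in>UNIV. nrm (X j) (emb (g j)))"
    by (simp add: space_prod_def dom_def)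
  also have "\<dots> \<le> (\<Prod>j\<in>UNIV. nrm (X j) (emb (g j)))" by (rule INF_lower[OF g])
  finally show "nrm (space_prod M X) F \<le> (\<Prod>j\<in>UNIV. nrm (X j) (emb (g j)))" .
qed

text \<open>Lozanovskii's factorization of \<open>(norm F / K) powr q\<close> over the polars, with
  weights \<open>q / r j\<close>. Each factor is bounded on a polar, so by the bipolar theorem it is
  a multiple of a member of the ball of \<open>X\<^sub>j\<^sup>r\<close>, and its root lies in
  \<open>X j\<close>.\<close>

lemma space_prod_memI:
  fixes X :: "'m::finite \<Rightarrow> ('a, 'k::{real_normed_field,second_countable_topology}) fspace"
  assumes cc: "\<And>j. convex_concave_space M (X j) (r j) (s j)"
    and q: "1 / q = (\<Sum>j\<in>UNIV. 1 / r j)" and F: "F \<in> L0 M" and K: "0 < K"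
    and le: "\<And>u. (\<And>j. u j \<in> polar M (convex_concave_space.B M (X j) (r j))) \<Longrightarrow>
       (\<And>j. AE x in M. 0 < u j x) \<Longrightarrow>
       (\<integral>\<^sup>+x. ennreal (norm (F x) powr q * (\<Prod>j\<in>UNIV. u j x powr (q / r j))) \<partial>M) \<le> ennreal (K powr q)"
  shows "F \<in> carr (space_prod M X)" "nrm (space_prod M X) F \<le> ennreal K"
proof -
  note sf = convex_concave_space.sf[OF cc] and r0 = convex_concave_space.r0[OF cc]
  note ball = convex_concave_space.ball[OF cc]
  define B where "B j = convex_concave_space.B M (X j) (r j)" for j
  have Bm: "b \<in> borel_measurable M" and Bn: "0 \<le> b x" if "b \<in> B j" for b j x
    using solid_ball.meas[OF ball[of j]] solid_ball.nonneg[OF ball[of j]] that by (auto simp: B_def)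
  have "0 < 1 / q" unfolding q using r0 by (intro sum_pos) auto
  then have q0: "0 < q" by simp
  have Fm [measurable]: "(\<lambda>x. norm (F x)) \<in> borel_measurable M" by (rule L0_norm_meas[OF F])
  define F' where "F' x = (norm (F x) / K) powr q" for x
  define \<theta> where "\<theta> j = q / r j" for j
  define n where "n = CARD('m)"
  have n: "0 < n" by (simp add: n_def)
  interpret L: lozanovskii M "\<lambda>j. polar M (B j)" \<theta> F'
  proof (intro lozanovskii.intro)
    show "sigma_finite_measure M" by (rule sf)
    show "0 < \<theta> j" for j using q0 r0 by (simp add: \<theta>_def)
    have "(\<Sum>j\<in>UNIV. \<theta> j) = q * (\<Sum>j\<in>UNIV. 1 / r j)" by (simp add: \<theta>_def sum_distrib_left)
    then show "(\<Sum>j\<in>UNIV. \<theta> j) = 1" unfolding q[symmetric] using q0 by simp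
    show "b \<in> borel_measurable M" if "b \<in> polar M (B j)" for b j by (rule polarD(1)[OF that])
    show "0 \<le> b x" if "b \<in> polar M (B j)" for b j x by (rule polarD(2)[OF that])
    show "(\<lambda>x. (1 - t) * b x + t * c x) \<in> polar M (B j)"
      if "b \<in> polar M (B j)" "c \<in> polar M (B j)" "0 \<le> t" "t \<le> 1" for b c j t
      by (rule polar_convex[where B = "B j"]) (fact Bm Bn that)+
    show "\<exists>b\<in>polar M (B j). AE x in M. 0 < b x" for j
      by (rule convex_concave_space.polar_unit[OF cc[of j]]) (auto simp: B_def)
    show "F' \<in> borel_measurable M" unfolding F'_def by measurable
    show "0 \<le> F' x" for x by (simp add: F'_def)
    fix u assume u: "\<And>j. u j \<in> polar M (B j)" "\<And>j. AE x in M. 0 < u j x"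
    note [measurable] = polarD(1)[OF u(1)]
    have "(\<integral>\<^sup>+x. ennreal (F' x * (\<Prod>j\<in>UNIV. u j x powr \<theta> j)) \<partial>M)
      = (\<integral>\<^sup>+x. ennreal (1 / K powr q) * ennreal (norm (F x) powr q * (\<Prod>j\<in>UNIV. u j x powr (q / r j))) \<partial>M)"
      using K by (intro nn_integral_cong) (simp add: F'_def \<theta>_def powr_divide flip: ennreal_mult')
    also have "\<dots> = ennreal (1 / K powr q) * (\<integral>\<^sup>+x. ennreal (norm (F x) powr q * (\<Prod>j\<in>UNIV. u j x powr (q / r j))) \<partial>M)"
      by (simp add: nn_integral_cmult)
    also have "\<dots> \<le> ennreal (1 / K powr q) * ennreal (K powr q)"
      using u unfolding B_def by (intro mult_left_mono le) auto
    also have "\<dots> = 1" using K by (simp flip: ennreal_mult')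
    finally show "(\<integral>\<^sup>+x. ennreal (F' x * (\<Prod>j\<in>UNIV. u j x powr \<theta> j)) \<partial>M) \<le> 1" .
  qed
  have main: "F \<in> carr (space_prod M X) \<and> nrm (space_prod M X) F \<le> ennreal (K * (1 + \<epsilon>))" if \<epsilon>: "0 < \<epsilon>" for \<epsilon>
  proof -
    \<comment> \<open>The loss \<open>1 + \<delta>\<close> is at the level of \<open>q\<close>-th
      powers and becomes \<open>1 + \<epsilon>\<close> after taking roots.\<close>
    define \<delta> where "\<delta> = (1 + \<epsilon>) powr q - 1"
    have \<delta>: "0 < \<delta>" using powr_less_mono2[OF q0, of 1 "1 + \<epsilon>"] \<epsilon> by (simp add: \<delta>_def)
    obtain v c where v: "\<And>j. v j \<in> borel_measurable M" "\<And>j x. 0 \<le> v j x"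
      "AE x in M. F' x \<le> (\<Prod>j\<in>UNIV. v j x powr \<theta> j)" "\<And>j. (0::real) < c j"
      "\<And>j b. b \<in> polar M (B j) \<Longrightarrow> (\<integral>\<^sup>+x. ennreal (v j x * b x) \<partial>M) \<le> ennreal (c j)"
      "(\<Sum>j\<in>UNIV. \<theta> j * c j) \<le> 1 + \<delta>"
      by (rule L.lozanovskii_factorization[OF \<delta>]) blast
    have pc: "(\<Prod>j\<in>UNIV. c j powr \<theta> j) \<le> (1 + \<epsilon>) powr q"
    proof -
      have "(\<Prod>j\<in>UNIV. c j powr \<theta> j) \<le> 1 + \<delta>"
        by (rule order_trans[OF prod_powr_le_weighted_sum v(6)])
          (auto simp: less_imp_le[OF L.\<theta>0] L.\<theta>1 less_imp_le[OF v(4)])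
      then show ?thesis by (simp add: \<delta>_def)
    qed
    define y where "y j x = v j x / c j" for j x
    have ym: "y j \<in> borel_measurable M" for j unfolding y_def using v(1) by measurable
    have y0: "0 \<le> y j x" for j x using v(2,4) by (simp add: y_def less_imp_le)
    have yB: "y j \<in> B j" for j
      unfolding B_def
    proof (rule solid_ball.bipolar[OF ball sf ym y0])
      fix g assume g: "g \<in> polar M (convex_concave_space.B M (X j) (r j))"
      show "(\<integral>\<^sup>+x. ennreal (y j x * g x) \<partial>M) \<le> 1"
        unfolding y_def using v(5)[of g j] g by (intro nn_integral_scale_le v polarD(1)[OF g]) (auto simp: B_def)
    qed
    note yX = convex_concave_space.BD(3,4)[OF cc yB[unfolded B_def]]
    \<comment> \<open>The scalar \<open>K * (1 + \<epsilon>)\<close> is spread evenly over the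
      factors.\<close>
    define \<kappa> where "\<kappa> = (K * (1 + \<epsilon>)) powr (1 / n)"
    have \<kappa>n: "(\<Prod>j\<in>(UNIV::'m set). \<kappa>) = K * (1 + \<epsilon>)"
      using K \<epsilon> n by (simp add: \<kappa>_def n_def[symmetric] powr_power)
    define g where "g j x = \<kappa> * y j x powr (1 / r j)" for j x
    have \<kappa>0: "0 \<le> \<kappa>" by (simp add: \<kappa>_def)
    have gX: "emb (g j) \<in> carr (X j)" "nrm (X j) (emb (g j)) \<le> ennreal \<kappa>" for j
      unfolding g_def
      using solid_space_emb_scale[OF convex_concave_space.solidX[OF cc[of j]] yX(1)[of j], of \<kappa>]
        mult_left_mono[OF yX(2)[of j], of "ennreal \<kappa>"] \<kappa>0 by simp_all
    have Fg: "AE x in M. norm (F x) \<le> (\<Prod>j\<in>UNIV. g j x)"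
      using v(3)
    proof eventually_elim
      case (elim x)
      have "(\<Prod>j\<in>UNIV. v j x powr \<theta> j) = (\<Prod>j\<in>UNIV. c j powr \<theta> j) * (\<Prod>j\<in>UNIV. y j x powr \<theta> j)"
        unfolding prod.distrib[symmetric] y_def
      proof (intro prod.cong refl)
        fix j
        show "v j x powr \<theta> j = c j powr \<theta> j * (v j x / c j) powr \<theta> j"
          using v(4)[of j] by (simp add: powr_mult[symmetric])
      qed
      also have "\<dots> \<le> (1 + \<epsilon>) powr q * (\<Prod>j\<in>UNIV. y j x powr \<theta> j)"
        by (intro mult_right_mono pc prod_nonneg) auto
      also have "(\<Prod>j\<in>UNIV. y j x powr \<theta> j) = (\<Prod>j\<in>UNIV. y j x powr (1 / r j)) powr q"
        by (simp add: \<theta>_def prod_powr_distrib powr_powr)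
      finally have "F' x \<le> ((1 + \<epsilon>) * (\<Prod>j\<in>UNIV. y j x powr (1 / r j))) powr q"
        using elim by (simp add: powr_mult)
      then have "norm (F x) / K \<le> (1 + \<epsilon>) * (\<Prod>j\<in>UNIV. y j x powr (1 / r j))"
      proof -
        have "0 \<le> (1 + \<epsilon>) * (\<Prod>j\<in>UNIV. y j x powr (1 / r j))"
          using \<epsilon> by (intro mult_nonneg_nonneg prod_nonneg) auto
        with q0 show "F' x \<le> ((1 + \<epsilon>) * (\<Prod>j\<in>UNIV. y j x powr (1 / r j))) powr q \<Longrightarrow> ?thesis"
          unfolding F'_def
          using powr_less_mono2[of q "(1 + \<epsilon>) * (\<Prod>j\<in>UNIV. y j x powr (1 / r j))" "norm (F x) / K"]
          by (meson not_less)
      qed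
      then have "norm (F x) \<le> K * (1 + \<epsilon>) * (\<Prod>j\<in>UNIV. y j x powr (1 / r j))"
        using K by (simp add: field_simps)
      then show ?case unfolding g_def prod.distrib \<kappa>n .
    qed
    have "AE x in M. 0 \<le> g j x" for j using \<kappa>0 by (simp add: g_def)
    note space_prodI[OF F gX(1) this Fg]
    moreover have "(\<Prod>j\<in>UNIV. nrm (X j) (emb (g j))) \<le> (\<Prod>j\<in>(UNIV::'m set). ennreal \<kappa>)"
      by (intro prod_mono_ennreal gX)
    moreover have "(\<Prod>j\<in>(UNIV::'m set). ennreal \<kappa>) = ennreal (K * (1 + \<epsilon>))"
      using \<kappa>0 by (simp add: prod_ennreal \<kappa>n[symmetric] ennreal_power)
    ultimately show ?thesis by auto
  qed
  show "F \<in> carr (space_prod M X)" using main[of 1] by simp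
  show "nrm (space_prod M X) F \<le> ennreal K"
  proof (rule ennreal_le_epsilon)
    fix e :: real assume e: "0 < e"
    then have "nrm (space_prod M X) F \<le> ennreal (K * (1 + e / K))" using main[of "e / K"] K by simp
    also have "\<dots> = ennreal K + ennreal e" using K e by (simp add: distrib_left ennreal_plus)
    finally show "nrm (space_prod M X) F \<le> ennreal K + ennreal e" .
  qed
qed

theorem theorem6p6:
  fixes M :: "'a measure" and \<E> :: "'a set set"
    and r :: "'m::finite \<Rightarrow> real" and s p :: "'m \<Rightarrow> ennreal"
    and r0 :: real and s0 p0 :: ennreal
    and V :: "'m \<Rightarrow> 'v set"
    and S :: "'m \<Rightarrow> 'v \<Rightarrow> 'a \<Rightarrow> 'k::{real_normed_field,second_countable_topology}"
    and T :: "('m \<Rightarrow> 'v) \<Rightarrow> 'a \<Rightarrow> 'k"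
    and \<phi> :: "('m \<Rightarrow> real) \<Rightarrow> real"
    and X :: "'m \<Rightarrow> ('a, 'k) fspace"
  assumes "\<And>j. 0 < r j"
    and "\<And>j. ennreal (r j) < s j"
    and "\<And>j. ennreal (r j) \<le> p j \<and> p j \<le> s j"
    and "inverse p0 = (\<Sum>j\<in>UNIV. inverse (p j))"
    and "1 / r0 = (\<Sum>j\<in>UNIV. 1 / r j)"
    and "inverse s0 = (\<Sum>j\<in>UNIV. inverse (s j))"
    and "sigma_finite_measure M"
    and "set_basis M \<E>"
    and "\<And>j. S j \<in> V j \<rightarrow> L0 M"
    and "T \<in> T_domain M \<E> p r s V S \<rightarrow> L0 M"
    and "increasing_nonneg \<phi>"
    and "\<And>w f. (\<And>j. w j \<in> Ap M \<E> (p j) (r j) (s j)) \<Longrightarrow>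
           (\<And>j. f j \<in> V j \<and> S j (f j) \<in> wLp M (p j) (w j)) \<Longrightarrow>
           wLnorm M p0 (\<lambda>x. \<Prod>j\<in>UNIV. w j x) (T f)
             \<le> ennreal (\<phi> (\<lambda>j. enn2real (Ap_const M \<E> (p j) (r j) (s j) (w j))))
               * (\<Prod>j\<in>UNIV. wLnorm M (p j) (w j) (S j (f j)))"
    and "\<And>j. qBfs M (X j)"
    and "\<And>j. p_convex (ennreal (r j)) (X j)"
    and "\<And>j. q_concave (s j) (X j)"
    and "\<And>j. p j \<noteq> ennreal (r j) \<Longrightarrow> maximal_bounded M \<E> (space_rs M (r j) (s j) (X j))"
    and "\<And>j. p j \<noteq> s j \<Longrightarrow> maximal_bounded M \<E> (kdual M (space_rs M (r j) (s j) (X j)))"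
  shows "\<forall>f. (\<forall>j. f j \<in> V j \<and> S j (f j) \<in> carr (X j)) \<longrightarrow>
           f \<in> T_domain M \<E> p r s V S \<and>
           T f \<in> carr (space_prod M X) \<and>
           nrm (space_prod M X) (T f)
             \<le> ennreal (2 powr (1 / r0 - enn2real (inverse s0))
                         * \<phi> (\<lambda>j. extrap_const M \<E> (p j) (r j) (s j) (X j)))
               * (\<Prod>j\<in>UNIV. nrm (X j) (S j (f j)))"
proof (intro allI impI)
  fix f assume f: "\<forall>j. f j \<in> V j \<and> S j (f j) \<in> carr (X j)"
  note r0 = assms(1) and rs = assms(2) and rps = assms(3) and p0 = assms(4) and r0_sum = assms(5) and s0 = assms(6)
    and sf = assms(7) and basis = assms(8) and S = assms(9) and T = assms(10) and \<phi> = assms(11) and bound = assms(12)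
    and X = assms(13) and cvx = assms(14) and ccv = assms(15) and bdd = assms(16) and bdd' = assms(17)
  have SL0: "S j (f j) \<in> L0 M" for j using S[of j] f by auto
  show "f \<in> T_domain M \<E> p r s V S \<and> T f \<in> carr (space_prod M X) \<and>
    nrm (space_prod M X) (T f) \<le> ennreal (2 powr (1 / r0 - enn2real (inverse s0))
       * \<phi> (\<lambda>j. extrap_const M \<E> (p j) (r j) (s j) (X j))) * (\<Prod>j\<in>UNIV. nrm (X j) (S j (f j)))"
  \<comment> \<open>An empty space admits an empty basis and no nonzero function. Every almost
    everywhere statement then holds, the constant weight 1 belongs to each class, and
    \<open>T f\<close> has norm 0.\<close>
  proof (cases "space M = {}")
    case True
    have AE_all: "AE x in M. P x" for P using True by (intro AE_I2) auto
    have "\<E> = {}"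
    proof (rule ccontr)
      assume "\<E> \<noteq> {}"
      then obtain E where "E \<in> sets M" "0 < emeasure M E" using basis by (auto simp: set_basis_def)
      with sets.sets_into_space[of E M] True show False by auto
    qed
    then have Ap: "(\<lambda>x. 1) \<in> Ap M \<E> (p j) (r j) (s j)" for j
      by (auto simp: Ap_def weight_def Ap_const_def bot_ennreal)
    have fin: "wLnorm M q (\<lambda>x. 1) g < \<infinity>" if "g \<in> L0 M" for q and g :: "'a \<Rightarrow> 'k"
    proof -
      note [measurable] = L0_norm_meas[OF that]
      have "esssup M (\<lambda>x. ennreal (norm (g x))) \<le> 0" by (intro esssup_I AE_all) simp
      moreover have "(\<integral>\<^sup>+x. epow (ennreal (norm (g x))) (enn2real q) \<partial>M) = (\<integral>\<^sup>+x. 0 \<partial>M)"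
        by (intro nn_integral_cong_AE AE_all)
      ultimately show ?thesis by (auto simp: wLnorm_def Lnorm_def intro: epow_less_top)
    qed
    have dom: "f \<in> T_domain M \<E> p r s V S"
      unfolding T_domain_def
    proof (intro Pi_I)
      fix j
      have "f j \<in> {v \<in> V j. S j v \<in> wLp M (p j) (\<lambda>x. 1)}" using f SL0 fin[OF SL0] by (simp add: wLp_def)
      then show "f j \<in> (\<Union>w\<in>Ap M \<E> (p j) (r j) (s j). {v \<in> V j. S j v \<in> wLp M (p j) w})"
        using Ap[of j] by blast
    qed
    then have TL0: "T f \<in> L0 M" using T by auto
    have zero: "(\<lambda>x. 0) \<in> carr (X j)" "nrm (X j) (\<lambda>x. 0) = 0" for j
      using X[of j] by (auto simp: qBfs_def quasi_normed_on_def)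
    note prodI = space_prodI[OF TL0, of "\<lambda>j x. 0" X]
    have "nrm (space_prod M X) (T f) \<le> (\<Prod>j\<in>UNIV. nrm (X j) (emb (\<lambda>x. 0)))"
      by (rule prodI(2)) (use zero AE_all in simp_all)
    also have "\<dots> = 0" using zero by simp
    finally have "nrm (space_prod M X) (T f) \<le> 0" .
    moreover have "T f \<in> carr (space_prod M X)"
      by (rule prodI(1)) (use zero AE_all in simp_all)
    ultimately show ?thesis using dom by simp
  next
    case False
    have ex: "extrapolation M (X j) (r j) (s j) \<E> (p j)" for j
      using r0 rs rps sf basis X cvx ccv bdd bdd' False
      by (intro extrapolation.intro convex_concave_space.intro measure_basis.intro extrapolation_axioms.intro) auto
    note cc = extrapolation.axioms(1)[OF ex]
    define \<alpha> where "\<alpha> j = extrapolation.\<alpha> (r j) (p j)" for j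
    define \<beta> where "\<beta> j = extrapolation.\<beta> (s j) (p j)" for j
    define C where "C j = extrap_const M \<E> (p j) (r j) (s j) (X j)" for j
    define B where "B j = convex_concave_space.B M (X j) (r j)" for j
    have C0: "0 \<le> C j" for j by (simp add: C_def extrap_const_def)
    have \<alpha>0: "0 \<le> \<alpha> j" for j unfolding \<alpha>_def by (rule extrapolation.\<alpha>0[OF ex])
    have p0_eq: "inverse p0 = ennreal (\<Sum>j\<in>UNIV. enn2real (inverse (p j)))"
      unfolding p0 by (subst extrapolation.inverse_p[OF ex]) (simp add: sum_ennreal)
    have s0_eq: "inverse s0 = ennreal (\<Sum>j\<in>UNIV. enn2real (inverse (s j)))"
      unfolding s0 by (subst extrapolation.inverse_s[OF ex]) (simp add: sum_ennreal)
    have p0_real: "enn2real (inverse p0) = (\<Sum>j\<in>UNIV. enn2real (inverse (p j)))"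
      and s0_real: "enn2real (inverse s0) = (\<Sum>j\<in>UNIV. enn2real (inverse (s j)))"
      unfolding p0_eq s0_eq by (simp_all add: sum_nonneg)
    have p0_nz: "p0 \<noteq> 0" using p0_eq by auto
    have sum\<alpha>: "1 / r0 = enn2real (inverse p0) + (\<Sum>j\<in>UNIV. \<alpha> j)"
      unfolding r0_sum p0_real \<alpha>_def extrapolation.\<alpha>_def[OF ex] by (simp add: sum_subtractf)
    have sum\<alpha>\<beta>: "(\<Sum>j\<in>UNIV. \<beta> j) + (\<Sum>j\<in>UNIV. \<alpha> j) = 1 / r0 - enn2real (inverse s0)"
      unfolding r0_sum s0_real \<alpha>_def \<beta>_def extrapolation.\<alpha>_def[OF ex] extrapolation.\<beta>_def[OF ex]
      by (simp add: sum_subtractf)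
    have "0 < 1 / r0" unfolding r0_sum using r0 by (intro sum_pos) auto
    then have r0_pos: "0 < r0" by simp
    obtain n where n: "\<And>j. 0 \<le> n j" "\<And>j. nrm (X j) (S j (f j)) = ennreal (n j)"
    proof -
      have "\<exists>t\<ge>0. nrm (X j) (S j (f j)) = ennreal t" for j
        using convex_concave_space.finX[OF cc, of "S j (f j)" j] f by (cases "nrm (X j) (S j (f j))") auto
      then show ?thesis using that by metis
    qed
    \<comment> \<open>The outcome of \<open>weight_exists\<close> for one coordinate, bundled so
      that weights can be chosen for all \<open>j\<close> at once.\<close>
    define Q where "Q N u j w A \<longleftrightarrow> w \<in> Ap M \<E> (p j) (r j) (s j) \<and> Ap_const M \<E> (p j) (r j) (s j) w \<le> ennreal (C j) \<and>
      wLnorm M (p j) w (S j (f j)) \<le> ennreal (2 powr \<beta> j * N j) \<and> A \<in> borel_measurable M \<and> (\<forall>x. 0 \<le> A x) \<and>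
      (0 < \<alpha> j \<longrightarrow> (\<integral>\<^sup>+x. ennreal (A x) \<partial>M) \<le> 2) \<and> (\<forall>x. 0 \<le> w x) \<and>
      (AE x in M. u j x powr (1 / r j) \<le> w x * A x powr \<alpha> j)"
      for N :: "'m \<Rightarrow> real" and u :: "'m \<Rightarrow> 'a \<Rightarrow> real" and j and w A :: "'a \<Rightarrow> real"
    have weights: "\<exists>w A. Q N u j w A"
      if N: "n j < N j" and u: "u j \<in> polar M (B j)" "AE x in M. 0 < u j x" for N u j
    proof -
      have "nrm (X j) (S j (f j)) < ennreal (N j)" using N n[of j] by (simp add: ennreal_less_iff)
      then obtain w A where "w \<in> Ap M \<E> (p j) (r j) (s j)" "Ap_const M \<E> (p j) (r j) (s j) w \<le> ennreal (C j)"
        "wLnorm M (p j) w (S j (f j)) \<le> ennreal (2 powr \<beta> j * N j)" "A \<in> borel_measurable M" "\<And>x. 0 \<le> A x"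
        "0 < \<alpha> j \<Longrightarrow> (\<integral>\<^sup>+x. ennreal (A x) \<partial>M) \<le> 2" "\<And>x. 0 \<le> w x" "AE x in M. u j x powr (1 / r j) \<le> w x * A x powr \<alpha> j"
        using extrapolation.weight_exists[OF ex, of "S j (f j)" j "N j" "u j"] f u(1) extrapolation.not_AE_0[OF ex u(2)]
        unfolding B_def C_def \<alpha>_def \<beta>_def by blast
      then show ?thesis unfolding Q_def by blast
    qed
    have wLp: "S j (f j) \<in> wLp M (p j) w" if "Q N u j w A" for N u j w A
    proof -
      have "wLnorm M (p j) w (S j (f j)) \<le> ennreal (2 powr \<beta> j * N j)" using that unfolding Q_def by blast
      then have "wLnorm M (p j) w (S j (f j)) < \<infinity>" by (rule le_less_trans) simp
      then show ?thesis using SL0 by (simp add: wLp_def)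
    qed
    \<comment> \<open>Any positive test function and any bound above the norm yield a weight, which
      already places \<open>f\<close> in the domain of \<open>T\<close>.\<close>
    have dom: "f \<in> T_domain M \<E> p r s V S"
      unfolding T_domain_def
    proof (intro Pi_I)
      fix j
      obtain u where u: "u \<in> polar M (B j)" "AE x in M. 0 < u x"
        unfolding B_def by (rule convex_concave_space.polar_unit[OF cc])
      then obtain w A where q: "Q (\<lambda>j. n j + 1) (\<lambda>j. u) j w A"
        using weights[of j "\<lambda>j. n j + 1" "\<lambda>j. u"] by auto
      show "f j \<in> (\<Union>w\<in>Ap M \<E> (p j) (r j) (s j). {v \<in> V j. S j v \<in> wLp M (p j) w})"
      proof (rule UN_I)
        show "w \<in> Ap M \<E> (p j) (r j) (s j)" using q unfolding Q_def by (rule conjunct1)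
        show "f j \<in> {v \<in> V j. S j v \<in> wLp M (p j) w}" using wLp[OF q] f by simp
      qed
    qed
    then have TL0: "T f \<in> L0 M" using T by auto
    note [measurable] = L0_norm_meas[OF TL0]
    have \<phi>0: "0 \<le> \<phi> C" using \<phi> C0 unfolding increasing_nonneg_def by blast
    \<comment> \<open>Both occurrences of \<open>e\<close> matter: \<open>n j + e\<close> gives the
      strict norm bound that the choice of weights requires, and the outer \<open>e\<close> keeps
      \<open>K e\<close> positive when \<phi> or a norm vanishes.\<close>
    define K where "K e = (\<phi> C * (\<Prod>j\<in>UNIV. 2 powr \<beta> j * (n j + e)) + e) * (\<Prod>j\<in>UNIV. 2 powr \<alpha> j)" for e
    have test: "(\<integral>\<^sup>+x. ennreal (norm (T f x) powr r0 * (\<Prod>j\<in>UNIV. u j x powr (r0 / r j))) \<partial>M) \<le> ennreal (K e powr r0)"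
      if e: "0 < e" and u: "\<And>j. u j \<in> polar M (B j)" "\<And>j. AE x in M. 0 < u j x" for e u
    proof -
      define N where "N j = n j + e" for j
      have N0: "0 < N j" for j using n(1)[of j] e by (simp add: N_def)
      have "\<exists>w A. Q N u j w A" for j by (rule weights[OF _ u]) (use e in \<open>simp add: N_def\<close>)
      then obtain w A where Q: "\<And>j. Q N u j (w j) (A j)" by metis
      have wA: "w j \<in> Ap M \<E> (p j) (r j) (s j)" "Ap_const M \<E> (p j) (r j) (s j) (w j) \<le> ennreal (C j)"
        "wLnorm M (p j) (w j) (S j (f j)) \<le> ennreal (2 powr \<beta> j * N j)" "A j \<in> borel_measurable M" "0 \<le> A j x"
        "0 < \<alpha> j \<Longrightarrow> (\<integral>\<^sup>+x. ennreal (A j x) \<partial>M) \<le> 2" "0 \<le> w j x"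
        "AE x in M. u j x powr (1 / r j) \<le> w j x * A j x powr \<alpha> j" for j x
        using Q[of j] unfolding Q_def by blast+
      have wm [measurable]: "w j \<in> borel_measurable M" for j using wA(1)[of j] by (simp add: Ap_def weight_def)
      note [measurable] = wA(4)
      define G where "G x = norm (T f x) * (\<Prod>j\<in>UNIV. w j x)" for x
      have G0: "0 \<le> G x" for x unfolding G_def by (intro mult_nonneg_nonneg prod_nonneg wA(7)) auto
      have [measurable]: "G \<in> borel_measurable M" unfolding G_def by measurable
      have "wLnorm M p0 (\<lambda>x. \<Prod>j\<in>UNIV. w j x) (T f)
        \<le> ennreal (\<phi> (\<lambda>j. enn2real (Ap_const M \<E> (p j) (r j) (s j) (w j)))) * (\<Prod>j\<in>UNIV. wLnorm M (p j) (w j) (S j (f j)))"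
        by (rule bound) (use wA(1) f wLp[OF Q] in auto)
      \<comment> \<open>The weights depend on the test functions, but their constants are at most
        \<open>C j\<close>; monotonicity of \<phi> makes the bound uniform in
        \<open>u\<close>.\<close>
      also have "\<dots> \<le> ennreal (\<phi> C) * (\<Prod>j\<in>UNIV. ennreal (2 powr \<beta> j * N j))"
      proof (intro mult_mono ennreal_leI increasing_nonneg_mono[OF \<phi>] prod_mono_ennreal wA(3))
        show "enn2real (Ap_const M \<E> (p j) (r j) (s j) (w j)) \<le> C j" for j
          using enn2real_mono[OF wA(2)[of j]] C0[of j] by simp
      qed auto
      also have "\<dots> = ennreal (\<phi> C * (\<Prod>j\<in>UNIV. 2 powr \<beta> j * N j))"
      proof -
        have "(\<Prod>j\<in>UNIV. ennreal (2 powr \<beta> j * N j)) = ennreal (\<Prod>j\<in>UNIV. 2 powr \<beta> j * N j)"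
          using N0 by (intro prod_ennreal mult_nonneg_nonneg) (auto simp: less_imp_le)
        then show ?thesis by (simp only: ennreal_mult'[OF \<phi>0])
      qed
      also have "\<dots> \<le> ennreal (\<phi> C * (\<Prod>j\<in>UNIV. 2 powr \<beta> j * N j) + e)"
        using e by (intro ennreal_leI) simp
      also have "wLnorm M p0 (\<lambda>x. \<Prod>j\<in>UNIV. w j x) (T f) = Lnorm M p0 G"
        using wA(7) by (simp add: wLnorm_def Lnorm_def G_def abs_mult prod_nonneg mult.commute)
      finally have GL: "Lnorm M p0 G \<le> ennreal (\<phi> C * (\<Prod>j\<in>UNIV. 2 powr \<beta> j * N j) + e)" .
      have pos: "0 < \<phi> C * (\<Prod>j\<in>UNIV. 2 powr \<beta> j * N j) + e"
        using e \<phi>0 N0 by (intro add_nonneg_pos mult_nonneg_nonneg prod_nonneg) (auto simp: less_imp_le)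
      have AE_u: "AE x in M. \<forall>j\<in>UNIV. u j x powr (1 / r j) \<le> w j x * A j x powr \<alpha> j"
        by (intro AE_finite_allI wA(8)) simp
      have "(\<integral>\<^sup>+x. ennreal (norm (T f x) powr r0 * (\<Prod>j\<in>UNIV. u j x powr (r0 / r j))) \<partial>M)
        \<le> (\<integral>\<^sup>+x. ennreal (G x powr r0 * (\<Prod>j\<in>UNIV. A j x powr (r0 * \<alpha> j))) \<partial>M)"
      proof (intro nn_integral_mono_AE)
        show "AE x in M. ennreal (norm (T f x) powr r0 * (\<Prod>j\<in>UNIV. u j x powr (r0 / r j)))
          \<le> ennreal (G x powr r0 * (\<Prod>j\<in>UNIV. A j x powr (r0 * \<alpha> j)))"
          using AE_u
        proof eventually_elim
          case (elim x)
          have "u j x powr (r0 / r j) \<le> w j x powr r0 * A j x powr (r0 * \<alpha> j)" for j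
          proof -
            have "(u j x powr (1 / r j)) powr r0 \<le> (w j x * A j x powr \<alpha> j) powr r0"
              using elim r0_pos by (intro powr_mono2) auto
            then show ?thesis by (simp add: powr_mult powr_powr mult.commute)
          qed
          then have "(\<Prod>j\<in>UNIV. u j x powr (r0 / r j)) \<le> (\<Prod>j\<in>UNIV. w j x powr r0 * A j x powr (r0 * \<alpha> j))"
            by (intro prod_mono) auto
          then have "norm (T f x) powr r0 * (\<Prod>j\<in>UNIV. u j x powr (r0 / r j))
            \<le> norm (T f x) powr r0 * (\<Prod>j\<in>UNIV. w j x powr r0 * A j x powr (r0 * \<alpha> j))"
            by (rule mult_left_mono) simp
          also have "\<dots> = G x powr r0 * (\<Prod>j\<in>UNIV. A j x powr (r0 * \<alpha> j))"
            by (simp add: G_def prod.distrib powr_mult prod_powr_distrib)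
          finally show ?case by (rule ennreal_leI)
        qed
      qed
      \<comment> \<open>Hoelder's inequality with \<open>r0 / p0\<close> for \<open>G\<close> and
        \<open>r0 * \<alpha> j\<close> for \<open>A j\<close>; by the definition of the \<alpha>
        these add up to 1.\<close>
      also have "\<dots> \<le> ennreal ((\<phi> C * (\<Prod>j\<in>UNIV. 2 powr \<beta> j * N j) + e) powr r0 * (\<Prod>j\<in>UNIV. 2 powr (r0 * \<alpha> j)))"
      proof (rule nn_integral_powr_prod_le[OF _ _ G0 wA(5) GL pos p0_nz r0_pos])
        show "r0 * enn2real (inverse p0) + (\<Sum>j\<in>UNIV. r0 * \<alpha> j) = 1"
          using sum\<alpha> r0_pos by (simp add: field_simps flip: sum_distrib_left)
        show "(\<integral>\<^sup>+x. ennreal (A j x) \<partial>M) \<le> 2" if "0 < r0 * \<alpha> j" for j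
          using that r0_pos by (intro wA(6)) (simp add: zero_less_mult_iff)
      qed (use r0_pos \<alpha>0 in auto)
      also have "(\<phi> C * (\<Prod>j\<in>UNIV. 2 powr \<beta> j * N j) + e) powr r0 * (\<Prod>j\<in>UNIV. 2 powr (r0 * \<alpha> j)) = K e powr r0"
        by (simp add: K_def N_def powr_mult prod_powr_distrib powr_powr mult.commute)
      finally show ?thesis .
    qed
    have K0: "0 < K e" if "0 < e" for e
      unfolding K_def using that \<phi>0 n(1)
      by (intro mult_pos_pos add_nonneg_pos mult_nonneg_nonneg prod_nonneg prod_pos) auto
    note memI = space_prod_memI[OF cc r0_sum TL0 K0 test[unfolded B_def]]
    have mem: "T f \<in> carr (space_prod M X)" by (rule memI(1)[of 1]) auto
    have le: "nrm (space_prod M X) (T f) \<le> ennreal (K (1 / real (Suc k)))" for k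
      by (rule memI(2)) auto
    \<comment> \<open>The auxiliary \<open>e\<close> is removed along \<open>1 / (k + 1)\<close>;
      the left side does not depend on it.\<close>
    have "(\<lambda>k. K (1 / real (Suc k))) \<longlonglongrightarrow> (\<phi> C * (\<Prod>j\<in>UNIV. 2 powr \<beta> j * (n j + 0)) + 0) * (\<Prod>j\<in>UNIV. 2 powr \<alpha> j)"
      unfolding K_def by (intro tendsto_intros tendsto_prod LIMSEQ_Suc[OF lim_1_over_n])
    then have "(\<lambda>k. ennreal (K (1 / real (Suc k)))) \<longlonglongrightarrow> ennreal (\<phi> C * (\<Prod>j\<in>UNIV. 2 powr \<beta> j * n j) * (\<Prod>j\<in>UNIV. 2 powr \<alpha> j))"
      by (intro tendsto_ennrealI) simp
    then have "nrm (space_prod M X) (T f) \<le> ennreal (\<phi> C * (\<Prod>j\<in>UNIV. 2 powr \<beta> j * n j) * (\<Prod>j\<in>UNIV. 2 powr \<alpha> j))"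
      by (rule LIMSEQ_le_const) (use le in blast)
    also have "\<phi> C * (\<Prod>j\<in>UNIV. 2 powr \<beta> j * n j) * (\<Prod>j\<in>UNIV. 2 powr \<alpha> j)
        = 2 powr (1 / r0 - enn2real (inverse s0)) * \<phi> C * (\<Prod>j\<in>UNIV. n j)"
    proof -
      have "(\<Prod>j\<in>(UNIV::'m set). 2 powr \<beta> j) * (\<Prod>j\<in>UNIV. 2 powr \<alpha> j) = (2::real) powr (1 / r0 - enn2real (inverse s0))"
        unfolding sum\<alpha>\<beta>[symmetric] by (simp add: powr_add powr_sum)
      then show ?thesis by (simp add: prod.distrib mult_ac)
    qed
    also have "ennreal (2 powr (1 / r0 - enn2real (inverse s0)) * \<phi> C * (\<Prod>j\<in>UNIV. n j))
        = ennreal (2 powr (1 / r0 - enn2real (inverse s0)) * \<phi> C) * (\<Prod>j\<in>UNIV. nrm (X j) (S j (f j)))"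
      using n \<phi>0 by (simp add: prod_ennreal ennreal_mult prod_nonneg)
    finally show ?thesis using dom mem by (simp add: C_def[abs_def])
  qed
qed

end
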